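(* Let $X$ and $Y$ be SCLCSs, let $n\ge2$, and let $f:[0,+\infty)^n\to X$ be a locally integrable function. Then the following holds. (i) Let $h_j\ge0$ for $1\le j\le n$, let $f_h(t_1,\dots,t_n):=f(t_1+h_1,\dots,t_n+h_n)$ for $t_1\ge0,\dots,t_n\ge0$, and let $H:=[h_1,+\infty)\times\dots\times[h_n,+\infty)$. If $(\lambda_1,\dots,\lambda_n)\in\Omega_{abs}(f)$, then $(\lambda_1,\dots,\lambda_n)\in\Omega_{abs}(f_h)$ and $$(\mathcal Lf_h)(\lambda_1,\dots,\lambda_n)=e^{\lambda_1h_1+\dots+\lambda_nh_n}(\mathcal Lf)(\lambda_1,\dots,\lambda_n)-e^{\lambda_1h_1+\dots+\lambda_nh_n}\int_{[0,+\infty)^n\setminus H}e^{-\lambda_1t_1-\dots-\lambda_nt_n}f(t_1,\dots,t_n)\,dt_1\cdots dt_n .$$ (ii) Let $h_j\ge0$ for $1\le j\le n$, let $f_{h-}(t_1,\dots,t_n):=f(t_1-h_1,\dots,t_n-h_n)$ if $t_1\ge h_1,\dots,t_n\ge h_n$, and $f_{h-}(t_1,\dots,t_n):=0$ if there is $j$ with $t_j<h_j$. Then $(\lambda_1,\dots,\lambda_n)\in\Omega_{abs}(f)$ [respectively $(\lambda_1,\dots,\lambda_n)\in\Omega(f)$] if and only if $(\lambda_1,\dots,\lambda_n)\in\Omega_{abs}(f_{h-})$ [respectively $(\lambda_1,\dots,\lambda_n)\in\Omega(f_{h-})$]; if this is the case, then $$(\mathcal Lf_{h-})(\lambda_1,\dots,\lambda_n)=e^{-\lambda_1h_1-\dots-\lambda_nh_n}(\mathcal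 Lf)(\lambda_1,\dots,\lambda_n).$$ (iii) If $T\in L(X,Y)$ and $(\lambda_1,\dots,\lambda_n)\in\Omega_{abs}(f)$ [respectively $\in\Omega(f)$], then $(\lambda_1,\dots,\lambda_n)\in\Omega_{abs}(Tf)$ [respectively $\in\Omega(Tf)$] and $T(\mathcal Lf)(\lambda_1,\dots,\lambda_n)=(\mathcal L(Tf))(\lambda_1,\dots,\lambda_n)$. (iv) If $z_j\in\mathbb C$ for $1\le j\le n$ and $f_z(t_1,\dots,t_n):=e^{-z_1t_1-\dots-z_nt_n}f(t_1,\dots,t_n)$ for $t_1\ge0,\dots,t_n\ge0$, then $(\lambda_1+z_1,\dots,\lambda_n+z_n)\in\Omega_{abs}(f)$ [respectively $\in\Omega(f)$] if and only if $(\lambda_1,\dots,\lambda_n)\in\Omega_{abs}(f_z)$ [respectively $\in\Omega(f_z)$]; if this is the case, then $(\mathcal Lf_z)(\lambda_1,\dots,\lambda_n)=(\mathcal Lf)(\lambda_1+z_1,\dots,\lambda_n+z_n)$. (v) Suppose that $\mathcal A$ is a closed multivalued linear operator between $X$ and $Y$, that $g:[0,+\infty)^n\to Y$ is locally integrable and that $g(t_1,\dots,t_n)\in\mathcal Af(t_1,\dots,t_n)$ for a.e. $(t_1,\dots,t_n)\in[0,+\infty)^n$. If $(\lambda_1,\dots,\lambda_n)\in\Omega(f)\cap\Omega(g)$, then $(\mathcal Lg)(\lambda_1,\dots,\lambda_n)\in\mathcal A(\mathcal Lf)(\lambda_1,\dots,\lambda_n)$.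
   Context: An SCLCS is a Hausdorff sequentially complete locally convex space over $\mathbb C$; $\circledast$ denotes a fundamental system of seminorms defining the topology of the space. $L(X,Y)$ is the space of continuous linear maps from $X$ to $Y$. Integration (with respect to Lebesgue measure): for a compact set $K$, a function $f:K\to X$ is integrable if there is a sequence $(f_k)$ of simple functions with $f_k(t)\to f(t)$ for a.e. $t\in K$ and such that for every $\epsilon>0$ and $p\in\circledast$ there is $k_0$ with $\int_K p(f_k-f_m)\le\epsilon$ for all $k,m\ge k_0$; then $\int_K f:=\lim_k\int_K f_k$. A function $f:[0,+\infty)^n\to X$ is locally integrable if its restriction to every compact subset is integrable; it is integrable if moreover $\int p(f)<\infty$ for all $p\in\circledast$, and then its integral is the limit of the integrals over an increasing sequence of compact sets exhausting the domain. For locally integrable $f$ and $\lambda=(\lambda_1,\dots,\lambda_n)\in\mathbb C^n$ put $I_\lambda(t_1,\dots,t_n):=\int_0^{t_1}\cdots\int_0^{t_n}e^{-\lambda_1s_1-\dots-\lambda_ns_n}f(s_1,\dots,s_n)\,ds_1\cdots ds_n$. $\Omega(f)$ is the set of all $\lambda$ for which the joint limit $(\mathcal Lf)(\lambda):=\lim_{t_1\to+\infty;\dots;t_n\to+\infty}I_\lambda(t_1,\dots,t_n)$ exists in the space (for every $\epsilon>0$ and $p\in\circledast$ there is $M>0$ with $p(I_\lambda(t_1,\dots,t_n)-(\mathcal Lf)(\lambda))<\epsilon$ whenever all $t_j>M$). $\Omega_{abs}(f)$ is the set of all $\lambda$ with $\int_{[0,+\infty)^n}p(e^{-\lambda_1t_1-\dots-\lambda_nt_n}f(t_1,\dots,t_n))\,dt_1\cdots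 dt_n<+\infty$ for every $p\in\circledast$; one has $\Omega_{abs}(f)\subseteq\Omega(f)$. A multivalued linear operator (MLO) $\mathcal A:X\to P(Y)$ is a map such that $D(\mathcal A):=\{x:\mathcal Ax\ne\emptyset\}$ is a linear subspace of $X$, $\mathcal Ax+\mathcal Ay\subseteq\mathcal A(x+y)$ for $x,y\in D(\mathcal A)$ and $c\,\mathcal Ax\subseteq\mathcal A(cx)$ for $c\in\mathbb C$, $x\in D(\mathcal A)$; equivalently, its graph $\{(x,y):y\in\mathcal Ax\}$ is a linear subspace of $X\times Y$. It is closed if its graph is closed in $X\times Y$. *)

theory Defs
  imports "HOL-Analysis.Analysis"
begin

text \<open>
  Hausdorff sequentially complete locally convex spaces over \<open>\<complex>\<close>, together with a system of
  seminorms defining the topology. The system need not be directed, hence the finite subsets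
  \<open>F\<close> in \<open>open_iff_seminorms\<close>; a directed (fundamental) system satisfies the axiom with
  singletons \<open>F\<close>.
\<close>

class sclcs = ab_group_add + t2_space +
  fixes scaleC :: "complex \<Rightarrow> 'a \<Rightarrow> 'a"  (infixr "*\<^sub>C" 75)
    and seminorms :: "('a \<Rightarrow> real) set"
  assumes scaleC_add_right: "a *\<^sub>C (x + y) = a *\<^sub>C x + a *\<^sub>C y"
    and scaleC_add_left: "(a + b) *\<^sub>C x = a *\<^sub>C x + b *\<^sub>C x"
    and scaleC_scaleC: "a *\<^sub>C b *\<^sub>C x = (a * b) *\<^sub>C x"
    and scaleC_one: "1 *\<^sub>C x = x"
    and seminorm_triangle: "p \<in> seminorms \<Longrightarrow> p (x + y) \<le> p x + p y"
    and seminorm_scaleC: "p \<in> seminorms \<Longrightarrow> p (a *\<^sub>C x) = cmod a * p x"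
    and open_iff_seminorms:
      "open U \<longleftrightarrow> (\<forall>x\<in>U. \<exists>F \<epsilon>. finite F \<and> F \<subseteq> seminorms \<and> \<epsilon> > 0 \<and>
                            {y. \<forall>p\<in>F. p (y - x) < \<epsilon>} \<subseteq> U)"
    and sequentially_complete:
      "(\<forall>p\<in>seminorms. \<forall>\<epsilon>>0. \<exists>N. \<forall>k\<ge>N. \<forall>m\<ge>N. p (u k - u m) < \<epsilon>) \<Longrightarrow> convergent u"

subsection \<open>Integration\<close>

definition simple_integral_on ::
    "'d::euclidean_space set \<Rightarrow> ('d \<Rightarrow> 'a::sclcs) \<Rightarrow> 'a" where
  "simple_integral_on K s =
     (\<Sum>x\<in>s ` K. complex_of_real (measure lebesgue {t \<in> K. s t = x}) *\<^sub>C x)"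

definition simple_approx ::
    "'d::euclidean_space set \<Rightarrow> ('d \<Rightarrow> 'a::sclcs) \<Rightarrow> (nat \<Rightarrow> 'd \<Rightarrow> 'a) \<Rightarrow> bool" where
  "simple_approx K f s \<longleftrightarrow>
     (\<forall>k. simple_function (lebesgue_on K) (s k)) \<and>
     (AE t in lebesgue_on K. (\<lambda>k. s k t) \<longlonglongrightarrow> f t) \<and>
     (\<forall>p\<in>seminorms. \<forall>\<epsilon>>0. \<exists>k0. \<forall>k\<ge>k0. \<forall>m\<ge>k0.
        (\<integral>\<^sup>+ t. ennreal (p (s k t - s m t)) \<partial>lebesgue_on K) \<le> ennreal \<epsilon>)"

text \<open>The next two notions are meant for compact \<open>K\<close>.\<close>

definition compact_integrable :: "'d::euclidean_space set \<Rightarrow> ('d \<Rightarrow> 'a::sclcs) \<Rightarrow> bool" where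
  "compact_integrable K f \<longleftrightarrow> (\<exists>s. simple_approx K f s)"

definition compact_integral :: "'d::euclidean_space set \<Rightarrow> ('d \<Rightarrow> 'a::sclcs) \<Rightarrow> 'a" where
  "compact_integral K f =
     (THE I. \<exists>s. simple_approx K f s \<and> (\<lambda>k. simple_integral_on K (s k)) \<longlonglongrightarrow> I)"

definition locally_integrable :: "'d::euclidean_space set \<Rightarrow> ('d \<Rightarrow> 'a::sclcs) \<Rightarrow> bool" where
  "locally_integrable D f \<longleftrightarrow> (\<forall>K. compact K \<and> K \<subseteq> D \<longrightarrow> compact_integrable K f)"

definition lcs_integrable :: "'d::euclidean_space set \<Rightarrow> ('d \<Rightarrow> 'a::sclcs) \<Rightarrow> bool" where
  "lcs_integrable D f \<longleftrightarrow> locally_integrable D f \<and>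
     (\<forall>p\<in>seminorms. (\<integral>\<^sup>+ t. ennreal (p (f t)) \<partial>lebesgue_on D) < \<infinity>)"

definition lcs_integral :: "'d::euclidean_space set \<Rightarrow> ('d \<Rightarrow> 'a::sclcs) \<Rightarrow> 'a" where
  "lcs_integral D f =
     (THE I. \<exists>K. (\<forall>i. compact (K i)) \<and> incseq K \<and> (\<Union>i::nat. K i) = D \<and>
                 (\<lambda>i. compact_integral (K i) f) \<longlonglongrightarrow> I)"

subsection \<open>The multidimensional Laplace transform\<close>

text \<open>Functions on \<open>[0,\<infinity>)\<^sup>n\<close> are total functions whose values off the orthant are irrelevant.\<close>

definition orthant :: "(real ^ 'n) set" where
  "orthant = {t. \<forall>j. 0 \<le> t $ j}"

definition pairing :: "complex ^ 'n \<Rightarrow> real ^ 'n \<Rightarrow> complex" where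
  "pairing lam t = (\<Sum>j\<in>UNIV. lam $ j * complex_of_real (t $ j))"

text \<open>
  \<open>I\<^sub>\<lambda>(t\<^sub>1,\<dots>,t\<^sub>n)\<close>: the integral \<open>\<integral>\<^sub>0\<^bsup>t\<^sub>1\<^esup>\<dots>\<integral>\<^sub>0\<^bsup>t\<^sub>n\<^esup>\<close> is the Lebesgue integral over the compact box
  \<open>[0,t\<^sub>1] \<times> \<dots> \<times> [0,t\<^sub>n]\<close>, which is \<open>cbox 0 t\<close>.
\<close>

definition laplace_partial ::
    "(real ^ 'n \<Rightarrow> 'a::sclcs) \<Rightarrow> complex ^ 'n \<Rightarrow> real ^ 'n \<Rightarrow> 'a" where
  "laplace_partial f lam t = compact_integral (cbox 0 t) (\<lambda>s. exp (- pairing lam s) *\<^sub>C f s)"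

definition has_laplace :: "(real ^ 'n \<Rightarrow> 'a::sclcs) \<Rightarrow> complex ^ 'n \<Rightarrow> 'a \<Rightarrow> bool" where
  "has_laplace f lam L \<longleftrightarrow>
     (\<forall>p\<in>seminorms. \<forall>\<epsilon>>0. \<exists>M>0. \<forall>t. (\<forall>j. t $ j > M) \<longrightarrow> p (laplace_partial f lam t - L) < \<epsilon>)"

definition laplace :: "(real ^ 'n \<Rightarrow> 'a::sclcs) \<Rightarrow> complex ^ 'n \<Rightarrow> 'a" where
  "laplace f lam = (THE L. has_laplace f lam L)"

text \<open>
  \<open>\<Omega>(f)\<close> and \<open>\<Omega>\<^sub>a\<^sub>b\<^sub>s(f)\<close> are only considered for locally integrable \<open>f\<close>; membership includes
  this requirement, so that the integrals involved are meaningful.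
\<close>

definition Omega :: "(real ^ 'n \<Rightarrow> 'a::sclcs) \<Rightarrow> (complex ^ 'n) set" where
  "Omega f = {lam. locally_integrable orthant f \<and> (\<exists>L. has_laplace f lam L)}"

definition Omega_abs :: "(real ^ 'n \<Rightarrow> 'a::sclcs) \<Rightarrow> (complex ^ 'n) set" where
  "Omega_abs f = {lam. locally_integrable orthant f \<and>
     (\<forall>p\<in>seminorms.
        (\<integral>\<^sup>+ t. ennreal (p (exp (- pairing lam t) *\<^sub>C f t)) \<partial>lebesgue_on orthant) < \<infinity>)}"

subsection \<open>Multivalued linear operators\<close>

definition mlo_domain :: "('a \<Rightarrow> 'b set) \<Rightarrow> 'a set" where
  "mlo_domain A = {x. A x \<noteq> {}}"

definition mlo :: "('a::sclcs \<Rightarrow> 'b::sclcs set) \<Rightarrow> bool" where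
  "mlo A \<longleftrightarrow> module.subspace (*\<^sub>C) (mlo_domain A) \<and>
     (\<forall>x\<in>mlo_domain A. \<forall>y\<in>mlo_domain A. {u + v | u v. u \<in> A x \<and> v \<in> A y} \<subseteq> A (x + y)) \<and>
     (\<forall>c. \<forall>x\<in>mlo_domain A. (\<lambda>u. c *\<^sub>C u) ` A x \<subseteq> A (c *\<^sub>C x))"

definition closed_mlo :: "('a::sclcs \<Rightarrow> 'b::sclcs set) \<Rightarrow> bool" where
  "closed_mlo A \<longleftrightarrow> mlo A \<and> closed {(x, y). y \<in> A x}"

end

theory Submission
  imports Defs
begin

text \<open>
  Everything rests on the estimate \<open>p (\<integral>f) \<le> \<integral>p(f)\<close>. It shows that the integral does not depend on
  the approximating sequence, and that integrals along two bounded exhaustions of the same set have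
  the same limit when \<open>\<integral>p(f) < \<infinity>\<close>; sequential completeness supplies the limit. Hence
  absolute convergence implies convergence, and (i) follows by splitting each box \<open>[0, t + h]\<close>
  into its intersections with \<open>H\<close> and with the complement of \<open>H\<close>. Parts (ii)--(iv) are identities
  between partial integrals that pass to the joint limit. For (v), the graph of \<open>\<A>\<close> is a closed
  subspace, and the distance to it with respect to a continuous seminorm is sublinear, so that the
  distance of \<open>(\<integral>f, \<integral>g)\<close> to the graph is at most the integral of the distance of \<open>(f, g)\<close>, which is
  zero.
\<close>

section \<open>Seminorms and convergence\<close>

text \<open>The seminorm system may be uncountable, so no diagonal argument can merge approximations
  made for single seminorms: the one sequence given by the definition has to serve all of them, and
  each estimate is made for a fixed seminorm or a finite sum of seminorms. No measurable structure
  on \<open>X\<close> is used; only scalar functions such as \<open>p (f t)\<close> are integrated.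
  The definition ties an approximating sequence to \<open>f\<close> by a.e. convergence alone;
  Fatou's lemma upgrades its Cauchy condition to convergence in mean, the form in which sums,
  operators and scalar factors are handled. A joint limit over n independent bounds is not the limit
  of a sequence. Its existence comes from small tails, from an identity between partial integrals or
  from continuity of \<open>T\<close>; its value can then be read off along boxes with upper corner
  \<open>(i, ..., i) + c\<close>. For (v) no separation theorem is invoked: a simple integral has
  nonnegative weights whose sum is at most the measure of the domain, so a pointwise distance can be
  integrated.\<close>

interpretation sclcs: vector_space "scaleC :: complex \<Rightarrow> 'a::sclcs \<Rightarrow> 'a"
  by unfold_locales (rule scaleC_add_right scaleC_add_left scaleC_scaleC scaleC_one)+

lemma seminorm_zero: "p \<in> seminorms \<Longrightarrow> p (0::'a::sclcs) = 0"
  using seminorm_scaleC[of p 0 0] by simp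

lemma seminorm_minus: "p \<in> seminorms \<Longrightarrow> p (- x) = p (x::'a::sclcs)"
  using seminorm_scaleC[of p "-1" x] by (simp add: scaleC_one)

lemma seminorm_minus_commute: "p \<in> seminorms \<Longrightarrow> p (x - y) = p (y - x::'a::sclcs)"
  using seminorm_minus[of p "x - y"] by simp

lemma seminorm_nonneg: "p \<in> seminorms \<Longrightarrow> 0 \<le> p (x::'a::sclcs)"
  using seminorm_triangle[of p x "- x"] by (simp add: seminorm_zero seminorm_minus)

lemma seminorm_triangle_sub: "p \<in> seminorms \<Longrightarrow> p (x - z) \<le> p (x - y) + p (y - z::'a::sclcs)"
  using seminorm_triangle[of p "x - y" "y - z"] by simp

lemma seminorm_le_add: "p \<in> seminorms \<Longrightarrow> p x \<le> p (x - y) + p (y::'a::sclcs)"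
  using seminorm_triangle[of p "x - y" "y"] by simp

lemma seminorm_sum:
  "p \<in> seminorms \<Longrightarrow> p (\<Sum>i\<in>I. x i :: 'a::sclcs) \<le> (\<Sum>i\<in>I. p (x i))"
  by (induction I rule: infinite_finite_induct)
     (auto simp: seminorm_zero intro: order_trans[OF seminorm_triangle])

lemma seminorm_abs_diff: "p \<in> seminorms \<Longrightarrow> \<bar>p x - p y\<bar> \<le> p (x - y::'a::sclcs)"
  using seminorm_le_add[of p x y] seminorm_le_add[of p y x] seminorm_minus_commute[of p x y]
  by linarith

lemma open_seminorm_ball:
  assumes "p \<in> seminorms"
  shows "open {y::'a::sclcs. p (y - x) < \<epsilon>}"
  unfolding open_iff_seminorms
proof
  fix z assume z: "z \<in> {y. p (y - x) < \<epsilon>}"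
  have "p (y - x) < \<epsilon>" if "p (y - z) < \<epsilon> - p (z - x)" for y
    using that seminorm_triangle_sub[OF assms, of y x z] by linarith
  then show "\<exists>F \<epsilon>'. finite F \<and> F \<subseteq> seminorms \<and> \<epsilon>' > 0 \<and>
      {y. \<forall>p\<in>F. p (y - z) < \<epsilon>'} \<subseteq> {y. p (y - x) < \<epsilon>}"
    using assms z by (intro exI[of _ "{p}"] exI[of _ "\<epsilon> - p (z - x)"]) auto
qed

lemma nhds_basis_seminorms:
  assumes "open U" "x \<in> U"
  obtains F \<epsilon> where "finite F" "F \<subseteq> seminorms" "\<epsilon> > 0" "{y. \<forall>p\<in>F. p (y - x) < \<epsilon>} \<subseteq> (U::'a::sclcs set)"
proof -
  from assms have "\<exists>F \<epsilon>. finite F \<and> F \<subseteq> seminorms \<and> \<epsilon> > 0 \<and> {y. \<forall>p\<in>F. p (y - x) < \<epsilon>} \<subseteq> U"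
    using open_iff_seminorms[of U] by simp
  then show ?thesis
    using that by auto
qed

text \<open>A basic neighbourhood involves only finitely many seminorms, so the finitely many
  eventual statements can be intersected.\<close>

lemma tendsto_iff_seminorms:
  fixes u :: "'i \<Rightarrow> 'a::sclcs"
  shows "(u \<longlongrightarrow> l) \<F> \<longleftrightarrow> (\<forall>p\<in>seminorms. ((\<lambda>i. p (u i - l)) \<longlongrightarrow> 0) \<F>)"
proof safe
  fix p :: "'a \<Rightarrow> real" assume u: "(u \<longlongrightarrow> l) \<F>" and p: "p \<in> seminorms"
  show "((\<lambda>i. p (u i - l)) \<longlongrightarrow> 0) \<F>"
  proof (rule tendstoI)
    fix e :: real assume "e > 0"
    then have "\<forall>\<^sub>F i in \<F>. u i \<in> {y. p (y - l) < e}"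
      by (intro topological_tendstoD[OF u] open_seminorm_ball p) (simp add: seminorm_zero p)
    then show "\<forall>\<^sub>F i in \<F>. dist (p (u i - l)) 0 < e"
      by eventually_elim (simp add: seminorm_nonneg p)
  qed
next
  assume lim: "\<forall>p\<in>seminorms. ((\<lambda>i. p (u i - l)) \<longlongrightarrow> 0) \<F>"
  show "(u \<longlongrightarrow> l) \<F>"
  proof (rule topological_tendstoI)
    fix U :: "'a set" assume "open U" "l \<in> U"
    then obtain F e where F: "finite F" "F \<subseteq> seminorms" "e > 0" "{y. \<forall>p\<in>F. p (y - l) < e} \<subseteq> U"
      by (rule nhds_basis_seminorms)
    have "\<forall>\<^sub>F i in \<F>. \<forall>p\<in>F. p (u i - l) < e"
      using F lim by (intro eventually_ball_finite) (auto intro: order_tendstoD)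
    then show "\<forall>\<^sub>F i in \<F>. u i \<in> U"
      by eventually_elim (use F in auto)
  qed
qed

lemma tendsto_seminorm:
  assumes "p \<in> seminorms" "(u \<longlongrightarrow> l) \<F>"
  shows "((\<lambda>i. p (u i)) \<longlongrightarrow> p (l::'a::sclcs)) \<F>"
proof -
  have *: "((\<lambda>i. p (u i - l)) \<longlongrightarrow> 0) \<F>"
    using assms by (simp add: tendsto_iff_seminorms)
  have "((\<lambda>i. p (u i) - p l) \<longlongrightarrow> 0) \<F>"
    by (rule Lim_null_comparison[OF _ *]) (simp add: seminorm_abs_diff assms(1))
  then show ?thesis
    by (rule LIM_zero_cancel)
qed

lemma tendsto_add_sclcs:
  assumes "(u \<longlongrightarrow> a) \<F>" "(v \<longlongrightarrow> b) \<F>"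
  shows "((\<lambda>i. u i + v i) \<longlongrightarrow> (a + b::'a::sclcs)) \<F>"
  unfolding tendsto_iff_seminorms
proof
  fix p :: "'a \<Rightarrow> real" assume p: "p \<in> seminorms"
  have *: "((\<lambda>i. p (u i - a) + p (v i - b)) \<longlongrightarrow> 0) \<F>"
    using assms p by (auto simp: tendsto_iff_seminorms intro: tendsto_add_zero)
  show "((\<lambda>i. p (u i + v i - (a + b))) \<longlongrightarrow> 0) \<F>"
    by (rule tendsto_sandwich[OF _ _ tendsto_const *])
       (use seminorm_triangle[OF p, of "u _ - a" "v _ - b"] in
         \<open>simp_all add: seminorm_nonneg p add_diff_add\<close>)
qed

text \<open>Scalars and vectors vary together, so the difference is routed through
  \<open>c i *\<^sub>C l\<close>; the factor \<open>cmod (c i)\<close> stays harmless because it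
  converges.\<close>

lemma tendsto_scaleC:
  assumes "(c \<longlongrightarrow> a) \<F>" "(u \<longlongrightarrow> l) \<F>"
  shows "((\<lambda>i. c i *\<^sub>C u i) \<longlongrightarrow> (a *\<^sub>C l::'a::sclcs)) \<F>"
  unfolding tendsto_iff_seminorms
proof
  fix p :: "'a \<Rightarrow> real" assume p: "p \<in> seminorms"
  have "((\<lambda>i. cmod (c i) * p (u i - l) + cmod (c i - a) * p l) \<longlongrightarrow> cmod a * 0 + 0 * p l) \<F>"
    using assms p by (intro tendsto_intros) (auto simp: tendsto_iff_seminorms LIM_zero tendsto_norm_zero)
  then have *: "((\<lambda>i. cmod (c i) * p (u i - l) + cmod (c i - a) * p l) \<longlongrightarrow> 0) \<F>"
    by simp
  have "p (c i *\<^sub>C u i - a *\<^sub>C l) \<le> cmod (c i) * p (u i - l) + cmod (c i - a) * p l" for i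
    using seminorm_triangle_sub[OF p, of "c i *\<^sub>C u i" "a *\<^sub>C l" "c i *\<^sub>C l"]
    by (simp add: seminorm_scaleC p flip: sclcs.scale_left_diff_distrib sclcs.scale_right_diff_distrib)
  then show "((\<lambda>i. p (c i *\<^sub>C u i - a *\<^sub>C l)) \<longlongrightarrow> 0) \<F>"
    by (intro tendsto_sandwich[OF _ _ tendsto_const *]) (auto simp: seminorm_nonneg p)
qed

lemma tendsto_diff_sclcs:
  assumes "(u \<longlongrightarrow> a) \<F>" "(v \<longlongrightarrow> b) \<F>"
  shows "((\<lambda>i. u i - v i) \<longlongrightarrow> (a - b::'a::sclcs)) \<F>"
  using tendsto_add_sclcs[OF assms(1) tendsto_scaleC[OF tendsto_const[of "-1"] assms(2)]] by simp

text \<open>The bound need not be a single seminorm, since the generating system need not be directed.\<close>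

lemma continuous_linear_bound:
  fixes T :: "'a::sclcs \<Rightarrow> 'b::sclcs"
  assumes lin: "Vector_Spaces.linear (*\<^sub>C) (*\<^sub>C) T" and cont: "continuous_on UNIV T"
    and q: "q \<in> seminorms"
  obtains F C where "finite F" "F \<subseteq> seminorms" "C \<ge> 0" "\<And>x. q (T x) \<le> C * (\<Sum>p\<in>F. p x)"
proof -
  interpret T: Vector_Spaces.linear "(*\<^sub>C)" "(*\<^sub>C)" T by fact
  have "open (T -` {y. q (y - 0) < 1} \<inter> UNIV)"
    using cont open_seminorm_ball[OF q, of 0 1]
    unfolding continuous_on_open_vimage[OF open_UNIV] by blast
  moreover have "0 \<in> T -` {y. q (y - 0) < 1} \<inter> UNIV"
    by (simp add: seminorm_zero q T.zero)
  ultimately obtain F e where F: "finite F" "F \<subseteq> seminorms" "e > 0"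
    "{y. \<forall>p\<in>F. p (y - 0) < e} \<subseteq> T -` {y. q (y - 0) < 1} \<inter> UNIV"
    by (rule nhds_basis_seminorms)
  have *: "q (T x) < 1" if "\<And>p. p \<in> F \<Longrightarrow> p x < e" for x
    using F(4) that by auto
  show thesis
  proof (rule that[of F "2 / e"])
    fix x
    let ?M = "\<Sum>p\<in>F. p x"
    have M: "0 \<le> ?M" "\<And>p. p \<in> F \<Longrightarrow> p x \<le> ?M"
      using F(1,2) seminorm_nonneg by (auto intro!: sum_nonneg member_le_sum)
    have "q (T x) \<le> 2 / e * ?M + d" if d: "d > 0" for d
    proof -
      \<comment> \<open>\<open>N\<close> is the sum of the seminorms enlarged by
        \<open>e * d / 2\<close>: it is positive even where all seminorms in \<open>F\<close>
        vanish. Scaling by \<open>e / (2 * N)\<close> brings every \<open>p x\<close> down to at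
        most \<open>e / 2\<close>, and the enlargement returns as the summand \<open>d\<close>,
        which is arbitrary.\<close>
      define N where "N = ?M + e * d / 2"
      have N: "N > 0" using M d F(3) by (simp add: N_def add_nonneg_pos)
      define c where "c = complex_of_real (e / (2 * N))"
      have c: "cmod c = e / (2 * N)"
        using N F(3) by (simp add: c_def norm_divide norm_mult)
      have "p (c *\<^sub>C x) < e" if "p \<in> F" for p
      proof -
        have "p x \<le> N" using M that d F(3) unfolding N_def by (smt (verit) divide_pos_pos mult_pos_pos)
        then have "e / (2 * N) * p x \<le> e / (2 * N) * N"
          using N F(3) by (intro mult_left_mono) auto
        also have "\<dots> < e" using N F(3) by simp
        finally show ?thesis using that F(2) by (simp add: seminorm_scaleC subset_iff c)
      qed
      then have "q (T (c *\<^sub>C x)) < 1" by (rule *)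
      then have "e / (2 * N) * q (T x) < 1" by (simp add: T.scale seminorm_scaleC q c)
      then have "q (T x) < 2 * N / e" using N F(3) by (simp add: field_simps)
      also have "2 * N / e = 2 / e * ?M + d" using F(3) by (simp add: N_def field_simps)
      finally show ?thesis by simp
    qed
    then show "q (T x) \<le> 2 / e * ?M" by (rule field_le_epsilon)
  qed (use F(1-3) in auto)
qed

lemma convergent_if_Cauchy:
  fixes u :: "nat \<Rightarrow> 'a::sclcs"
  assumes "\<And>p e. p \<in> seminorms \<Longrightarrow> e > 0 \<Longrightarrow> \<exists>N. \<forall>k\<ge>N. \<forall>m\<ge>N. p (u k - u m) < e"
  obtains l where "u \<longlonglongrightarrow> l"
proof -
  have "convergent u"
    by (rule sequentially_complete) (use assms in blast)
  then show ?thesis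
    using that unfolding convergent_def by auto
qed

text \<open>Matches the bound with \<open>\<le>\<close> in the definition of
  \<open>simple_approx\<close> with the notion of convergence for which limit rules exist.\<close>

lemma ennreal_tendsto_0_iff_le:
  "(u \<longlongrightarrow> (0::ennreal)) \<F> \<longleftrightarrow> (\<forall>\<epsilon>>0. \<forall>\<^sub>F k in \<F>. u k \<le> ennreal \<epsilon>)"
proof safe
  fix e :: real assume "(u \<longlongrightarrow> 0) \<F>" "e > 0"
  then show "\<forall>\<^sub>F k in \<F>. u k \<le> ennreal e"
    using order_tendstoD(2)[of u 0 \<F> "ennreal e"] by (auto elim: eventually_mono)
next
  assume *: "\<forall>\<epsilon>>0. \<forall>\<^sub>F k in \<F>. u k \<le> ennreal \<epsilon>"
  show "(u \<longlongrightarrow> 0) \<F>"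
  proof (rule order_tendstoI)
    fix a :: ennreal assume "0 < a"
    then obtain b where b: "0 < b" "b < a"
      using dense by blast
    then obtain e where e: "b = ennreal e" "e > 0"
      by (cases b) auto
    then show "\<forall>\<^sub>F k in \<F>. u k < a"
      using *[rule_format, OF e(2)] b(2) e(1) by (auto elim!: eventually_mono)
  qed simp
qed

text \<open>Allows a real quantity to be controlled by nonnegative integrals without first showing
  that each of these is finite.\<close>

lemma tendsto_0_if_ennreal_le:
  fixes u :: "'i \<Rightarrow> real"
  assumes "\<And>i. 0 \<le> u i" "\<And>i. ennreal (u i) \<le> v i" "(v \<longlongrightarrow> 0) \<F>"
  shows "(u \<longlongrightarrow> 0) \<F>"
proof -
  have "((\<lambda>i. ennreal (u i)) \<longlongrightarrow> ennreal 0) \<F>"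
    unfolding ennreal_0
    by (rule tendsto_sandwich[OF _ _ tendsto_const assms(3)]) (use assms(2) in simp_all)
  then show ?thesis
    by (rule tendsto_ennrealD) (use assms in auto)
qed

section \<open>Almost everywhere limits\<close>

text \<open>This is completeness of Lebesgue measure; the restriction to \<open>K\<close> is removed
  by extending both functions by zero.\<close>

lemma borel_measurable_lebesgue_on_AE:
  fixes u v :: "'d::euclidean_space \<Rightarrow> real"
  assumes K: "K \<in> sets lebesgue" and u: "u \<in> borel_measurable (lebesgue_on K)"
    and ae: "AE t in lebesgue_on K. u t = v t"
  shows "v \<in> borel_measurable (lebesgue_on K)"
proof -
  have *: "w \<in> borel_measurable (lebesgue_on K) \<longleftrightarrow>
      (\<lambda>t. if t \<in> K then w t else 0) \<in> borel_measurable lebesgue" for w :: "'d \<Rightarrow> real"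
    using K by (intro measurable_restrict_space_iff) auto
  have "AE t in lebesgue. (if t \<in> K then u t else 0) = (if t \<in> K then v t else 0)"
    using ae K by (subst (asm) AE_restrict_space_iff) auto
  with u show ?thesis
    unfolding * by (rule borel_measurable_AE)
qed

lemma borel_measurable_lebesgue_on_AE_limit:
  fixes u :: "nat \<Rightarrow> 'd::euclidean_space \<Rightarrow> real"
  assumes K: "K \<in> sets lebesgue" and u: "\<And>k. u k \<in> borel_measurable (lebesgue_on K)"
    and ae: "AE t in lebesgue_on K. (\<lambda>k. u k t) \<longlonglongrightarrow> v t"
  shows "v \<in> borel_measurable (lebesgue_on K)"
proof (rule borel_measurable_lebesgue_on_AE[OF K])
  \<comment> \<open>\<open>lim\<close> is a total function, so it is measurable everywhere, also on
    the null set where the sequence may diverge.\<close>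
  show "(\<lambda>t. lim (\<lambda>k. u k t)) \<in> borel_measurable (lebesgue_on K)"
    using u by (rule borel_measurable_lim_metric)
  show "AE t in lebesgue_on K. lim (\<lambda>k. u k t) = v t"
    using ae by eventually_elim (rule limI)
qed

text \<open>\<open>simple_approx\<close> without its Cauchy condition. This much already yields
  measurability of seminorms, and it is stable under sums and differences without any
  estimate.\<close>

definition ae_simple_limit ::
    "'d::euclidean_space set \<Rightarrow> ('d \<Rightarrow> 'a::sclcs) \<Rightarrow> (nat \<Rightarrow> 'd \<Rightarrow> 'a) \<Rightarrow> bool" where
  "ae_simple_limit K f s \<longleftrightarrow> (\<forall>k. simple_function (lebesgue_on K) (s k)) \<and>
     (AE t in lebesgue_on K. (\<lambda>k. s k t) \<longlonglongrightarrow> f t)"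

text \<open>\<open>\<phi>\<close> is arbitrary because only its finitely many values on the range of
  \<open>w\<close> matter; so seminorms can be composed with simple functions although their domain
  carries no measurable structure here.\<close>

lemma borel_measurable_simple:
  fixes \<phi> :: "'z \<Rightarrow> 'b::topological_space"
  shows "simple_function M w \<Longrightarrow> (\<lambda>t. \<phi> (w t)) \<in> borel_measurable M"
  by (rule borel_measurable_simple_function) (rule simple_function_compose1)

lemma ae_simple_limit_measurable:
  assumes "K \<in> sets lebesgue" "ae_simple_limit K f s" "p \<in> seminorms"
  shows "(\<lambda>t. p (f t)) \<in> borel_measurable (lebesgue_on K)"
proof (rule borel_measurable_lebesgue_on_AE_limit[OF assms(1)])
  show "(\<lambda>t. p (s k t)) \<in> borel_measurable (lebesgue_on K)" for k
    using assms(2) by (intro borel_measurable_simple) (simp add: ae_simple_limit_def)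
  have "AE t in lebesgue_on K. (\<lambda>k. s k t) \<longlonglongrightarrow> f t"
    using assms(2) by (simp add: ae_simple_limit_def)
  then show "AE t in lebesgue_on K. (\<lambda>k. p (s k t)) \<longlonglongrightarrow> p (f t)"
    by eventually_elim (rule tendsto_seminorm[OF assms(3)])
qed

lemma ae_simple_limit_simple:
  "simple_function (lebesgue_on K) w \<Longrightarrow> ae_simple_limit K w (\<lambda>_. w)"
  by (simp add: ae_simple_limit_def)

lemma ae_simple_limit_add:
  assumes "ae_simple_limit K f s" "ae_simple_limit K g r"
  shows "ae_simple_limit K (\<lambda>t. f t + g t) (\<lambda>k t. s k t + r k t)"
proof -
  have "AE t in lebesgue_on K. (\<lambda>k. s k t) \<longlonglongrightarrow> f t" "AE t in lebesgue_on K. (\<lambda>k. r k t) \<longlonglongrightarrow> g t"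
    using assms by (auto simp: ae_simple_limit_def)
  then have "AE t in lebesgue_on K. (\<lambda>k. s k t + r k t) \<longlonglongrightarrow> f t + g t"
    by eventually_elim (rule tendsto_add_sclcs)
  with assms show ?thesis
    by (auto simp: ae_simple_limit_def intro: simple_function_compose2)
qed

lemma ae_simple_limit_diff:
  assumes "ae_simple_limit K f s" "ae_simple_limit K g r"
  shows "ae_simple_limit K (\<lambda>t. f t - g t) (\<lambda>k t. s k t - r k t)"
proof -
  have "AE t in lebesgue_on K. (\<lambda>k. s k t) \<longlonglongrightarrow> f t" "AE t in lebesgue_on K. (\<lambda>k. r k t) \<longlonglongrightarrow> g t"
    using assms by (auto simp: ae_simple_limit_def)
  then have "AE t in lebesgue_on K. (\<lambda>k. s k t - r k t) \<longlonglongrightarrow> f t - g t"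
    by eventually_elim (rule tendsto_diff_sclcs)
  with assms show ?thesis
    by (auto simp: ae_simple_limit_def intro: simple_function_compose2)
qed

lemma seminorm_diff_measurable:
  assumes "K \<in> sets lebesgue" "ae_simple_limit K f s" "ae_simple_limit K g r" "p \<in> seminorms"
  shows "(\<lambda>t. p (f t - g t)) \<in> borel_measurable (lebesgue_on K)"
  by (rule ae_simple_limit_measurable[OF assms(1) ae_simple_limit_diff[OF assms(2,3)] assms(4)])

section \<open>Integrals of simple functions\<close>

lemma simple_function_level_lmeasurable:
  assumes "K \<in> lmeasurable" "simple_function (lebesgue_on K) w"
  shows "{t \<in> K. w t \<in> Z} \<in> lmeasurable"
proof -
  have "w -` Z \<inter> K \<in> sets (lebesgue_on K)"
    using simple_functionD(2)[OF assms(2), of Z] by simp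
  then have "{t \<in> K. w t \<in> Z} \<in> sets (lebesgue_on K)"
    by (rule back_subst[of "\<lambda>A. A \<in> _"]) auto
  then show ?thesis
    using assms(1) by (auto simp: sets_restrict_space_iff fmeasurableD intro: fmeasurableI2)
qed

text \<open>The sum on the right runs over the values of \<open>w\<close>, not of the composite; the
  level sets of the composite are disjoint unions of level sets of \<open>w\<close>. With
  \<open>w\<close> a pair of simple functions this provides a common refinement, which is how
  additivity is obtained.\<close>

lemma simple_integral_on_compose:
  fixes \<phi> :: "'z \<Rightarrow> 'a::sclcs"
  assumes K: "K \<in> lmeasurable" and w: "simple_function (lebesgue_on K) w"
  shows "simple_integral_on K (\<lambda>t. \<phi> (w t)) =
    (\<Sum>z\<in>w ` K. complex_of_real (measure lebesgue {t \<in> K. w t = z}) *\<^sub>C \<phi> z)"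
proof -
  have fin: "finite (w ` K)"
    using simple_functionD(1)[OF w] by simp
  have meas: "{t \<in> K. w t = z} \<in> lmeasurable" for z
    using simple_function_level_lmeasurable[OF K w, of "{z}"] by simp
  have lev: "measure lebesgue {t \<in> K. \<phi> (w t) = x} =
      (\<Sum>z | z \<in> w ` K \<and> \<phi> z = x. measure lebesgue {t \<in> K. w t = z})" for x
  proof -
    have "{t \<in> K. \<phi> (w t) = x} = (\<Union>z\<in>{z \<in> w ` K. \<phi> z = x}. {t \<in> K. w t = z})"
      by auto
    also have "measure lebesgue \<dots> = (\<Sum>z | z \<in> w ` K \<and> \<phi> z = x. measure lebesgue {t \<in> K. w t = z})"
      using fin fmeasurableD[OF meas] fmeasurableD2[OF meas]
      by (intro measure_finite_Union) (auto simp: disjoint_family_on_def)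
    finally show ?thesis .
  qed
  have "(\<Sum>z\<in>w ` K. complex_of_real (measure lebesgue {t \<in> K. w t = z}) *\<^sub>C \<phi> z) =
    (\<Sum>x\<in>\<phi> ` w ` K. \<Sum>z | z \<in> w ` K \<and> \<phi> z = x.
        complex_of_real (measure lebesgue {t \<in> K. w t = z}) *\<^sub>C \<phi> z)"
    by (rule sum.image_gen[OF fin])
  also have "\<dots> = (\<Sum>x\<in>\<phi> ` w ` K. \<Sum>z | z \<in> w ` K \<and> \<phi> z = x.
        complex_of_real (measure lebesgue {t \<in> K. w t = z}) *\<^sub>C x)"
    by (intro sum.cong) auto
  also have "\<dots> = simple_integral_on K (\<lambda>t. \<phi> (w t))"
    by (simp add: simple_integral_on_def lev sclcs.scale_sum_left image_image)
  finally show ?thesis by simp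
qed

text \<open>Uses the same partition and weights as \<open>simple_integral_on_compose\<close>, so
  that vector sums and scalar bounds can be compared term by term. \<open>d\<close> is a seminorm in
  most uses, and the distance to the graph in the proof of (v).\<close>

lemma nn_integral_simple_compose:
  fixes d :: "'z \<Rightarrow> real"
  assumes K: "K \<in> lmeasurable" and w: "simple_function (lebesgue_on K) w" and d: "\<And>z. 0 \<le> d z"
  shows "(\<integral>\<^sup>+ t. ennreal (d (w t)) \<partial>lebesgue_on K) =
    ennreal (\<Sum>z\<in>w ` K. measure lebesgue {t \<in> K. w t = z} * d z)"
proof -
  have meas: "{t \<in> K. w t = z} \<in> lmeasurable" for z
    using simple_function_level_lmeasurable[OF K w, of "{z}"] by simp
  have sf: "simple_function (lebesgue_on K) (\<lambda>t. ennreal (d (w t)))"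
    by (rule simple_function_compose1[OF w])
  have "(\<integral>\<^sup>+ t. ennreal (d (w t)) \<partial>lebesgue_on K) =
    (\<Sum>z\<in>w ` K. ennreal (d z) * emeasure (lebesgue_on K) {t \<in> K. w t = z})"
    using simple_function_partition[OF sf w, of "\<lambda>z. ennreal (d z)"]
    by (simp add: nn_integral_eq_simple_integral[OF sf])
  also have "\<dots> = (\<Sum>z\<in>w ` K. ennreal (measure lebesgue {t \<in> K. w t = z} * d z))"
    using K meas by (intro sum.cong refl)
      (auto simp: emeasure_restrict_space fmeasurableD emeasure_eq_measure2 ennreal_mult d mult.commute)
  also have "\<dots> = ennreal (\<Sum>z\<in>w ` K. measure lebesgue {t \<in> K. w t = z} * d z)"
    by (intro sum_ennreal) (simp add: d)
  finally show ?thesis .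
qed

lemma simple_integral_on_diff:
  assumes K: "K \<in> lmeasurable" and "simple_function (lebesgue_on K) s" "simple_function (lebesgue_on K) r"
  shows "simple_integral_on K (\<lambda>t. s t - r t) = simple_integral_on K s - simple_integral_on K r"
proof -
  have w: "simple_function (lebesgue_on K) (\<lambda>t. (s t, r t))"
    using assms by (intro simple_function_Pair)
  show ?thesis
    using simple_integral_on_compose[OF K w, of "\<lambda>z. fst z - snd z"]
      simple_integral_on_compose[OF K w, of fst] simple_integral_on_compose[OF K w, of snd]
    by (simp add: sclcs.scale_right_diff_distrib sum_subtractf)
qed

lemma simple_integral_on_add:
  assumes K: "K \<in> lmeasurable" and "simple_function (lebesgue_on K) s" "simple_function (lebesgue_on K) r"
  shows "simple_integral_on K (\<lambda>t. s t + r t) = simple_integral_on K s + simple_integral_on K r"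
proof -
  have w: "simple_function (lebesgue_on K) (\<lambda>t. (s t, r t))"
    using assms by (intro simple_function_Pair)
  show ?thesis
    using simple_integral_on_compose[OF K w, of "\<lambda>z. fst z + snd z"]
      simple_integral_on_compose[OF K w, of fst] simple_integral_on_compose[OF K w, of snd]
    by (simp add: scaleC_add_right sum.distrib)
qed

lemma simple_integral_on_linear:
  assumes K: "K \<in> lmeasurable" and s: "simple_function (lebesgue_on K) s"
    and T: "Vector_Spaces.linear (*\<^sub>C) (*\<^sub>C) T"
  shows "simple_integral_on K (\<lambda>t. T (s t)) = T (simple_integral_on K s)"
proof -
  interpret T: Vector_Spaces.linear "(*\<^sub>C)" "(*\<^sub>C)" T by fact
  show ?thesis
    unfolding simple_integral_on_compose[OF K s]
    by (simp add: simple_integral_on_def T.sum T.scale)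
qed

lemma seminorm_simple_integral_on_le:
  fixes s :: "'d::euclidean_space \<Rightarrow> 'a::sclcs"
  assumes K: "K \<in> lmeasurable" and s: "simple_function (lebesgue_on K) s" and p: "p \<in> seminorms"
  shows "ennreal (p (simple_integral_on K s)) \<le> (\<integral>\<^sup>+ t. ennreal (p (s t)) \<partial>lebesgue_on K)"
  using seminorm_sum[OF p, of "\<lambda>x. complex_of_real (measure lebesgue {t \<in> K. s t = x}) *\<^sub>C x" "s ` K"]
  by (simp add: nn_integral_simple_compose[OF K s, of p] simple_integral_on_def seminorm_nonneg
      seminorm_scaleC p ennreal_leI)

section \<open>The integral over sets of finite measure\<close>

text \<open>From left to right, \<open>k\<close> is fixed and Fatou's lemma is applied as
  \<open>m\<close> tends to infinity: \<open>p (s k t - f t)\<close> is a.e. the limit of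
  \<open>p (s k t - s m t)\<close>. From right to left it is the triangle inequality through
  \<open>f\<close>.\<close>

lemma simple_approx_iff:
  fixes f :: "'d::euclidean_space \<Rightarrow> 'a::sclcs"
  assumes K: "K \<in> sets lebesgue"
  shows "simple_approx K f s \<longleftrightarrow> ae_simple_limit K f s \<and>
    (\<forall>p\<in>seminorms. (\<lambda>k. \<integral>\<^sup>+ t. ennreal (p (s k t - f t)) \<partial>lebesgue_on K) \<longlonglongrightarrow> 0)"
    (is "?L \<longleftrightarrow> _ \<and> ?R")
proof (cases "ae_simple_limit K f s")
  case True
  then have simple: "simple_function (lebesgue_on K) (s k)" for k
    by (simp add: ae_simple_limit_def)
  note lim = ae_simple_limit_simple[OF this]
  note [measurable] = seminorm_diff_measurable[OF K lim True] seminorm_diff_measurable[OF K lim lim]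
  have "?L \<longleftrightarrow> ?R"
  proof
    assume L: ?L
    show ?R
    proof (intro ballI ennreal_tendsto_0_iff_le[THEN iffD2] allI impI)
      fix p :: "'a \<Rightarrow> real" and e :: real assume p: "p \<in> seminorms" and "e > 0"
      with L obtain k0 where k0: "\<And>k m. k \<ge> k0 \<Longrightarrow> m \<ge> k0 \<Longrightarrow>
        (\<integral>\<^sup>+ t. ennreal (p (s k t - s m t)) \<partial>lebesgue_on K) \<le> ennreal e"
        unfolding simple_approx_def by blast
      have "(\<integral>\<^sup>+ t. ennreal (p (s k t - f t)) \<partial>lebesgue_on K) \<le> ennreal e" if "k \<ge> k0" for k
      proof -
        have ae: "AE t in lebesgue_on K. (\<lambda>k. s k t) \<longlonglongrightarrow> f t"
          using True by (simp add: ae_simple_limit_def)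
        have "AE t in lebesgue_on K. ennreal (p (s k t - f t)) = liminf (\<lambda>m. ennreal (p (s k t - s m t)))"
          using ae
        proof eventually_elim
          case (elim t)
          then have "(\<lambda>m. ennreal (p (s k t - s m t))) \<longlonglongrightarrow> ennreal (p (s k t - f t))"
            by (intro tendsto_ennrealI tendsto_seminorm[OF p] tendsto_diff_sclcs tendsto_const)
          then show ?case by (intro lim_imp_Liminf[symmetric]) auto
        qed
        then have "(\<integral>\<^sup>+ t. ennreal (p (s k t - f t)) \<partial>lebesgue_on K) =
          (\<integral>\<^sup>+ t. liminf (\<lambda>m. ennreal (p (s k t - s m t))) \<partial>lebesgue_on K)"
          by (rule nn_integral_cong_AE)
        also have "\<dots> \<le> liminf (\<lambda>m. \<integral>\<^sup>+ t. ennreal (p (s k t - s m t)) \<partial>lebesgue_on K)"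
          using p by (intro nn_integral_liminf) measurable
        also have "\<dots> \<le> limsup (\<lambda>m. \<integral>\<^sup>+ t. ennreal (p (s k t - s m t)) \<partial>lebesgue_on K)"
          by (intro Liminf_le_Limsup) simp
        also have "\<dots> \<le> ennreal e"
          using k0[OF that] by (intro Limsup_bounded) (auto simp: eventually_sequentially)
        finally show ?thesis .
      qed
      then show "\<forall>\<^sub>F k in sequentially. (\<integral>\<^sup>+ t. ennreal (p (s k t - f t)) \<partial>lebesgue_on K) \<le> ennreal e"
        by (auto simp: eventually_sequentially)
    qed
  next
    assume R: ?R
    have "\<exists>k0. \<forall>k\<ge>k0. \<forall>m\<ge>k0. (\<integral>\<^sup>+ t. ennreal (p (s k t - s m t)) \<partial>lebesgue_on K) \<le> ennreal e"
      if p: "p \<in> seminorms" and e: "e > 0" for p e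
    proof -
      from R p e have "\<forall>\<^sub>F k in sequentially. (\<integral>\<^sup>+ t. ennreal (p (s k t - f t)) \<partial>lebesgue_on K) \<le> ennreal (e / 2)"
        by (auto simp: ennreal_tendsto_0_iff_le)
      then obtain k0 where k0: "\<And>k. k \<ge> k0 \<Longrightarrow>
        (\<integral>\<^sup>+ t. ennreal (p (s k t - f t)) \<partial>lebesgue_on K) \<le> ennreal (e / 2)"
        by (auto simp: eventually_sequentially)
      have "(\<integral>\<^sup>+ t. ennreal (p (s k t - s m t)) \<partial>lebesgue_on K) \<le> ennreal e" if "k \<ge> k0" "m \<ge> k0" for k m
      proof -
        have "p (s k t - s m t) \<le> p (s k t - f t) + p (s m t - f t)" for t
          using seminorm_triangle_sub[OF p, of "s k t" "s m t" "f t"]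
            seminorm_minus_commute[OF p, of "s m t" "f t"] by simp
        then have "(\<integral>\<^sup>+ t. ennreal (p (s k t - s m t)) \<partial>lebesgue_on K) \<le>
          (\<integral>\<^sup>+ t. ennreal (p (s k t - f t)) + ennreal (p (s m t - f t)) \<partial>lebesgue_on K)"
          by (intro nn_integral_mono) (simp add: seminorm_nonneg p flip: ennreal_plus)
        also have "\<dots> = (\<integral>\<^sup>+ t. ennreal (p (s k t - f t)) \<partial>lebesgue_on K) +
            (\<integral>\<^sup>+ t. ennreal (p (s m t - f t)) \<partial>lebesgue_on K)"
          using p by (intro nn_integral_add) measurable
        also have "\<dots> \<le> ennreal (e / 2) + ennreal (e / 2)"
          using k0 that by (intro add_mono)
        also have "\<dots> = ennreal e"
          using e by (simp flip: ennreal_plus)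
        finally show ?thesis .
      qed
      then show ?thesis by blast
    qed
    with True show ?L
      by (auto simp: simple_approx_def ae_simple_limit_def)
  qed
  with True show ?thesis by simp
qed (auto simp: simple_approx_def ae_simple_limit_def)

lemma simple_approxD:
  assumes "K \<in> sets lebesgue" "simple_approx K f s"
  shows "ae_simple_limit K f s" "simple_function (lebesgue_on K) (s k)"
    "p \<in> seminorms \<Longrightarrow> (\<lambda>k. \<integral>\<^sup>+ t. ennreal (p (s k t - f t)) \<partial>lebesgue_on K) \<longlonglongrightarrow> 0"
  using assms by (auto simp: simple_approx_iff ae_simple_limit_def)

lemma seminorm_measurable_simple_approx:
  assumes "K \<in> sets lebesgue" "simple_approx K f s" "p \<in> seminorms"
  shows "(\<lambda>t. p (f t)) \<in> borel_measurable (lebesgue_on K)"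
    "(\<lambda>t. p (s k t)) \<in> borel_measurable (lebesgue_on K)"
    "(\<lambda>t. p (s k t - f t)) \<in> borel_measurable (lebesgue_on K)"
  using seminorm_diff_measurable[OF assms(1) ae_simple_limit_simple
      [OF simple_approxD(2)[OF assms(1,2), of k]] simple_approxD(1)[OF assms(1,2)] assms(3)]
    ae_simple_limit_measurable[OF assms(1) simple_approxD(1)[OF assms(1,2)] assms(3)]
    ae_simple_limit_measurable[OF assms(1) ae_simple_limit_simple
      [OF simple_approxD(2)[OF assms(1,2), of k]] assms(3)]
  by auto

lemma seminorm_measurable:
  assumes "K \<in> sets lebesgue" "compact_integrable K f" "p \<in> seminorms"
  shows "(\<lambda>t. p (f t)) \<in> borel_measurable (lebesgue_on K)"
  using assms seminorm_measurable_simple_approx(1) unfolding compact_integrable_def by blast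

text \<open>Both sequences are compared with \<open>f\<close> in mean, so no interleaved sequence
  has to be formed.\<close>

lemma seminorm_simple_integral_diff_tendsto_0:
  fixes f :: "'d::euclidean_space \<Rightarrow> 'a::sclcs"
  assumes K: "K \<in> lmeasurable" and s: "simple_approx K f s" and r: "simple_approx K f r"
    and p: "p \<in> seminorms"
  shows "(\<lambda>k. p (simple_integral_on K (s k) - simple_integral_on K (r k))) \<longlonglongrightarrow> 0"
proof (rule tendsto_0_if_ennreal_le)
  note KL = fmeasurableD[OF K]
  note [measurable] = seminorm_measurable_simple_approx[OF KL s p] seminorm_measurable_simple_approx[OF KL r p]
  fix k
  have "ennreal (p (simple_integral_on K (s k) - simple_integral_on K (r k))) \<le>
      (\<integral>\<^sup>+ t. ennreal (p (s k t - r k t)) \<partial>lebesgue_on K)"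
    using seminorm_simple_integral_on_le[OF K _ p, of "\<lambda>t. s k t - r k t"]
      simple_approxD(2)[OF KL s] simple_approxD(2)[OF KL r]
    by (simp add: simple_integral_on_diff[OF K] simple_function_compose2)
  also have "\<dots> \<le> (\<integral>\<^sup>+ t. ennreal (p (s k t - f t)) + ennreal (p (r k t - f t)) \<partial>lebesgue_on K)"
    using seminorm_triangle_sub[OF p, of "s k _" "r k _" "f _"]
      seminorm_minus_commute[OF p, of "r k _" "f _"]
    by (intro nn_integral_mono) (simp add: seminorm_nonneg p flip: ennreal_plus)
  also have "\<dots> = (\<integral>\<^sup>+ t. ennreal (p (s k t - f t)) \<partial>lebesgue_on K) +
      (\<integral>\<^sup>+ t. ennreal (p (r k t - f t)) \<partial>lebesgue_on K)"
    by (intro nn_integral_add) measurable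
  finally show "ennreal (p (simple_integral_on K (s k) - simple_integral_on K (r k))) \<le>
      (\<integral>\<^sup>+ t. ennreal (p (s k t - f t)) \<partial>lebesgue_on K) +
      (\<integral>\<^sup>+ t. ennreal (p (r k t - f t)) \<partial>lebesgue_on K)" .
next
  show "(\<lambda>k. (\<integral>\<^sup>+ t. ennreal (p (s k t - f t)) \<partial>lebesgue_on K) +
      (\<integral>\<^sup>+ t. ennreal (p (r k t - f t)) \<partial>lebesgue_on K)) \<longlonglongrightarrow> 0"
    using tendsto_add[OF simple_approxD(3)[OF fmeasurableD[OF K] s p]
        simple_approxD(3)[OF fmeasurableD[OF K] r p]] by simp
qed (simp add: seminorm_nonneg p)

text \<open>Resolves the definite description. The computation rules for integrals below exhibit one
  approximating sequence, compute the limit of its integrals and appeal to this fact.\<close>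

lemma compact_integral_unique:
  assumes K: "K \<in> lmeasurable" and s: "simple_approx K f s"
    and lim: "(\<lambda>k. simple_integral_on K (s k)) \<longlonglongrightarrow> I"
  shows "compact_integral K f = I"
  unfolding compact_integral_def
proof (rule the_equality)
  fix J assume "\<exists>s. simple_approx K f s \<and> (\<lambda>k. simple_integral_on K (s k)) \<longlonglongrightarrow> J"
  then obtain r where r: "simple_approx K f r" "(\<lambda>k. simple_integral_on K (r k)) \<longlonglongrightarrow> J"
    by blast
  have "(\<lambda>k. simple_integral_on K (r k) - simple_integral_on K (s k)) \<longlonglongrightarrow> 0"
    unfolding tendsto_iff_seminorms
    using seminorm_simple_integral_diff_tendsto_0[OF K r(1) s] by simp
  from tendsto_add_sclcs[OF this lim] have "(\<lambda>k. simple_integral_on K (r k)) \<longlonglongrightarrow> I"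
    by simp
  with r(2) show "J = I"
    by (rule LIMSEQ_unique)
qed (use s lim in blast)

lemma compact_integral_tendsto:
  fixes f :: "'d::euclidean_space \<Rightarrow> 'a::sclcs"
  assumes K: "K \<in> lmeasurable" and s: "simple_approx K f s"
  shows "(\<lambda>k. simple_integral_on K (s k)) \<longlonglongrightarrow> compact_integral K f"
proof -
  have "\<exists>N. \<forall>k\<ge>N. \<forall>m\<ge>N. p (simple_integral_on K (s k) - simple_integral_on K (s m)) < e"
    if p: "p \<in> seminorms" and e: "e > 0" for p and e :: real
  proof -
    obtain N where N: "\<And>k m. k \<ge> N \<Longrightarrow> m \<ge> N \<Longrightarrow>
        (\<integral>\<^sup>+ t. ennreal (p (s k t - s m t)) \<partial>lebesgue_on K) \<le> ennreal (e / 2)"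
      using s p half_gt_zero[OF e] unfolding simple_approx_def by meson
    have sf: "simple_function (lebesgue_on K) (s k)" for k
      using s by (simp add: simple_approx_def)
    have "p (simple_integral_on K (s k) - simple_integral_on K (s m)) < e" if "k \<ge> N" "m \<ge> N" for k m
    proof -
      have "ennreal (p (simple_integral_on K (s k) - simple_integral_on K (s m))) \<le> ennreal (e / 2)"
        using seminorm_simple_integral_on_le[OF K _ p, of "\<lambda>t. s k t - s m t"] N[OF that] sf
        by (simp add: simple_integral_on_diff[OF K] simple_function_compose2)
      then show ?thesis using e by (simp add: ennreal_le_iff)
    qed
    then show ?thesis by blast
  qed
  then obtain l where l: "(\<lambda>k. simple_integral_on K (s k)) \<longlonglongrightarrow> l"
    by (rule convergent_if_Cauchy)
  with compact_integral_unique[OF K s l] show ?thesis by simp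
qed

text \<open>The estimate for \<open>s k\<close> costs the extra term \<open>p (s k t - f t)\<close>,
  whose integral vanishes in the limit.\<close>

lemma seminorm_compact_integral_le:
  fixes f :: "'d::euclidean_space \<Rightarrow> 'a::sclcs"
  assumes K: "K \<in> lmeasurable" and f: "compact_integrable K f" and p: "p \<in> seminorms"
  shows "ennreal (p (compact_integral K f)) \<le> (\<integral>\<^sup>+ t. ennreal (p (f t)) \<partial>lebesgue_on K)"
proof -
  obtain s where s: "simple_approx K f s"
    using f by (auto simp: compact_integrable_def)
  note KL = fmeasurableD[OF K]
  note [measurable] = seminorm_measurable_simple_approx[OF KL s p]
  have "ennreal (p (simple_integral_on K (s k))) \<le>
    (\<integral>\<^sup>+ t. ennreal (p (s k t - f t)) \<partial>lebesgue_on K) + (\<integral>\<^sup>+ t. ennreal (p (f t)) \<partial>lebesgue_on K)" for k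
  proof -
    have "ennreal (p (simple_integral_on K (s k))) \<le> (\<integral>\<^sup>+ t. ennreal (p (s k t)) \<partial>lebesgue_on K)"
      by (rule seminorm_simple_integral_on_le[OF K simple_approxD(2)[OF KL s] p])
    also have "\<dots> \<le> (\<integral>\<^sup>+ t. ennreal (p (s k t - f t)) + ennreal (p (f t)) \<partial>lebesgue_on K)"
      using seminorm_le_add[OF p, of "s k _" "f _"]
      by (intro nn_integral_mono) (simp add: seminorm_nonneg p flip: ennreal_plus)
    also have "\<dots> = (\<integral>\<^sup>+ t. ennreal (p (s k t - f t)) \<partial>lebesgue_on K) + (\<integral>\<^sup>+ t. ennreal (p (f t)) \<partial>lebesgue_on K)"
      by (intro nn_integral_add) measurable
    finally show ?thesis .
  qed
  moreover have "(\<lambda>k. ennreal (p (simple_integral_on K (s k)))) \<longlonglongrightarrow> ennreal (p (compact_integral K f))"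
    by (intro tendsto_ennrealI tendsto_seminorm[OF p] compact_integral_tendsto[OF K s])
  moreover have "(\<lambda>k. (\<integral>\<^sup>+ t. ennreal (p (s k t - f t)) \<partial>lebesgue_on K) +
      (\<integral>\<^sup>+ t. ennreal (p (f t)) \<partial>lebesgue_on K)) \<longlonglongrightarrow> 0 + (\<integral>\<^sup>+ t. ennreal (p (f t)) \<partial>lebesgue_on K)"
    by (intro tendsto_add simple_approxD(3)[OF KL s p] tendsto_const)
  ultimately show ?thesis
    by (auto intro: LIMSEQ_le)
qed

text \<open>A single approximant at mean distance at most 1 suffices, since a simple function on a
  set of finite measure has a finite integral. The result provides the dominating function in
  \<open>compact_integrable_mult\<close>.\<close>

lemma seminorm_integral_finite:
  fixes f :: "'d::euclidean_space \<Rightarrow> 'a::sclcs"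
  assumes K: "K \<in> lmeasurable" and f: "compact_integrable K f" and p: "p \<in> seminorms"
  shows "(\<integral>\<^sup>+ t. ennreal (p (f t)) \<partial>lebesgue_on K) < \<infinity>"
proof -
  obtain s where s: "simple_approx K f s"
    using f by (auto simp: compact_integrable_def)
  note KL = fmeasurableD[OF K]
  note [measurable] = seminorm_measurable_simple_approx[OF KL s p]
  have "\<forall>\<^sub>F k in sequentially. (\<integral>\<^sup>+ t. ennreal (p (s k t - f t)) \<partial>lebesgue_on K) \<le> ennreal 1"
    using simple_approxD(3)[OF KL s p] by (simp only: ennreal_tendsto_0_iff_le zero_less_one)
  then obtain k where k: "(\<integral>\<^sup>+ t. ennreal (p (s k t - f t)) \<partial>lebesgue_on K) \<le> ennreal 1"
    by (auto simp: eventually_sequentially)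
  have "(\<integral>\<^sup>+ t. ennreal (p (f t)) \<partial>lebesgue_on K) \<le>
      (\<integral>\<^sup>+ t. ennreal (p (s k t - f t)) + ennreal (p (s k t)) \<partial>lebesgue_on K)"
    using seminorm_le_add[OF p, of "f _" "s k _"] seminorm_minus_commute[OF p, of "f _" "s k _"]
    by (intro nn_integral_mono) (simp add: seminorm_nonneg p flip: ennreal_plus)
  also have "\<dots> = (\<integral>\<^sup>+ t. ennreal (p (s k t - f t)) \<partial>lebesgue_on K) + (\<integral>\<^sup>+ t. ennreal (p (s k t)) \<partial>lebesgue_on K)"
    by (intro nn_integral_add) measurable
  also have "\<dots> < \<infinity>"
    using k nn_integral_simple_compose[OF K simple_approxD(2)[OF KL s, of k], of p] seminorm_nonneg[OF p]
    by (auto simp: ennreal_add_less_top order_le_less_trans)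
  finally show ?thesis .
qed

lemma simple_approx_cong_AE:
  assumes "simple_approx K f s" "AE t in lebesgue_on K. f t = g t"
  shows "simple_approx K g s"
proof -
  have "AE t in lebesgue_on K. (\<lambda>k. s k t) \<longlonglongrightarrow> f t"
    using assms(1) by (simp add: simple_approx_def)
  with assms(2) have "AE t in lebesgue_on K. (\<lambda>k. s k t) \<longlonglongrightarrow> g t"
    by eventually_elim simp
  with assms(1) show ?thesis
    by (simp add: simple_approx_def)
qed

lemma compact_integrable_cong:
  assumes "compact_integrable K f" "\<And>t. t \<in> K \<Longrightarrow> f t = g t"
  shows "compact_integrable K g"
proof -
  have "AE t in lebesgue_on K. f t = g t"
    using assms(2) by (auto intro!: AE_I2)
  with assms(1) show ?thesis
    by (auto simp: compact_integrable_def intro: simple_approx_cong_AE)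
qed

lemma compact_integral_cong:
  assumes "\<And>t. t \<in> K \<Longrightarrow> f t = g t"
  shows "compact_integral K f = compact_integral K g"
proof -
  have "AE t in lebesgue_on K. f t = g t" "AE t in lebesgue_on K. g t = f t"
    using assms by (auto intro!: AE_I2)
  then have "simple_approx K f s \<longleftrightarrow> simple_approx K g s" for s
    using simple_approx_cong_AE by blast
  then show ?thesis by (simp add: compact_integral_def)
qed

subsection \<open>Linearity\<close>

lemma simple_approx_add:
  fixes f :: "'d::euclidean_space \<Rightarrow> 'a::sclcs"
  assumes K: "K \<in> sets lebesgue" and s: "simple_approx K f s" and r: "simple_approx K g r"
  shows "simple_approx K (\<lambda>t. f t + g t) (\<lambda>k t. s k t + r k t)"
  unfolding simple_approx_iff[OF K]
proof (intro conjI ballI)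
  show "ae_simple_limit K (\<lambda>t. f t + g t) (\<lambda>k t. s k t + r k t)"
    by (intro ae_simple_limit_add simple_approxD[OF K] s r)
  fix p :: "'a \<Rightarrow> real" assume p: "p \<in> seminorms"
  note [measurable] = seminorm_measurable_simple_approx[OF K s p] seminorm_measurable_simple_approx[OF K r p]
  show "(\<lambda>k. \<integral>\<^sup>+ t. ennreal (p (s k t + r k t - (f t + g t))) \<partial>lebesgue_on K) \<longlonglongrightarrow> 0"
  proof (rule tendsto_sandwich[OF _ _ tendsto_const])
    show "\<forall>\<^sub>F k in sequentially. (\<integral>\<^sup>+ t. ennreal (p (s k t + r k t - (f t + g t))) \<partial>lebesgue_on K) \<le>
      (\<integral>\<^sup>+ t. ennreal (p (s k t - f t)) \<partial>lebesgue_on K) + (\<integral>\<^sup>+ t. ennreal (p (r k t - g t)) \<partial>lebesgue_on K)"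
    proof (rule always_eventually, rule allI)
      fix k
      have "(\<integral>\<^sup>+ t. ennreal (p (s k t + r k t - (f t + g t))) \<partial>lebesgue_on K) \<le>
        (\<integral>\<^sup>+ t. ennreal (p (s k t - f t)) + ennreal (p (r k t - g t)) \<partial>lebesgue_on K)"
        using seminorm_triangle[OF p, of "s k _ - f _" "r k _ - g _"]
        by (intro nn_integral_mono) (simp add: seminorm_nonneg p add_diff_add flip: ennreal_plus)
      also have "\<dots> = (\<integral>\<^sup>+ t. ennreal (p (s k t - f t)) \<partial>lebesgue_on K) + (\<integral>\<^sup>+ t. ennreal (p (r k t - g t)) \<partial>lebesgue_on K)"
        by (intro nn_integral_add) measurable
      finally show "(\<integral>\<^sup>+ t. ennreal (p (s k t + r k t - (f t + g t))) \<partial>lebesgue_on K) \<le>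
      (\<integral>\<^sup>+ t. ennreal (p (s k t - f t)) \<partial>lebesgue_on K) + (\<integral>\<^sup>+ t. ennreal (p (r k t - g t)) \<partial>lebesgue_on K)" .
    qed
    show "(\<lambda>k. (\<integral>\<^sup>+ t. ennreal (p (s k t - f t)) \<partial>lebesgue_on K) +
        (\<integral>\<^sup>+ t. ennreal (p (r k t - g t)) \<partial>lebesgue_on K)) \<longlonglongrightarrow> 0"
      using tendsto_add[OF simple_approxD(3)[OF K s p] simple_approxD(3)[OF K r p]] by simp
  qed simp
qed

lemma compact_integral_add:
  assumes K: "K \<in> lmeasurable" and f: "compact_integrable K f" and g: "compact_integrable K g"
  shows "compact_integral K (\<lambda>t. f t + g t) = compact_integral K f + compact_integral K g"
proof -
  obtain s r where s: "simple_approx K f s" and r: "simple_approx K g r"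
    using f g by (auto simp: compact_integrable_def)
  note KL = fmeasurableD[OF K]
  show ?thesis
    using tendsto_add_sclcs[OF compact_integral_tendsto[OF K s] compact_integral_tendsto[OF K r]]
    by (intro compact_integral_unique[OF K simple_approx_add[OF KL s r]])
       (simp add: simple_integral_on_add[OF K] simple_approxD[OF KL s] simple_approxD[OF KL r])
qed

text \<open>Sequential continuity of \<open>T\<close> carries over a.e. convergence; convergence in
  mean needs the quantitative bound \<open>continuous_linear_bound\<close>, with a finite sum of
  seminorms of the domain.\<close>

lemma simple_approx_linear:
  fixes f :: "'d::euclidean_space \<Rightarrow> 'a::sclcs" and T :: "'a \<Rightarrow> 'b::sclcs"
  assumes K: "K \<in> sets lebesgue" and s: "simple_approx K f s"
    and T: "Vector_Spaces.linear (*\<^sub>C) (*\<^sub>C) T" "continuous_on UNIV T"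
  shows "simple_approx K (\<lambda>t. T (f t)) (\<lambda>k t. T (s k t))"
  unfolding simple_approx_iff[OF K]
proof (intro conjI ballI)
  interpret T: Vector_Spaces.linear "(*\<^sub>C)" "(*\<^sub>C)" T by fact
  have "AE t in lebesgue_on K. (\<lambda>k. s k t) \<longlonglongrightarrow> f t"
    using s by (simp add: simple_approx_def)
  then have "AE t in lebesgue_on K. (\<lambda>k. T (s k t)) \<longlonglongrightarrow> T (f t)"
    by eventually_elim (auto intro: continuous_on_tendsto_compose[OF T(2)])
  then show "ae_simple_limit K (\<lambda>t. T (f t)) (\<lambda>k t. T (s k t))"
    using simple_function_compose1[OF simple_approxD(2)[OF K s], of T]
    by (simp add: ae_simple_limit_def)
  fix q :: "'b \<Rightarrow> real" assume q: "q \<in> seminorms"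
  obtain F C where F: "finite F" "F \<subseteq> seminorms" "C \<ge> 0" "\<And>x. q (T x) \<le> C * (\<Sum>p\<in>F. p x)"
    using continuous_linear_bound[OF T q] by blast
  have [measurable]: "(\<lambda>t. p (s k t - f t)) \<in> borel_measurable (lebesgue_on K)" if "p \<in> F" for p k
    using seminorm_measurable_simple_approx[OF K s] F(2) that by blast
  have nonneg: "p \<in> F \<Longrightarrow> 0 \<le> p x" for p x
    using F(2) seminorm_nonneg by blast
  show "(\<lambda>k. \<integral>\<^sup>+ t. ennreal (q (T (s k t) - T (f t))) \<partial>lebesgue_on K) \<longlonglongrightarrow> 0"
  proof (rule tendsto_sandwich[OF _ _ tendsto_const])
    show "\<forall>\<^sub>F k in sequentially. (\<integral>\<^sup>+ t. ennreal (q (T (s k t) - T (f t))) \<partial>lebesgue_on K) \<le>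
      ennreal C * (\<Sum>p\<in>F. \<integral>\<^sup>+ t. ennreal (p (s k t - f t)) \<partial>lebesgue_on K)"
    proof (rule always_eventually, rule allI)
      fix k
      have "(\<integral>\<^sup>+ t. ennreal (q (T (s k t) - T (f t))) \<partial>lebesgue_on K) \<le>
        (\<integral>\<^sup>+ t. ennreal C * (\<Sum>p\<in>F. ennreal (p (s k t - f t))) \<partial>lebesgue_on K)"
      proof (rule nn_integral_mono)
        fix t
        have "ennreal (q (T (s k t - f t))) \<le> ennreal (C * (\<Sum>p\<in>F. p (s k t - f t)))"
          using F(4) by (rule ennreal_leI)
        then show "ennreal (q (T (s k t) - T (f t))) \<le> ennreal C * (\<Sum>p\<in>F. ennreal (p (s k t - f t)))"
          using F(3) nonneg by (simp add: T.diff ennreal_mult sum_nonneg)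
      qed
      also have "\<dots> = ennreal C * (\<Sum>p\<in>F. \<integral>\<^sup>+ t. ennreal (p (s k t - f t)) \<partial>lebesgue_on K)"
        by (subst nn_integral_cmult, measurable, subst nn_integral_sum, measurable)
      finally show "(\<integral>\<^sup>+ t. ennreal (q (T (s k t) - T (f t))) \<partial>lebesgue_on K) \<le>
        ennreal C * (\<Sum>p\<in>F. \<integral>\<^sup>+ t. ennreal (p (s k t - f t)) \<partial>lebesgue_on K)" .
    qed
    have "(\<lambda>k. ennreal C * (\<Sum>p\<in>F. \<integral>\<^sup>+ t. ennreal (p (s k t - f t)) \<partial>lebesgue_on K)) \<longlonglongrightarrow>
        ennreal C * (\<Sum>p\<in>F. 0)"
      using F(2) by (intro ennreal_tendsto_cmult tendsto_sum simple_approxD(3)[OF K s]) auto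
    then show "(\<lambda>k. ennreal C * (\<Sum>p\<in>F. \<integral>\<^sup>+ t. ennreal (p (s k t - f t)) \<partial>lebesgue_on K)) \<longlonglongrightarrow> 0"
      by simp
  qed simp
qed

lemma compact_integrable_linear:
  assumes "K \<in> sets lebesgue" "compact_integrable K f"
    "Vector_Spaces.linear (*\<^sub>C) (*\<^sub>C) T" "continuous_on UNIV T"
  shows "compact_integrable K (\<lambda>t. T (f t))"
  using simple_approx_linear[OF assms(1) _ assms(3,4)] assms(2) unfolding compact_integrable_def by blast

lemma compact_integral_linear:
  assumes K: "K \<in> lmeasurable" and f: "compact_integrable K f"
    and T: "Vector_Spaces.linear (*\<^sub>C) (*\<^sub>C) T" "continuous_on UNIV T"
  shows "compact_integral K (\<lambda>t. T (f t)) = T (compact_integral K f)"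
proof -
  obtain s where s: "simple_approx K f s"
    using f by (auto simp: compact_integrable_def)
  note KL = fmeasurableD[OF K]
  have "(\<lambda>k. T (simple_integral_on K (s k))) \<longlonglongrightarrow> T (compact_integral K f)"
    by (rule continuous_on_tendsto_compose[OF T(2) compact_integral_tendsto[OF K s]]) auto
  then show ?thesis
    by (intro compact_integral_unique[OF K simple_approx_linear[OF KL s T]])
       (simp add: simple_integral_on_linear[OF K simple_approxD(2)[OF KL s] T(1)])
qed

lemma linear_scaleC: "Vector_Spaces.linear (*\<^sub>C) (*\<^sub>C) ((*\<^sub>C) c :: 'a::sclcs \<Rightarrow> 'a)"
  by unfold_locales (simp_all add: scaleC_add_right scaleC_scaleC mult.commute)

lemma continuous_on_scaleC: "continuous_on S ((*\<^sub>C) c :: 'a::sclcs \<Rightarrow> 'a)"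
  unfolding continuous_on_def by (auto intro: tendsto_scaleC tendsto_ident_at)

lemmas compact_integral_scaleC = compact_integral_linear[OF _ _ linear_scaleC continuous_on_scaleC]

subsection \<open>Dependence on the domain\<close>

lemma nn_integral_lebesgue_on_subset:
  fixes u :: "'d::euclidean_space \<Rightarrow> ennreal"
  assumes "K \<in> sets lebesgue" "A \<in> sets lebesgue" "A \<subseteq> K"
  shows "(\<integral>\<^sup>+ t. u t \<partial>lebesgue_on A) \<le> (\<integral>\<^sup>+ t. u t \<partial>lebesgue_on K)"
  using assms by (auto simp: nn_integral_restrict_space intro!: nn_integral_mono split: split_indicator)

lemma simple_approx_subset:
  fixes f :: "'d::euclidean_space \<Rightarrow> 'a::sclcs"
  assumes K: "K \<in> sets lebesgue" and A: "A \<in> sets lebesgue" "A \<subseteq> K" and s: "simple_approx K f s"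
  shows "simple_approx A f s"
proof -
  have "simple_function (lebesgue_on A) (s k)" for k
  proof -
    have sf: "simple_function (lebesgue_on K) (s k)"
      using s by (simp add: simple_approx_def)
    have "finite (s k ` A)"
      using simple_functionD(1)[OF sf] finite_subset[OF image_mono[OF A(2)]] by simp
    moreover have "s k -` {x} \<inter> A \<in> sets lebesgue" for x
    proof -
      have "s k -` {x} \<inter> K \<in> sets lebesgue"
        using simple_functionD(2)[OF sf, of "{x}"] K by (simp add: sets_restrict_space_iff)
      then have "(s k -` {x} \<inter> K) \<inter> A \<in> sets lebesgue"
        using A(1) by (rule sets.Int)
      moreover have "(s k -` {x} \<inter> K) \<inter> A = s k -` {x} \<inter> A"
        using A(2) by auto
      ultimately show ?thesis by simp
    qed
    ultimately show ?thesis
      using A(1) by (auto simp: simple_function_def sets_restrict_space_iff)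
  qed
  moreover have "AE t in lebesgue_on A. (\<lambda>k. s k t) \<longlonglongrightarrow> f t"
  proof -
    have "AE t in lebesgue. t \<in> K \<longrightarrow> (\<lambda>k. s k t) \<longlonglongrightarrow> f t"
      using s K by (simp add: simple_approx_def AE_restrict_space_iff)
    then have "AE t in lebesgue. t \<in> A \<longrightarrow> (\<lambda>k. s k t) \<longlonglongrightarrow> f t"
      by eventually_elim (use A(2) in auto)
    then show ?thesis
      using A(1) by (simp add: AE_restrict_space_iff)
  qed
  ultimately show ?thesis
    using s nn_integral_lebesgue_on_subset[OF K A] unfolding simple_approx_def by (meson order_trans)
qed

lemma compact_integrable_subset:
  "K \<in> sets lebesgue \<Longrightarrow> A \<in> sets lebesgue \<Longrightarrow> A \<subseteq> K \<Longrightarrow> compact_integrable K f \<Longrightarrow>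
    compact_integrable A f"
  using simple_approx_subset unfolding compact_integrable_def by blast

section \<open>Extension by zero and additivity over disjoint sets\<close>

lemma simple_approx_extend:
  fixes f :: "'d::euclidean_space \<Rightarrow> 'a::sclcs"
  assumes K: "K \<in> sets lebesgue" and A: "A \<in> sets lebesgue" "A \<subseteq> K" and s: "simple_approx A f s"
  shows "simple_approx K (\<lambda>t. if t \<in> A then f t else 0) (\<lambda>k t. if t \<in> A then s k t else 0)"
  unfolding simple_approx_def
proof (intro conjI allI impI ballI)
  fix k
  have sf: "simple_function (lebesgue_on A) (s k)"
    using s by (simp add: simple_approx_def)
  let ?w = "\<lambda>t. if t \<in> A then s k t else 0"
  have "?w ` K \<subseteq> insert 0 (s k ` A)" by auto
  then have "finite (?w ` K)"
    using simple_functionD(1)[OF sf] by (auto intro: finite_subset)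
  moreover have "?w -` {x} \<inter> K \<in> sets lebesgue" for x
  proof -
    have "s k -` {x} \<inter> A \<in> sets lebesgue"
      using simple_functionD(2)[OF sf, of "{x}"] A by (simp add: sets_restrict_space_iff)
    moreover have "?w -` {x} \<inter> K = (s k -` {x} \<inter> A) \<union> (if x = 0 then K - A else {})"
      using A(2) by (auto split: if_splits)
    ultimately show ?thesis using A(1) K by auto
  qed
  ultimately show "simple_function (lebesgue_on K) ?w"
    using K by (auto simp: simple_function_def sets_restrict_space_iff)
next
  have "AE t in lebesgue. t \<in> A \<longrightarrow> (\<lambda>k. s k t) \<longlonglongrightarrow> f t"
    using s A by (simp add: simple_approx_def AE_restrict_space_iff)
  then have "AE t in lebesgue. t \<in> K \<longrightarrow>
    (\<lambda>k. if t \<in> A then s k t else 0) \<longlonglongrightarrow> (if t \<in> A then f t else 0)"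
    by eventually_elim auto
  then show "AE t in lebesgue_on K. (\<lambda>k. if t \<in> A then s k t else 0) \<longlonglongrightarrow> (if t \<in> A then f t else 0)"
    using K by (simp add: AE_restrict_space_iff)
next
  fix p :: "'a \<Rightarrow> real" and e :: real assume p: "p \<in> seminorms" and e: "0 < e"
  have "(\<integral>\<^sup>+ t. ennreal (p ((if t \<in> A then s k t else 0) - (if t \<in> A then s m t else 0))) \<partial>lebesgue_on K) =
    (\<integral>\<^sup>+ t. ennreal (p (s k t - s m t)) \<partial>lebesgue_on A)" for k m
    using A K p
    by (auto simp: nn_integral_restrict_space seminorm_zero intro!: nn_integral_cong split: split_indicator)
  then show "\<exists>k0. \<forall>k\<ge>k0. \<forall>m\<ge>k0.
    (\<integral>\<^sup>+ t. ennreal (p ((if t \<in> A then s k t else 0) - (if t \<in> A then s m t else 0))) \<partial>lebesgue_on K)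
      \<le> ennreal e"
    using s p e by (simp add: simple_approx_def)
qed

text \<open>Extension enlarges the level set of the value 0 only, and that level set is multiplied
  by the zero vector.\<close>

lemma simple_integral_on_extend:
  assumes A: "A \<subseteq> K" and fin: "finite (s ` A)"
  shows "simple_integral_on K (\<lambda>t. if t \<in> A then s t else 0) = simple_integral_on A s"
proof -
  let ?w = "\<lambda>t. if t \<in> A then s t else 0"
  have fin': "finite (?w ` K)"
    using fin by (rule finite_subset[rotated, OF finite_insert[THEN iffD2]]) auto
  have "simple_integral_on K ?w =
      (\<Sum>x\<in>?w ` K - {0}. complex_of_real (measure lebesgue {t \<in> K. ?w t = x}) *\<^sub>C x)"
    unfolding simple_integral_on_def by (rule sum.mono_neutral_right[OF fin']) auto
  also have "\<dots> = (\<Sum>x\<in>s ` A - {0}. complex_of_real (measure lebesgue {t \<in> A. s t = x}) *\<^sub>C x)"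
  proof (rule sum.cong)
    show "?w ` K - {0} = s ` A - {0}" using A by (auto split: if_splits)
    fix x assume "x \<in> s ` A - {0}"
    then have "{t \<in> K. ?w t = x} = {t \<in> A. s t = x}" using A by auto
    then show "complex_of_real (measure lebesgue {t \<in> K. ?w t = x}) *\<^sub>C x =
        complex_of_real (measure lebesgue {t \<in> A. s t = x}) *\<^sub>C x" by simp
  qed
  also have "\<dots> = simple_integral_on A s"
    unfolding simple_integral_on_def by (rule sum.mono_neutral_left[OF fin]) auto
  finally show ?thesis .
qed

lemma compact_integral_extend:
  assumes K: "K \<in> lmeasurable" and A: "A \<in> sets lebesgue" "A \<subseteq> K" and f: "compact_integrable A f"
  shows "compact_integrable K (\<lambda>t. if t \<in> A then f t else 0)"
    "compact_integral K (\<lambda>t. if t \<in> A then f t else 0) = compact_integral A f"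
proof -
  obtain s where s: "simple_approx A f s"
    using f by (auto simp: compact_integrable_def)
  have Am: "A \<in> lmeasurable"
    using K A by (auto intro: fmeasurableI2)
  note ext = simple_approx_extend[OF fmeasurableD[OF K] A s]
  then show "compact_integrable K (\<lambda>t. if t \<in> A then f t else 0)"
    by (auto simp: compact_integrable_def)
  have "finite (s k ` A)" for k
    using simple_functionD(1)[OF simple_approxD(2)[OF A(1) s, of k]] by simp
  then show "compact_integral K (\<lambda>t. if t \<in> A then f t else 0) = compact_integral A f"
    using compact_integral_tendsto[OF Am s]
    by (intro compact_integral_unique[OF K ext]) (simp add: simple_integral_on_extend[OF A(2)])
qed

text \<open>Additivity in the domain is reduced to additivity in the integrand: on the union,
  \<open>f\<close> is the sum of its two extensions by zero.\<close>

lemma compact_integral_Un: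
  assumes A: "A \<in> lmeasurable" and B: "B \<in> lmeasurable" and disj: "A \<inter> B = {}"
    and f: "compact_integrable (A \<union> B) f"
  shows "compact_integral (A \<union> B) f = compact_integral A f + compact_integral B f"
proof -
  have AB: "A \<union> B \<in> lmeasurable" using A B by (rule fmeasurable.Un)
  have fA: "compact_integrable A f" and fB: "compact_integrable B f"
    using A B f AB by (auto intro: compact_integrable_subset[OF fmeasurableD[OF AB]] fmeasurableD)
  note eA = compact_integral_extend[OF AB fmeasurableD[OF A] Un_upper1 fA]
  note eB = compact_integral_extend[OF AB fmeasurableD[OF B] Un_upper2 fB]
  have "compact_integral (A \<union> B) f =
      compact_integral (A \<union> B) (\<lambda>t. (if t \<in> A then f t else 0) + (if t \<in> B then f t else 0))"
    using disj by (intro compact_integral_cong) auto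
  then show ?thesis
    using compact_integral_add[OF AB eA(1) eB(1)] eA(2) eB(2) by simp
qed

section \<open>Translation invariance\<close>

lemma measurable_lebesgue_translation: "(\<lambda>t. t + h) \<in> lebesgue \<rightarrow>\<^sub>M (lebesgue :: 'd::euclidean_space measure)"
  using lebesgue_affine_measurable[of "\<lambda>_. 1" h] by (simp add: euclidean_representation add.commute)

lemma sets_lebesgue_translation:
  "K \<in> sets lebesgue \<Longrightarrow> (\<lambda>t. t + h) ` K \<in> sets (lebesgue :: 'd::euclidean_space measure)"
  using lebesgue_sets_translation[of K h] by (simp add: add.commute)

lemma lmeasurable_translation:
  "K \<in> lmeasurable \<Longrightarrow> (\<lambda>t. t + h) ` K \<in> (lmeasurable :: 'd::euclidean_space set set)"
  using measurable_translation[of K h] by (simp add: add.commute)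

text \<open>Stated as an identity of image measures so that a.e. statements
  (\<open>AE_distrD\<close>) and integrals (\<open>nn_integral_distr\<close>) are transferred by the
  same fact.\<close>

lemma
  fixes h :: "'d::euclidean_space"
  assumes K: "K \<in> sets lebesgue"
  defines "L \<equiv> (\<lambda>t. t + h) ` K"
  shows measurable_lebesgue_on_translation: "(\<lambda>t. t + h) \<in> lebesgue_on K \<rightarrow>\<^sub>M lebesgue_on L"
    and distr_lebesgue_on_translation: "distr (lebesgue_on K) (lebesgue_on L) (\<lambda>t. t + h) = lebesgue_on L"
proof -
  show m: "(\<lambda>t. t + h) \<in> lebesgue_on K \<rightarrow>\<^sub>M lebesgue_on L"
    by (intro measurable_restrict_space2 measurable_restrict_space1 measurable_lebesgue_translation)
       (auto simp: L_def)
  have L: "L \<in> sets lebesgue"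
    unfolding L_def by (rule sets_lebesgue_translation[OF K])
  show "distr (lebesgue_on K) (lebesgue_on L) (\<lambda>t. t + h) = lebesgue_on L"
  proof (rule measure_eqI)
    fix A assume "A \<in> sets (distr (lebesgue_on K) (lebesgue_on L) (\<lambda>t. t + h))"
    then have A: "A \<in> sets (lebesgue_on L)" by simp
    then have "A \<subseteq> L" "A \<in> sets lebesgue"
      using L by (auto simp: sets_restrict_space_iff)
    have "emeasure (distr (lebesgue_on K) (lebesgue_on L) (\<lambda>t. t + h)) A =
        emeasure (lebesgue_on K) ((\<lambda>t. t + h) -` A \<inter> K)"
      using m A by (simp add: emeasure_distr)
    also have "\<dots> = emeasure lebesgue ((\<lambda>t. t + h) -` A \<inter> K)"
      using K by (simp add: emeasure_restrict_space)
    also have "\<dots> = emeasure lebesgue ((\<lambda>t. t + h) ` ((\<lambda>t. t + h) -` A \<inter> K))"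
      using emeasure_lebesgue_affine[of 1 h "(\<lambda>t. t + h) -` A \<inter> K"] by simp
    also have "(\<lambda>t. t + h) ` ((\<lambda>t. t + h) -` A \<inter> K) = A"
      using \<open>A \<subseteq> L\<close> by (auto simp: L_def)
    also have "emeasure lebesgue A = emeasure (lebesgue_on L) A"
      using L \<open>A \<subseteq> L\<close> by (simp add: emeasure_restrict_space)
    finally show "emeasure (distr (lebesgue_on K) (lebesgue_on L) (\<lambda>t. t + h)) A = emeasure (lebesgue_on L) A" .
  qed simp
qed

lemma nn_integral_translation:
  fixes h :: "'d::euclidean_space"
  assumes "K \<in> sets lebesgue" "u \<in> borel_measurable (lebesgue_on ((\<lambda>t. t + h) ` K))"
  shows "(\<integral>\<^sup>+ t. u (t + h) \<partial>lebesgue_on K) = (\<integral>\<^sup>+ t. u t \<partial>lebesgue_on ((\<lambda>t. t + h) ` K))"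
  using nn_integral_distr[OF measurable_lebesgue_on_translation[OF assms(1), of h], of u] assms(2)
  by (simp add: distr_lebesgue_on_translation[OF assms(1)])

lemma simple_approx_translation:
  fixes f :: "'d::euclidean_space \<Rightarrow> 'a::sclcs"
  assumes K: "K \<in> sets lebesgue" and s: "simple_approx ((\<lambda>t. t + h) ` K) f s"
  shows "simple_approx K (\<lambda>t. f (t + h)) (\<lambda>k t. s k (t + h))"
proof -
  let ?L = "(\<lambda>t. t + h) ` K"
  note m = measurable_lebesgue_on_translation[OF K, of h]
  have sf: "simple_function (lebesgue_on ?L) (s k)" for k
    using s by (simp add: simple_approx_def)
  have "AE t in lebesgue_on ?L. (\<lambda>k. s k t) \<longlonglongrightarrow> f t"
    using s by (simp add: simple_approx_def)
  then have "AE t in distr (lebesgue_on K) (lebesgue_on ?L) (\<lambda>t. t + h). (\<lambda>k. s k t) \<longlonglongrightarrow> f t"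
    by (simp only: distr_lebesgue_on_translation[OF K])
  from AE_distrD[OF m this] have "AE t in lebesgue_on K. (\<lambda>k. s k (t + h)) \<longlonglongrightarrow> f (t + h)" .
  moreover have "(\<integral>\<^sup>+ t. ennreal (p (s k (t + h) - s m (t + h))) \<partial>lebesgue_on K) =
      (\<integral>\<^sup>+ t. ennreal (p (s k t - s m t)) \<partial>lebesgue_on ?L)" for k m and p :: "'a \<Rightarrow> real"
    by (rule nn_integral_translation[OF K, where u = "\<lambda>t. ennreal (p (s k t - s m t))"])
       (intro borel_measurable_simple_function simple_function_ennreal
          simple_function_compose1[of _ _ p] simple_function_compose2[OF sf sf])
  ultimately show ?thesis
    using s simple_function_comp[OF m sf] by (simp add: simple_approx_def)
qed

lemma simple_integral_on_translation:
  "simple_integral_on K (\<lambda>t. s (t + h)) = simple_integral_on ((\<lambda>t. t + h) ` K) s"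
proof -
  have "measure lebesgue {t \<in> (\<lambda>t. t + h) ` K. s t = x} = measure lebesgue {t \<in> K. s (t + h) = x}" for x
  proof -
    have "{t \<in> (\<lambda>t. t + h) ` K. s t = x} = (+) h ` {t \<in> K. s (t + h) = x}"
      by (auto simp: add.commute)
    then show ?thesis by (simp only: measure_translation)
  qed
  then show ?thesis by (simp add: simple_integral_on_def image_image)
qed

lemma compact_integrable_translation:
  "K \<in> sets lebesgue \<Longrightarrow> compact_integrable ((\<lambda>t. t + h) ` K) f \<Longrightarrow> compact_integrable K (\<lambda>t. f (t + h))"
  using simple_approx_translation unfolding compact_integrable_def by blast

lemma compact_integral_translation:
  assumes K: "K \<in> lmeasurable" and f: "compact_integrable ((\<lambda>t. t + h) ` K) f"
  shows "compact_integral K (\<lambda>t. f (t + h)) = compact_integral ((\<lambda>t. t + h) ` K) f"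
proof -
  obtain s where s: "simple_approx ((\<lambda>t. t + h) ` K) f s"
    using f by (auto simp: compact_integrable_def)
  show ?thesis
    using compact_integral_tendsto[OF lmeasurable_translation[OF K] s]
    by (intro compact_integral_unique[OF K simple_approx_translation[OF fmeasurableD[OF K] s]])
       (simp add: simple_integral_on_translation)
qed

subsection \<open>Multiplication by bounded scalar functions\<close>

text \<open>The approximants are products of simple functions. The error splits into
  \<open>F k t *\<^sub>C (s k t - f t)\<close>, controlled by the mean error of \<open>s k\<close>,
  and \<open>(F k t - \<phi> t) *\<^sub>C f t\<close>, which tends to 0 in mean by dominated
  convergence with the majorant \<open>3 * \<bar>B\<bar> * p (f t)\<close>.\<close>

lemma compact_integrable_mult:
  fixes f :: "'d::euclidean_space \<Rightarrow> 'a::sclcs" and \<phi> :: "'d \<Rightarrow> complex"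
  assumes K: "K \<in> lmeasurable" and f: "compact_integrable K f"
    and \<phi>[measurable]: "\<phi> \<in> borel_measurable (lebesgue_on K)" and bound: "\<And>t. t \<in> K \<Longrightarrow> cmod (\<phi> t) \<le> B"
  shows "compact_integrable K (\<lambda>t. \<phi> t *\<^sub>C f t)"
proof -
  note KL = fmeasurableD[OF K]
  obtain s where s: "simple_approx K f s"
    using f by (auto simp: compact_integrable_def)
  obtain F where F: "\<And>k. simple_function (lebesgue_on K) (F k)"
      "\<And>t. t \<in> K \<Longrightarrow> (\<lambda>k. F k t) \<longlonglongrightarrow> \<phi> t" "\<And>k t. t \<in> K \<Longrightarrow> cmod (F k t) \<le> 2 * cmod (\<phi> t)"
    using borel_measurable_implies_sequence_metric[OF \<phi>, of 0] by simp metis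
  \<comment> \<open>The factor 2 is the price of approximating by simple functions in a metric
    space, here with base point 0. The absolute value is taken because \<open>B\<close> may be
    negative when \<open>K\<close> is empty.\<close>
  have F_bound: "cmod (F k t) \<le> 2 * \<bar>B\<bar>" if "t \<in> K" for k t
    using F(3)[OF that, of k] bound[OF that] by linarith
  have [measurable]: "F k \<in> borel_measurable (lebesgue_on K)" for k
    by (rule borel_measurable_simple_function[OF F(1)])
  have "simple_approx K (\<lambda>t. \<phi> t *\<^sub>C f t) (\<lambda>k t. F k t *\<^sub>C s k t)"
    unfolding simple_approx_iff[OF KL]
  proof (intro conjI ballI)
    have "AE t in lebesgue_on K. (\<lambda>k. s k t) \<longlonglongrightarrow> f t"
      using s by (simp add: simple_approx_def)
    moreover have "AE t in lebesgue_on K. (\<lambda>k. F k t) \<longlonglongrightarrow> \<phi> t"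
      using F(2) by (auto intro: AE_I2)
    ultimately have "AE t in lebesgue_on K. (\<lambda>k. F k t *\<^sub>C s k t) \<longlonglongrightarrow> \<phi> t *\<^sub>C f t"
      by eventually_elim (rule tendsto_scaleC)
    then show "ae_simple_limit K (\<lambda>t. \<phi> t *\<^sub>C f t) (\<lambda>k t. F k t *\<^sub>C s k t)"
      using simple_approxD(2)[OF KL s] F(1)
      by (auto simp: ae_simple_limit_def intro: simple_function_compose2)
  next
    fix p :: "'a \<Rightarrow> real" assume p: "p \<in> seminorms"
    note [measurable] = seminorm_measurable_simple_approx[OF KL s p]
    have tend2: "(\<lambda>k. \<integral>\<^sup>+ t. ennreal (cmod (F k t - \<phi> t) * p (f t)) \<partial>lebesgue_on K) \<longlonglongrightarrow>
        (\<integral>\<^sup>+ t. 0 \<partial>lebesgue_on K)"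
    proof (rule nn_integral_dominated_convergence[where w = "\<lambda>t. ennreal (3 * \<bar>B\<bar>) * ennreal (p (f t))"])
      show "AE t in lebesgue_on K. ennreal (cmod (F k t - \<phi> t) * p (f t)) \<le> ennreal (3 * \<bar>B\<bar>) * ennreal (p (f t))" for k
      proof (rule AE_I2)
        fix t assume "t \<in> space (lebesgue_on K)"
        then have "t \<in> K" by simp
        then have "cmod (F k t - \<phi> t) \<le> 3 * \<bar>B\<bar>"
          using F_bound[of t k] bound[of t] norm_triangle_ineq4[of "F k t" "\<phi> t"] by linarith
        then show "ennreal (cmod (F k t - \<phi> t) * p (f t)) \<le> ennreal (3 * \<bar>B\<bar>) * ennreal (p (f t))"
          by (simp add: seminorm_nonneg p ennreal_leI mult_right_mono flip: ennreal_mult)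
      qed
      show "(\<integral>\<^sup>+ t. ennreal (3 * \<bar>B\<bar>) * ennreal (p (f t)) \<partial>lebesgue_on K) < \<infinity>"
        using seminorm_integral_finite[OF K f p] by (subst nn_integral_cmult) (auto simp: ennreal_mult_less_top)
      show "AE t in lebesgue_on K. (\<lambda>k. ennreal (cmod (F k t - \<phi> t) * p (f t))) \<longlonglongrightarrow> 0"
      proof (rule AE_I2)
        fix t assume "t \<in> space (lebesgue_on K)"
        then have "(\<lambda>k. ennreal (cmod (F k t - \<phi> t) * p (f t))) \<longlonglongrightarrow> ennreal (cmod (\<phi> t - \<phi> t) * p (f t))"
          by (intro tendsto_ennrealI tendsto_intros F(2)) simp
        then show "(\<lambda>k. ennreal (cmod (F k t - \<phi> t) * p (f t))) \<longlonglongrightarrow> 0" by simp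
      qed
    qed measurable
    have tend1: "(\<lambda>k. ennreal (2 * \<bar>B\<bar>) * (\<integral>\<^sup>+ t. ennreal (p (s k t - f t)) \<partial>lebesgue_on K)) \<longlonglongrightarrow>
        ennreal (2 * \<bar>B\<bar>) * 0"
      by (intro ennreal_tendsto_cmult simple_approxD(3)[OF KL s p]) simp
    show "(\<lambda>k. \<integral>\<^sup>+ t. ennreal (p (F k t *\<^sub>C s k t - \<phi> t *\<^sub>C f t)) \<partial>lebesgue_on K) \<longlonglongrightarrow> 0"
    proof (rule tendsto_sandwich[OF _ _ tendsto_const])
      show "\<forall>\<^sub>F k in sequentially. (\<integral>\<^sup>+ t. ennreal (p (F k t *\<^sub>C s k t - \<phi> t *\<^sub>C f t)) \<partial>lebesgue_on K) \<le>
        ennreal (2 * \<bar>B\<bar>) * (\<integral>\<^sup>+ t. ennreal (p (s k t - f t)) \<partial>lebesgue_on K) +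
        (\<integral>\<^sup>+ t. ennreal (cmod (F k t - \<phi> t) * p (f t)) \<partial>lebesgue_on K)"
      proof (rule always_eventually, rule allI)
        fix k
        have "(\<integral>\<^sup>+ t. ennreal (p (F k t *\<^sub>C s k t - \<phi> t *\<^sub>C f t)) \<partial>lebesgue_on K) \<le>
          (\<integral>\<^sup>+ t. ennreal (2 * \<bar>B\<bar>) * ennreal (p (s k t - f t)) +
            ennreal (cmod (F k t - \<phi> t) * p (f t)) \<partial>lebesgue_on K)"
        proof (rule nn_integral_mono)
          fix t assume "t \<in> space (lebesgue_on K)"
          then have t: "t \<in> K" by simp
          have "p (F k t *\<^sub>C s k t - \<phi> t *\<^sub>C f t) \<le>
              p (F k t *\<^sub>C s k t - F k t *\<^sub>C f t) + p (F k t *\<^sub>C f t - \<phi> t *\<^sub>C f t)"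
            by (rule seminorm_triangle_sub[OF p])
          also have "\<dots> = cmod (F k t) * p (s k t - f t) + cmod (F k t - \<phi> t) * p (f t)"
            by (simp add: seminorm_scaleC p flip: sclcs.scale_left_diff_distrib sclcs.scale_right_diff_distrib)
          also have "\<dots> \<le> 2 * \<bar>B\<bar> * p (s k t - f t) + cmod (F k t - \<phi> t) * p (f t)"
            using F_bound[OF t, of k] by (intro add_mono mult_right_mono) (auto simp: seminorm_nonneg p)
          finally show "ennreal (p (F k t *\<^sub>C s k t - \<phi> t *\<^sub>C f t)) \<le>
              ennreal (2 * \<bar>B\<bar>) * ennreal (p (s k t - f t)) + ennreal (cmod (F k t - \<phi> t) * p (f t))"
            by (simp add: seminorm_nonneg p ennreal_leI flip: ennreal_mult ennreal_plus)
        qed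
        also have "\<dots> = ennreal (2 * \<bar>B\<bar>) * (\<integral>\<^sup>+ t. ennreal (p (s k t - f t)) \<partial>lebesgue_on K) +
            (\<integral>\<^sup>+ t. ennreal (cmod (F k t - \<phi> t) * p (f t)) \<partial>lebesgue_on K)"
          by (subst nn_integral_add, measurable, subst nn_integral_cmult, measurable)
        finally show "(\<integral>\<^sup>+ t. ennreal (p (F k t *\<^sub>C s k t - \<phi> t *\<^sub>C f t)) \<partial>lebesgue_on K) \<le>
          ennreal (2 * \<bar>B\<bar>) * (\<integral>\<^sup>+ t. ennreal (p (s k t - f t)) \<partial>lebesgue_on K) +
          (\<integral>\<^sup>+ t. ennreal (cmod (F k t - \<phi> t) * p (f t)) \<partial>lebesgue_on K)" .
      qed
      show "(\<lambda>k. ennreal (2 * \<bar>B\<bar>) * (\<integral>\<^sup>+ t. ennreal (p (s k t - f t)) \<partial>lebesgue_on K) +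
        (\<integral>\<^sup>+ t. ennreal (cmod (F k t - \<phi> t) * p (f t)) \<partial>lebesgue_on K)) \<longlonglongrightarrow> 0"
        using tendsto_add[OF tend1 tend2] by simp
    qed simp
  qed
  then show ?thesis
    by (auto simp: compact_integrable_def)
qed

section \<open>Closed subspaces of a product\<close>

text \<open>For finite \<open>F\<close> this is one continuous seminorm dominating every member of
  \<open>F\<close>; the balls of these sums form a base of neighbourhoods without assuming that the
  system is directed.\<close>

definition seminorm_sum :: "('a::sclcs \<Rightarrow> real) set \<Rightarrow> 'a \<Rightarrow> real" where
  "seminorm_sum F x = (\<Sum>p\<in>F. p x)"

lemma
  fixes F :: "('a::sclcs \<Rightarrow> real) set"
  assumes F: "F \<subseteq> seminorms"
  shows seminorm_sum_nonneg: "0 \<le> seminorm_sum F x"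
    and seminorm_sum_zero: "seminorm_sum F 0 = 0"
    and seminorm_sum_minus_commute: "seminorm_sum F (x - y) = seminorm_sum F (y - x)"
    and seminorm_sum_scaleC: "seminorm_sum F (c *\<^sub>C x) = cmod c * seminorm_sum F x"
    and seminorm_sum_triangle: "seminorm_sum F (x + y) \<le> seminorm_sum F x + seminorm_sum F y"
    and seminorm_sum_le: "finite F \<Longrightarrow> p \<in> F \<Longrightarrow> p x \<le> seminorm_sum F x"
    and seminorm_sum_tendsto: "(u \<longlongrightarrow> l) \<F> \<Longrightarrow> ((\<lambda>i. seminorm_sum F (u i - l)) \<longlongrightarrow> 0) \<F>"
proof -
  have p: "p \<in> seminorms" if "p \<in> F" for p using F that by blast
  show "0 \<le> seminorm_sum F x" "seminorm_sum F 0 = 0"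
    by (simp_all add: seminorm_sum_def sum_nonneg seminorm_nonneg seminorm_zero p)
  show "seminorm_sum F (x - y) = seminorm_sum F (y - x)"
    unfolding seminorm_sum_def by (intro sum.cong refl seminorm_minus_commute p)
  show "seminorm_sum F (c *\<^sub>C x) = cmod c * seminorm_sum F x"
    by (simp add: seminorm_sum_def sum_distrib_left seminorm_scaleC p)
  show "seminorm_sum F (x + y) \<le> seminorm_sum F x + seminorm_sum F y"
    unfolding seminorm_sum_def sum.distrib[symmetric] by (intro sum_mono seminorm_triangle p)
  show "finite F \<Longrightarrow> p \<in> F \<Longrightarrow> p x \<le> seminorm_sum F x"
    unfolding seminorm_sum_def by (intro member_le_sum) (auto simp: p seminorm_nonneg)
  show "(u \<longlongrightarrow> l) \<F> \<Longrightarrow> ((\<lambda>i. seminorm_sum F (u i - l)) \<longlongrightarrow> 0) \<F>"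
    unfolding seminorm_sum_def by (rule tendsto_null_sum) (auto simp: tendsto_iff_seminorms p)
qed

lemma seminorm_sum_sum_le:
  "F \<subseteq> seminorms \<Longrightarrow> seminorm_sum F (\<Sum>i\<in>I. x i) \<le> (\<Sum>i\<in>I. seminorm_sum F (x i))"
  by (induction I rule: infinite_finite_induct)
     (auto simp: seminorm_sum_zero intro: order_trans[OF seminorm_sum_triangle])

lemma seminorm_sum_triangle_sub:
  "F \<subseteq> seminorms \<Longrightarrow> seminorm_sum F (x - z) \<le> seminorm_sum F (x - y) + seminorm_sum F (y - z)"
  using seminorm_sum_triangle[of F "x - y" "y - z"] by simp

text \<open>A neighbourhood of the point missing \<open>G\<close> would contain a product of two
  sets, each cut out by finitely many seminorms; adding up the seminorms on each side turns this
  into a single inequality.\<close>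

lemma mem_closed_product:
  fixes G :: "('a::sclcs \<times> 'b::sclcs) set"
  assumes G: "closed G"
    and approx: "\<And>F F' e. finite F \<Longrightarrow> F \<subseteq> seminorms \<Longrightarrow> finite F' \<Longrightarrow> F' \<subseteq> seminorms \<Longrightarrow> e > 0 \<Longrightarrow>
      \<exists>(a, b)\<in>G. seminorm_sum F (a - x) + seminorm_sum F' (b - y) < e"
  shows "(x, y) \<in> G"
proof (rule ccontr)
  assume "(x, y) \<notin> G"
  then obtain U V where U: "open U" "x \<in> U" and V: "open V" "y \<in> V" and UV: "U \<times> V \<subseteq> - G"
    using open_prod_elim[of "- G" "(x, y)"] G unfolding open_Compl mem_Times_iff
    by (metis ComplI fst_conv snd_conv open_Compl)
  obtain F d where F: "finite F" "F \<subseteq> seminorms" "d > 0" "{a. \<forall>p\<in>F. p (a - x) < d} \<subseteq> U"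
    using U by (rule nhds_basis_seminorms)
  obtain F' d' where F': "finite F'" "F' \<subseteq> seminorms" "d' > 0" "{b. \<forall>p\<in>F'. p (b - y) < d'} \<subseteq> V"
    using V by (rule nhds_basis_seminorms)
  have "min d d' > 0" using F(3) F'(3) by simp
  then obtain a b where ab: "(a, b) \<in> G" "seminorm_sum F (a - x) + seminorm_sum F' (b - y) < min d d'"
    using approx[OF F(1,2) F'(1,2)] by blast
  have "p (a - x) < d" if "p \<in> F" for p
    using seminorm_sum_le[OF F(2,1) that, of "a - x"] seminorm_sum_nonneg[OF F'(2), of "b - y"] ab(2)
    by linarith
  moreover have "p (b - y) < d'" if "p \<in> F'" for p
    using seminorm_sum_le[OF F'(2,1) that, of "b - y"] seminorm_sum_nonneg[OF F(2), of "a - x"] ab(2)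
    by linarith
  ultimately have "(a, b) \<in> U \<times> V"
    using F(4) F'(4) by auto
  with UV ab(1) show False by blast
qed

lemma nn_integral_seminorm_sum_tendsto_0:
  fixes f :: "'d::euclidean_space \<Rightarrow> 'a::sclcs"
  assumes K: "K \<in> sets lebesgue" and s: "simple_approx K f s" and F: "F \<subseteq> seminorms"
  shows "(\<lambda>k. \<integral>\<^sup>+ t. ennreal (seminorm_sum F (s k t - f t)) \<partial>lebesgue_on K) \<longlonglongrightarrow> 0"
    "(\<lambda>t. seminorm_sum F (s k t - f t)) \<in> borel_measurable (lebesgue_on K)"
proof -
  have p: "p \<in> seminorms" if "p \<in> F" for p using F that by blast
  have [measurable]: "(\<lambda>t. p (s k t - f t)) \<in> borel_measurable (lebesgue_on K)" if "p \<in> F" for p k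
    by (rule seminorm_measurable_simple_approx[OF K s p[OF that]])
  show "(\<lambda>t. seminorm_sum F (s k t - f t)) \<in> borel_measurable (lebesgue_on K)"
    unfolding seminorm_sum_def by measurable
  have "(\<integral>\<^sup>+ t. ennreal (seminorm_sum F (s k t - f t)) \<partial>lebesgue_on K) =
      (\<Sum>p\<in>F. \<integral>\<^sup>+ t. ennreal (p (s k t - f t)) \<partial>lebesgue_on K)" for k
  proof -
    have "ennreal (seminorm_sum F (s k t - f t)) = (\<Sum>p\<in>F. ennreal (p (s k t - f t)))" for t
      unfolding seminorm_sum_def by (rule sum_ennreal[symmetric]) (simp add: p seminorm_nonneg)
    then show ?thesis
      by (simp add: nn_integral_sum)
  qed
  then show "(\<lambda>k. \<integral>\<^sup>+ t. ennreal (seminorm_sum F (s k t - f t)) \<partial>lebesgue_on K) \<longlonglongrightarrow> 0"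
    by (simp add: tendsto_null_sum simple_approxD(3)[OF K s] p)
qed

text \<open>
  The approximants of \<open>(f, g)\<close> need not take values in \<open>G\<close>, but the integral of their distance \<open>d\<close> to
  \<open>G\<close> tends to \<open>0\<close>; replacing each of their finitely many values by a nearly closest point of \<open>G\<close>
  gives points of \<open>G\<close> close to \<open>(\<integral>f, \<integral>g)\<close>.
\<close>

lemma compact_integral_mem_closed_product:
  fixes G :: "('a::sclcs \<times> 'b::sclcs) set" and f :: "'d::euclidean_space \<Rightarrow> 'a"
  assumes K: "K \<in> lmeasurable" and f: "compact_integrable K f" and g: "compact_integrable K g"
    and G: "closed G" "(0, 0) \<in> G"
    and G_add: "\<And>a b a' b'. (a, b) \<in> G \<Longrightarrow> (a', b') \<in> G \<Longrightarrow> (a + a', b + b') \<in> G"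
    and G_scaleC: "\<And>c a b. (a, b) \<in> G \<Longrightarrow> (c *\<^sub>C a, c *\<^sub>C b) \<in> G"
    and ae: "AE t in lebesgue_on K. (f t, g t) \<in> G"
  shows "(compact_integral K f, compact_integral K g) \<in> G"
proof (rule mem_closed_product[OF G(1)])
  fix P :: "('a \<Rightarrow> real) set" and Q :: "('b \<Rightarrow> real) set" and e :: real
  assume "finite P" and P: "P \<subseteq> seminorms" and "finite Q" and Q: "Q \<subseteq> seminorms" and e: "e > 0"
  obtain s r where s: "simple_approx K f s" and r: "simple_approx K g r"
    using f g by (auto simp: compact_integrable_def)
  note KL = fmeasurableD[OF K]
  define R where "R z = seminorm_sum P (fst z) + seminorm_sum Q (snd z)" for z
  \<comment> \<open>\<open>d\<close> is the distance to \<open>G\<close> in the seminorm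
    \<open>R\<close>. It is bounded below because \<open>R\<close> is nonnegative, and the infimum
    is over a nonempty set because \<open>(0, 0)\<close> lies in \<open>G\<close>.\<close>
  define d where "d z = Inf ((\<lambda>u. R (z - u)) ` G)" for z
  have R_nonneg: "0 \<le> R z" for z
    by (simp add: R_def seminorm_sum_nonneg P Q)
  have bdd: "bdd_below ((\<lambda>u. R (z - u)) ` G)" for z
    by (rule bdd_belowI[of _ 0]) (use R_nonneg in blast)
  have d_nonneg: "0 \<le> d z" for z
    unfolding d_def using G(2) R_nonneg by (intro cInf_greatest) blast+
  have d_le: "d z \<le> R (z - u)" if "u \<in> G" for z u
    unfolding d_def using that bdd by (intro cInf_lower) auto
  have near: "\<exists>u\<in>G. R (z - u) < d z + \<delta>" if "\<delta> > 0" for z \<delta>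
    using cInf_lessD[of "(\<lambda>u. R (z - u)) ` G" "d z + \<delta>"] G(2) that by (auto simp: d_def)
  \<comment> \<open>The tolerance \<open>e\<close> is split into thirds: distance of the
    approximants to \<open>G\<close>, error of the nearly closest points, and error of the simple
    integrals. The second is \<open>\<delta>\<close> times a total mass of at most
    \<open>measure lebesgue K\<close>; adding 1 avoids division by zero.\<close>
  define \<delta> where "\<delta> = e / 3 / (measure lebesgue K + 1)"
  have pos: "measure lebesgue K + 1 > 0" by (simp add: add_nonneg_pos)
  with e have \<delta>: "\<delta> > 0" by (simp add: \<delta>_def)
  \<comment> \<open>The infimum need not be attained, hence a point of \<open>G\<close> within
    \<open>\<delta>\<close> of optimal.\<close>
  define c where "c z = (SOME u. u \<in> G \<and> R (z - u) < d z + \<delta>)" for z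
  have c: "c z \<in> G" "R (z - c z) < d z + \<delta>" for z
    using someI_ex[of "\<lambda>u. u \<in> G \<and> R (z - u) < d z + \<delta>"] near[OF \<delta>, of z] by (auto simp: c_def)

  \<comment> \<open>Pairing the two approximants puts both integrals on the same partition of
    \<open>K\<close>, so that each cell carries one point of the product space.\<close>
  define w where "w k t = (s k t, r k t)" for k t
  have w: "simple_function (lebesgue_on K) (w k)" for k
    unfolding w_def by (intro simple_function_Pair simple_approxD(2)[OF KL s] simple_approxD(2)[OF KL r])
  define m where "m k z = measure lebesgue {t \<in> K. w k t = z}" for k z

  \<comment> \<open>The sum is the integral of \<open>d (w k t)\<close>. For almost every
    \<open>t\<close> the point \<open>(f t, g t)\<close> lies in \<open>G\<close>, so this integrand
    is at most the distance from \<open>w k t\<close> to \<open>(f t, g t)\<close>.\<close>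
  have "(\<lambda>k. \<Sum>z\<in>w k ` K. m k z * d z) \<longlonglongrightarrow> 0"
  proof (rule tendsto_0_if_ennreal_le)
    fix k
    show "0 \<le> (\<Sum>z\<in>w k ` K. m k z * d z)"
      by (intro sum_nonneg mult_nonneg_nonneg d_nonneg) (simp add: m_def)
    have "ennreal (\<Sum>z\<in>w k ` K. m k z * d z) = (\<integral>\<^sup>+ t. ennreal (d (w k t)) \<partial>lebesgue_on K)"
      unfolding m_def by (rule nn_integral_simple_compose[OF K w d_nonneg, symmetric])
    also have "\<dots> \<le> (\<integral>\<^sup>+ t. ennreal (seminorm_sum P (s k t - f t)) +
        ennreal (seminorm_sum Q (r k t - g t)) \<partial>lebesgue_on K)"
    proof (rule nn_integral_mono_AE)
      show "AE t in lebesgue_on K. ennreal (d (w k t)) \<le>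
          ennreal (seminorm_sum P (s k t - f t)) + ennreal (seminorm_sum Q (r k t - g t))"
        using ae
      proof eventually_elim
        case (elim t)
        then show ?case
          using d_le[OF elim, of "w k t"]
          by (simp add: R_def w_def seminorm_sum_nonneg P Q ennreal_leI flip: ennreal_plus)
      qed
    qed
    also have "\<dots> = (\<integral>\<^sup>+ t. ennreal (seminorm_sum P (s k t - f t)) \<partial>lebesgue_on K) +
        (\<integral>\<^sup>+ t. ennreal (seminorm_sum Q (r k t - g t)) \<partial>lebesgue_on K)"
      using nn_integral_seminorm_sum_tendsto_0(2)[OF KL s P] nn_integral_seminorm_sum_tendsto_0(2)[OF KL r Q]
      by (intro nn_integral_add) auto
    finally show "ennreal (\<Sum>z\<in>w k ` K. m k z * d z) \<le>
        (\<integral>\<^sup>+ t. ennreal (seminorm_sum P (s k t - f t)) \<partial>lebesgue_on K) +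
        (\<integral>\<^sup>+ t. ennreal (seminorm_sum Q (r k t - g t)) \<partial>lebesgue_on K)" .
  next
    show "(\<lambda>k. (\<integral>\<^sup>+ t. ennreal (seminorm_sum P (s k t - f t)) \<partial>lebesgue_on K) +
        (\<integral>\<^sup>+ t. ennreal (seminorm_sum Q (r k t - g t)) \<partial>lebesgue_on K)) \<longlonglongrightarrow> 0"
      using tendsto_add[OF nn_integral_seminorm_sum_tendsto_0(1)[OF KL s P]
          nn_integral_seminorm_sum_tendsto_0(1)[OF KL r Q]] by simp
  qed
  moreover have "(\<lambda>k. seminorm_sum P (simple_integral_on K (s k) - compact_integral K f) +
      seminorm_sum Q (simple_integral_on K (r k) - compact_integral K g)) \<longlonglongrightarrow> 0"
    using tendsto_add[OF seminorm_sum_tendsto[OF P compact_integral_tendsto[OF K s]]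
        seminorm_sum_tendsto[OF Q compact_integral_tendsto[OF K r]]] by simp
  ultimately have "\<forall>\<^sub>F k in sequentially. (\<Sum>z\<in>w k ` K. m k z * d z) < e / 3 \<and>
      seminorm_sum P (simple_integral_on K (s k) - compact_integral K f) +
      seminorm_sum Q (simple_integral_on K (r k) - compact_integral K g) < e / 3"
    using e by (intro eventually_conj) (auto dest: order_tendstoD(2)[where a = "e / 3"])
  then obtain k where k: "(\<Sum>z\<in>w k ` K. m k z * d z) < e / 3"
      "seminorm_sum P (simple_integral_on K (s k) - compact_integral K f) +
      seminorm_sum Q (simple_integral_on K (r k) - compact_integral K g) < e / 3"
    by (auto simp: eventually_sequentially)

  have fin: "finite (w k ` K)"
    using simple_functionD(1)[OF w[of k]] by simp
  \<comment> \<open>The simple integrals with each value \<open>z\<close> replaced by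
    \<open>c z\<close>. As linear combinations of points of \<open>G\<close>, they form a pair in
    \<open>G\<close>.\<close>
  define a b where "a = (\<Sum>z\<in>w k ` K. complex_of_real (m k z) *\<^sub>C fst (c z))"
    and "b = (\<Sum>z\<in>w k ` K. complex_of_real (m k z) *\<^sub>C snd (c z))"
  have "(\<Sum>z\<in>I. complex_of_real (m k z) *\<^sub>C fst (c z), \<Sum>z\<in>I. complex_of_real (m k z) *\<^sub>C snd (c z)) \<in> G"
    for I
    by (induction I rule: infinite_finite_induct) (auto simp: G(2) c(1) intro!: G_add G_scaleC)
  then have ab: "(a, b) \<in> G" by (simp add: a_def b_def)

  have S: "simple_integral_on K (s k) = (\<Sum>z\<in>w k ` K. complex_of_real (m k z) *\<^sub>C fst z)"
    "simple_integral_on K (r k) = (\<Sum>z\<in>w k ` K. complex_of_real (m k z) *\<^sub>C snd z)"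
    using simple_integral_on_compose[OF K w[of k], of fst] simple_integral_on_compose[OF K w[of k], of snd]
    by (simp_all add: w_def m_def)
  have "(\<Sum>z\<in>w k ` K. m k z) \<le> measure lebesgue K"
  proof -
    have "ennreal (\<Sum>z\<in>w k ` K. m k z) = emeasure (lebesgue_on K) K"
      using nn_integral_simple_compose[OF K w[of k], of "\<lambda>_. 1"] by (simp add: m_def)
    also have "\<dots> = ennreal (measure lebesgue K)"
      using K KL by (simp add: emeasure_restrict_space emeasure_eq_measure2)
    finally show ?thesis by (simp add: sum_nonneg m_def)
  qed
  then have "\<delta> * (\<Sum>z\<in>w k ` K. m k z) \<le> \<delta> * measure lebesgue K"
    using \<delta> by (intro mult_left_mono) auto
  also have "\<dots> < \<delta> * (measure lebesgue K + 1)"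
    using \<delta> by simp
  also have "\<dots> = e / 3"
    using pos by (intro nonzero_eq_divide_eq[THEN iffD1]) (rule less_imp_neq[symmetric], simp_all only: \<delta>_def)
  finally have small: "\<delta> * (\<Sum>z\<in>w k ` K. m k z) < e / 3" .
  have "seminorm_sum P (a - simple_integral_on K (s k)) + seminorm_sum Q (b - simple_integral_on K (r k)) \<le>
      (\<Sum>z\<in>w k ` K. m k z * R (z - c z))"
  proof -
    have "seminorm_sum P (simple_integral_on K (s k) - a) \<le> (\<Sum>z\<in>w k ` K. m k z * seminorm_sum P (fst z - fst (c z)))"
      unfolding S a_def sum_subtractf[symmetric] sclcs.scale_right_diff_distrib[symmetric]
      by (rule order_trans[OF seminorm_sum_sum_le[OF P]]) (simp add: seminorm_sum_scaleC P m_def)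
    moreover have "seminorm_sum Q (simple_integral_on K (r k) - b) \<le> (\<Sum>z\<in>w k ` K. m k z * seminorm_sum Q (snd z - snd (c z)))"
      unfolding S b_def sum_subtractf[symmetric] sclcs.scale_right_diff_distrib[symmetric]
      by (rule order_trans[OF seminorm_sum_sum_le[OF Q]]) (simp add: seminorm_sum_scaleC Q m_def)
    ultimately show ?thesis
      by (simp add: R_def distrib_left sum.distrib seminorm_sum_minus_commute[OF P, of a]
          seminorm_sum_minus_commute[OF Q, of b])
  qed
  also have "\<dots> \<le> (\<Sum>z\<in>w k ` K. m k z * (d z + \<delta>))"
    using c(2) by (intro sum_mono mult_left_mono) (auto simp: less_imp_le m_def)
  also have "\<dots> = (\<Sum>z\<in>w k ` K. m k z * d z) + \<delta> * (\<Sum>z\<in>w k ` K. m k z)"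
    by (simp add: distrib_left sum.distrib sum_distrib_left mult.commute)
  finally have "seminorm_sum P (a - simple_integral_on K (s k)) + seminorm_sum Q (b - simple_integral_on K (r k)) < 2 * e / 3"
    using k(1) small by linarith
  then have "seminorm_sum P (a - compact_integral K f) + seminorm_sum Q (b - compact_integral K g) < e"
    using k(2) seminorm_sum_triangle_sub[OF P, of a "compact_integral K f" "simple_integral_on K (s k)"]
      seminorm_sum_triangle_sub[OF Q, of b "compact_integral K g" "simple_integral_on K (r k)"]
    by linarith
  with ab show "\<exists>(a, b)\<in>G. seminorm_sum P (a - compact_integral K f) + seminorm_sum Q (b - compact_integral K g) < e"
    by blast
qed

lemma closed_mlo_graph:
  assumes "closed_mlo A"
  shows "closed {(x, y). y \<in> A x}" "0 \<in> A 0"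
    "b \<in> A a \<Longrightarrow> b' \<in> A a' \<Longrightarrow> b + b' \<in> A (a + a')"
    "b \<in> A a \<Longrightarrow> c *\<^sub>C b \<in> A (c *\<^sub>C a)"
proof -
  have A: "mlo A" using assms by (simp add: closed_mlo_def)
  show "closed {(x, y). y \<in> A x}" using assms by (simp add: closed_mlo_def)
  show "b \<in> A a \<Longrightarrow> b' \<in> A a' \<Longrightarrow> b + b' \<in> A (a + a')"
    using A unfolding mlo_def mlo_domain_def by blast
  show sc: "c *\<^sub>C b \<in> A (c *\<^sub>C a)" if "b \<in> A a" for a b c
    using A that unfolding mlo_def mlo_domain_def by blast
  \<comment> \<open>The domain is a subspace, so \<open>A 0\<close> is nonempty; scaling any of its
    elements by 0 produces 0.\<close>
  have "0 \<in> mlo_domain A"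
    using A sclcs.subspace_0 unfolding mlo_def by blast
  then obtain y where "y \<in> A 0" by (auto simp: mlo_domain_def)
  from sc[OF this, of 0] show "0 \<in> A 0" by simp
qed

lemma compact_integral_closed_mlo:
  assumes "K \<in> lmeasurable" "compact_integrable K f" "compact_integrable K g"
    and A: "closed_mlo A" and "AE t in lebesgue_on K. g t \<in> A (f t)"
  shows "compact_integral K g \<in> A (compact_integral K f)"
  using compact_integral_mem_closed_product[OF assms(1-3) closed_mlo_graph(1)[OF A]] assms(5)
    closed_mlo_graph(2-4)[OF A] by simp

section \<open>Locally integrable functions\<close>

text \<open>
  Bounded Lebesgue sets, unlike compact ones, are closed under differences; this permits splitting
  integrals over \<open>[0,\<infinity>)\<^sup>n \<setminus> H\<close>.
\<close>

definition boundedly_integrable :: "'d::euclidean_space set \<Rightarrow> ('d \<Rightarrow> 'a::sclcs) \<Rightarrow> bool" where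
  "boundedly_integrable D f \<longleftrightarrow>
     (\<forall>A. A \<in> sets lebesgue \<longrightarrow> bounded A \<longrightarrow> A \<subseteq> D \<longrightarrow> compact_integrable A f)"

text \<open>The closure of a bounded subset of the closed set \<open>D\<close> is compact and stays
  inside \<open>D\<close>, and integrability passes to measurable subsets.\<close>

lemma locally_integrable_imp_boundedly:
  assumes "closed D" "locally_integrable D f"
  shows "boundedly_integrable D f"
  unfolding boundedly_integrable_def
proof (intro allI impI)
  fix A assume A: "A \<in> sets lebesgue" "bounded A" "A \<subseteq> D"
  then have "compact (closure A)" "closure A \<subseteq> D"
    using assms(1) by (simp_all add: closure_minimal)
  then have "compact_integrable (closure A) f"
    using assms(2) by (simp add: locally_integrable_def)
  then show "compact_integrable A f"
    using compact_integrable_subset[OF _ A(1) closure_subset, of f] by simp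
qed

lemma boundedly_integrable_subset:
  "boundedly_integrable D f \<Longrightarrow> E \<subseteq> D \<Longrightarrow> boundedly_integrable E f"
  unfolding boundedly_integrable_def by blast

lemma boundedly_integrable_imp_locally:
  "boundedly_integrable D f \<Longrightarrow> locally_integrable D f"
  unfolding boundedly_integrable_def locally_integrable_def
  by (meson compact_imp_bounded compact_imp_closed lmeasurable_compact fmeasurableD)

text \<open>\<open>D\<close> may be unbounded, so \<open>p (f t)\<close> is obtained as the
  pointwise limit of its truncations to balls.\<close>

lemma boundedly_integrable_seminorm_measurable:
  fixes f :: "'d::euclidean_space \<Rightarrow> 'a::sclcs"
  assumes f: "boundedly_integrable D f" and D: "D \<in> sets lebesgue" and p: "p \<in> seminorms"
  shows "(\<lambda>t. p (f t)) \<in> borel_measurable (lebesgue_on D)"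
proof (rule borel_measurable_lebesgue_on_AE_limit[OF D])
  fix k :: nat
  have A: "D \<inter> cball 0 (real k) \<in> sets lebesgue" using D by auto
  then have "compact_integrable (D \<inter> cball 0 (real k)) f"
    using f by (simp add: boundedly_integrable_def bounded_Int)
  from seminorm_measurable[OF A this p]
  have "(\<lambda>t. if t \<in> D \<inter> cball 0 (real k) then p (f t) else 0) \<in> borel_measurable lebesgue"
    using A by (subst (asm) measurable_restrict_space_iff[where c = 0]) auto
  then show "(\<lambda>t. if t \<in> D \<inter> cball 0 (real k) then p (f t) else 0) \<in> borel_measurable (lebesgue_on D)"
    by (rule measurable_restrict_space1)
next
  show "AE t in lebesgue_on D. (\<lambda>k. if t \<in> D \<inter> cball 0 (real k) then p (f t) else 0) \<longlonglongrightarrow> p (f t)"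
  proof (rule AE_I2)
    fix t assume "t \<in> space (lebesgue_on D)"
    then have t: "t \<in> D" by simp
    obtain N where "norm t \<le> real N" using real_arch_simple by blast
    then have "\<forall>\<^sub>F k in sequentially. (if t \<in> D \<inter> cball 0 (real k) then p (f t) else 0) = p (f t)"
      using t by (auto simp: eventually_sequentially intro!: exI[of _ N])
    then show "(\<lambda>k. if t \<in> D \<inter> cball 0 (real k) then p (f t) else 0) \<longlonglongrightarrow> p (f t)"
      by (rule tendsto_eventually)
  qed
qed

lemma locally_integrable_mult:
  fixes \<phi> :: "'d::euclidean_space \<Rightarrow> complex"
  assumes f: "locally_integrable D f" and \<phi>: "continuous_on D \<phi>"
  shows "locally_integrable D (\<lambda>t. \<phi> t *\<^sub>C f t)"
  unfolding locally_integrable_def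
proof (intro allI impI)
  fix K assume K: "compact K \<and> K \<subseteq> D"
  then have cont: "continuous_on K \<phi>"
    using \<phi> continuous_on_subset by blast
  then have "bounded (\<phi> ` K)"
    using K by (simp add: compact_continuous_image compact_imp_bounded)
  then obtain B where "\<And>t. t \<in> K \<Longrightarrow> cmod (\<phi> t) \<le> B"
    by (auto simp: bounded_iff)
  moreover have "\<phi> \<in> borel_measurable (lebesgue_on K)"
    using cont K by (intro continuous_imp_measurable_on_sets_lebesgue) (auto simp: lmeasurable_compact fmeasurableD)
  moreover have "compact_integrable K f"
    using f K by (simp add: locally_integrable_def)
  ultimately show "compact_integrable K (\<lambda>t. \<phi> t *\<^sub>C f t)"
    using K by (intro compact_integrable_mult) (auto simp: lmeasurable_compact)
qed

lemma locally_integrable_translation: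
  assumes f: "locally_integrable D f" and h: "\<And>t. t \<in> E \<Longrightarrow> t + h \<in> D"
  shows "locally_integrable E (\<lambda>t. f (t + h))"
  unfolding locally_integrable_def
proof (intro allI impI)
  fix K assume K: "compact K \<and> K \<subseteq> E"
  have "compact ((\<lambda>t. t + h) ` K)"
    using K compact_translation[of K h] by (simp add: add.commute)
  moreover have "(\<lambda>t. t + h) ` K \<subseteq> D"
    using K h by auto
  ultimately have "compact_integrable ((\<lambda>t. t + h) ` K) f"
    using f by (simp add: locally_integrable_def)
  then show "compact_integrable K (\<lambda>t. f (t + h))"
    using K by (intro compact_integrable_translation) (auto simp: lmeasurable_compact fmeasurableD)
qed

text \<open>Closedness of \<open>C\<close> keeps \<open>K \<inter> C\<close> compact, where the
  hypothesis applies. The use is with \<open>C\<close> the region where a function shifted backwards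
  is not set to zero.\<close>

lemma locally_integrable_extend:
  assumes f: "locally_integrable (D \<inter> C) f" and C: "closed C"
  shows "locally_integrable D (\<lambda>t. if t \<in> C then f t else 0)"
  unfolding locally_integrable_def
proof (intro allI impI)
  fix K assume K: "compact K \<and> K \<subseteq> D"
  have comp: "compact (K \<inter> C)"
    using K C by (simp add: compact_Int_closed)
  then have "compact_integrable (K \<inter> C) f"
    using f K by (auto simp: locally_integrable_def)
  then have "compact_integrable K (\<lambda>t. if t \<in> K \<inter> C then f t else 0)"
    using K comp by (intro compact_integral_extend) (auto simp: lmeasurable_compact fmeasurableD)
  then show "compact_integrable K (\<lambda>t. if t \<in> C then f t else 0)"
    by (rule compact_integrable_cong) simp
qed

lemma locally_integrable_linear:
  assumes "locally_integrable D f" "Vector_Spaces.linear (*\<^sub>C) (*\<^sub>C) T" "continuous_on UNIV T"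
  shows "locally_integrable D (\<lambda>t. T (f t))"
  unfolding locally_integrable_def
proof (intro allI impI)
  fix K assume "compact K \<and> K \<subseteq> D"
  then have "K \<in> sets lebesgue" "compact_integrable K f"
    using assms(1) by (auto simp: locally_integrable_def lmeasurable_compact fmeasurableD)
  then show "compact_integrable K (\<lambda>t. T (f t))"
    by (rule compact_integrable_linear[OF _ _ assms(2,3)])
qed

section \<open>Absolutely convergent integrals\<close>

text \<open>The members are bounded Lebesgue sets instead of compact ones, so that an exhaustion can
  be intersected with the complement of \<open>H\<close>, as in \<open>exhausts_Int\<close>.\<close>

definition exhausts :: "(nat \<Rightarrow> 'd::euclidean_space set) \<Rightarrow> 'd set \<Rightarrow> bool" where
  "exhausts A D \<longleftrightarrow> (\<forall>i. A i \<in> sets lebesgue \<and> bounded (A i)) \<and> incseq A \<and> (\<Union>i. A i) = D"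

lemma exhaustsD:
  assumes "exhausts A D"
  shows "A i \<in> sets lebesgue" "bounded (A i)" "incseq A" "A i \<subseteq> D" "(\<Union>i. A i) = D" "A i \<in> lmeasurable"
  using assms by (auto simp: exhausts_def intro: bounded_set_imp_lmeasurable)

lemma exhausts_Int: "exhausts A D \<Longrightarrow> B \<in> sets lebesgue \<Longrightarrow> exhausts (\<lambda>i. A i \<inter> B) (D \<inter> B)"
  unfolding exhausts_def by (auto simp: incseq_def bounded_Int)

lemma exhausts_cball: "D \<in> sets lebesgue \<Longrightarrow> exhausts (\<lambda>i. D \<inter> cball 0 (real i)) (D::'d::euclidean_space set)"
  unfolding exhausts_def by (auto simp: incseq_def bounded_Int intro: real_arch_simple)

text \<open>Dominated convergence with \<open>u\<close> itself as the majorant: each point of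
  \<open>D\<close> eventually leaves \<open>D - A i\<close>.\<close>

lemma nn_integral_tail_tendsto_0:
  fixes u :: "'d::euclidean_space \<Rightarrow> ennreal"
  assumes A: "exhausts A D" and u: "u \<in> borel_measurable (lebesgue_on D)"
    and D: "D \<in> sets lebesgue" and fin: "(\<integral>\<^sup>+ t. u t \<partial>lebesgue_on D) < \<infinity>"
  shows "(\<lambda>i. \<integral>\<^sup>+ t. u t \<partial>lebesgue_on (D - A i)) \<longlonglongrightarrow> 0"
proof -
  have [measurable]: "(\<lambda>t. u t * indicator D t) \<in> borel_measurable lebesgue"
    using u D by (subst (asm) borel_measurable_restrict_space_iff_ennreal) auto
  have [measurable]: "A i \<in> sets lebesgue" for i
    by (rule exhaustsD[OF A])
  have "(\<lambda>i. \<integral>\<^sup>+ t. u t * indicator D t * indicator (- A i) t \<partial>lebesgue) \<longlonglongrightarrow> (\<integral>\<^sup>+ t. 0 \<partial>(lebesgue :: 'd measure))"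
  proof (rule nn_integral_dominated_convergence[where w = "\<lambda>t. u t * indicator D t"])
    show "(\<integral>\<^sup>+ t. u t * indicator D t \<partial>lebesgue) < \<infinity>"
      using fin D by (simp add: nn_integral_restrict_space)
    show "AE t in lebesgue. (\<lambda>i. u t * indicator D t * indicator (- A i) t) \<longlonglongrightarrow> 0"
    proof (rule AE_I2)
      fix t
      show "(\<lambda>i. u t * indicator D t * indicator (- A i) t) \<longlonglongrightarrow> 0"
      proof (cases "t \<in> D")
        case True
        then obtain N where "t \<in> A N" using exhaustsD(5)[OF A] by blast
        then have "t \<in> A i" if "i \<ge> N" for i
          using exhaustsD(3)[OF A] that by (auto simp: incseq_def)
        then have "\<forall>\<^sub>F i in sequentially. u t * indicator D t * indicator (- A i) t = 0"
          by (auto simp: eventually_sequentially intro!: exI[of _ N])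
        then show ?thesis by (rule tendsto_eventually)
      qed simp
    qed
  qed (auto split: split_indicator)
  moreover have "(\<integral>\<^sup>+ t. u t \<partial>lebesgue_on (D - A i)) =
      (\<integral>\<^sup>+ t. u t * indicator D t * indicator (- A i) t \<partial>lebesgue)" for i
    using D exhaustsD(1)[OF A, of i]
    by (auto simp: nn_integral_restrict_space intro!: nn_integral_cong split: split_indicator)
  ultimately show ?thesis by simp
qed

text \<open>The common part over \<open>A \<inter> B\<close> cancels; what remains lives on
  \<open>A - B\<close>, a subset of \<open>D - B\<close>, and on \<open>B - A\<close>, a subset of
  \<open>D - A\<close>. The sets need not be nested, so two unrelated exhaustions can be
  compared.\<close>

lemma seminorm_integral_diff_le:
  fixes f :: "'d::euclidean_space \<Rightarrow> 'a::sclcs"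
  assumes f: "boundedly_integrable D f" and D: "D \<in> sets lebesgue" and p: "p \<in> seminorms"
    and A: "A \<in> sets lebesgue" "bounded A" "A \<subseteq> D" and B: "B \<in> sets lebesgue" "bounded B" "B \<subseteq> D"
  shows "ennreal (p (compact_integral A f - compact_integral B f)) \<le>
    (\<integral>\<^sup>+ t. ennreal (p (f t)) \<partial>lebesgue_on (D - A)) + (\<integral>\<^sup>+ t. ennreal (p (f t)) \<partial>lebesgue_on (D - B))"
proof -
  have sub: "C \<in> lmeasurable \<and> compact_integrable C f" if "C \<in> sets lebesgue" "C \<subseteq> A \<or> C \<subseteq> B" for C
    using that A B f bounded_subset[of A C] bounded_subset[of B C]
    by (auto simp: boundedly_integrable_def intro: bounded_set_imp_lmeasurable)
  have split: "compact_integral C f = compact_integral (C \<inter> E) f + compact_integral (C - E) f"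
    if "C = A \<and> E = B \<or> C = B \<and> E = A" for C E
  proof -
    have *: "C \<in> sets lebesgue" "E \<in> sets lebesgue" "C \<subseteq> A \<or> C \<subseteq> B"
      using that A B by auto
    have "C \<inter> E \<in> lmeasurable" "C - E \<in> lmeasurable" "compact_integrable C f"
      using sub[of "C \<inter> E"] sub[of "C - E"] sub[of C] * by auto
    then show ?thesis
      using compact_integral_Un[of "C \<inter> E" "C - E" f] by (simp add: Int_Diff_Un Int_Diff_disjoint)
  qed
  have le: "ennreal (p (compact_integral C f)) \<le> (\<integral>\<^sup>+ t. ennreal (p (f t)) \<partial>lebesgue_on (D - E))"
    if "C \<in> sets lebesgue" "C \<subseteq> A \<or> C \<subseteq> B" "C \<subseteq> D - E" "E \<in> sets lebesgue" for C E
    using sub[OF that(1,2)] that D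
    by (intro order_trans[OF seminorm_compact_integral_le[OF _ _ p]] nn_integral_lebesgue_on_subset) auto
  have "compact_integral A f - compact_integral B f = compact_integral (A - B) f - compact_integral (B - A) f"
    using split[of A B] split[of B A] by (simp add: Int_commute)
  then have "p (compact_integral A f - compact_integral B f) \<le>
      p (compact_integral (B - A) f) + p (compact_integral (A - B) f)"
    using seminorm_triangle[OF p, of "compact_integral (A - B) f" "- compact_integral (B - A) f"]
    by (simp add: seminorm_minus p)
  then have "ennreal (p (compact_integral A f - compact_integral B f)) \<le>
      ennreal (p (compact_integral (B - A) f)) + ennreal (p (compact_integral (A - B) f))"
    by (simp add: seminorm_nonneg p ennreal_leI flip: ennreal_plus)
  also have "\<dots> \<le> (\<integral>\<^sup>+ t. ennreal (p (f t)) \<partial>lebesgue_on (D - A)) +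
      (\<integral>\<^sup>+ t. ennreal (p (f t)) \<partial>lebesgue_on (D - B))"
    using A B by (intro add_mono le) auto
  finally show ?thesis .
qed

text \<open>A variant of \<open>lcs_integrable\<close> with bounded Lebesgue sets in place of
  compact ones; it is inherited by every Lebesgue subset of \<open>D\<close>, in particular by the
  non-closed set \<open>orthant - H\<close>.\<close>

definition seminorms_integrable :: "'d::euclidean_space set \<Rightarrow> ('d \<Rightarrow> 'a::sclcs) \<Rightarrow> bool" where
  "seminorms_integrable D f \<longleftrightarrow> boundedly_integrable D f \<and> D \<in> sets lebesgue \<and>
     (\<forall>p\<in>seminorms. (\<integral>\<^sup>+ t. ennreal (p (f t)) \<partial>lebesgue_on D) < \<infinity>)"

lemma seminorms_integrable_tail:
  assumes "seminorms_integrable D f" "exhausts A D" "p \<in> seminorms"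
  shows "(\<lambda>i. \<integral>\<^sup>+ t. ennreal (p (f t)) \<partial>lebesgue_on (D - A i)) \<longlonglongrightarrow> 0"
  using assms boundedly_integrable_seminorm_measurable[of D f p]
  by (intro nn_integral_tail_tendsto_0) (auto simp: seminorms_integrable_def)

lemma seminorms_integrable_subset:
  fixes f :: "'d::euclidean_space \<Rightarrow> 'a::sclcs"
  assumes f: "seminorms_integrable D f" and E: "E \<in> sets lebesgue" "E \<subseteq> D"
  shows "seminorms_integrable E f"
  unfolding seminorms_integrable_def
proof (intro conjI ballI)
  show "boundedly_integrable E f"
    using f E(2) boundedly_integrable_subset by (auto simp: seminorms_integrable_def)
  fix p :: "'a \<Rightarrow> real" assume "p \<in> seminorms"
  then show "(\<integral>\<^sup>+ t. ennreal (p (f t)) \<partial>lebesgue_on E) < \<infinity>"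
    using f E by (intro order_le_less_trans[OF nn_integral_lebesgue_on_subset[of D E]])
      (auto simp: seminorms_integrable_def)
qed (rule E(1))

lemma exhausting_integrals_converge:
  fixes f :: "'d::euclidean_space \<Rightarrow> 'a::sclcs"
  assumes f: "seminorms_integrable D f"
  obtains L where "\<And>A. exhausts A D \<Longrightarrow> (\<lambda>i. compact_integral (A i) f) \<longlonglongrightarrow> L"
proof -
  have bi: "boundedly_integrable D f" and D: "D \<in> sets lebesgue"
    using f by (auto simp: seminorms_integrable_def)
  note le = seminorm_integral_diff_le[OF bi D]
  \<comment> \<open>Intersections with balls serve as a reference exhaustion: its integrals form a
    Cauchy sequence, and any other exhaustion is then compared with it.\<close>
  define C where "C i = D \<inter> cball 0 (real i)" for i
  have C: "exhausts C D"
    using exhausts_cball[OF D] by (simp add: C_def[abs_def])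
  have "\<exists>N. \<forall>k\<ge>N. \<forall>m\<ge>N. p (compact_integral (C k) f - compact_integral (C m) f) < e"
    if p: "p \<in> seminorms" and e: "e > 0" for p and e :: real
  proof -
    have "\<forall>\<^sub>F i in sequentially. (\<integral>\<^sup>+ t. ennreal (p (f t)) \<partial>lebesgue_on (D - C i)) \<le> ennreal (e / 3)"
      using seminorms_integrable_tail[OF f C p] e by (simp only: ennreal_tendsto_0_iff_le)
    then obtain N where N: "\<And>i. i \<ge> N \<Longrightarrow> (\<integral>\<^sup>+ t. ennreal (p (f t)) \<partial>lebesgue_on (D - C i)) \<le> ennreal (e / 3)"
      by (auto simp: eventually_sequentially)
    have "p (compact_integral (C k) f - compact_integral (C m) f) < e" if "k \<ge> N" "m \<ge> N" for k m
    proof -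
      have "ennreal (p (compact_integral (C k) f - compact_integral (C m) f)) \<le> ennreal (e / 3) + ennreal (e / 3)"
        by (rule order_trans[OF le[OF p exhaustsD(1,2,4)[OF C] exhaustsD(1,2,4)[OF C]] add_mono[OF N N]])
           (use that in auto)
      then show ?thesis
        using e by (simp add: ennreal_le_iff flip: ennreal_plus)
    qed
    then show ?thesis by blast
  qed
  then obtain L where L: "(\<lambda>i. compact_integral (C i) f) \<longlonglongrightarrow> L"
    by (rule convergent_if_Cauchy)
  show thesis
  proof (rule that)
    fix A assume A: "exhausts A D"
    have "(\<lambda>i. compact_integral (A i) f - compact_integral (C i) f) \<longlonglongrightarrow> 0"
      unfolding tendsto_iff_seminorms
    proof
      fix p :: "'a \<Rightarrow> real" assume p: "p \<in> seminorms"
      show "(\<lambda>i. p (compact_integral (A i) f - compact_integral (C i) f - 0)) \<longlonglongrightarrow> 0"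
      proof (rule tendsto_0_if_ennreal_le)
        show "ennreal (p (compact_integral (A i) f - compact_integral (C i) f - 0)) \<le>
            (\<integral>\<^sup>+ t. ennreal (p (f t)) \<partial>lebesgue_on (D - A i)) +
            (\<integral>\<^sup>+ t. ennreal (p (f t)) \<partial>lebesgue_on (D - C i))" for i
          using le[OF p exhaustsD(1,2,4)[OF A] exhaustsD(1,2,4)[OF C]] by simp
        show "(\<lambda>i. (\<integral>\<^sup>+ t. ennreal (p (f t)) \<partial>lebesgue_on (D - A i)) +
            (\<integral>\<^sup>+ t. ennreal (p (f t)) \<partial>lebesgue_on (D - C i))) \<longlonglongrightarrow> 0"
          using tendsto_add[OF seminorms_integrable_tail[OF f A p] seminorms_integrable_tail[OF f C p]] by simp
      qed (simp add: seminorm_nonneg p)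
    qed
    from tendsto_add_sclcs[OF this L] show "(\<lambda>i. compact_integral (A i) f) \<longlonglongrightarrow> L"
      by simp
  qed
qed

text \<open>\<open>K\<close> witnesses that the definite description in \<open>lcs_integral\<close>
  has a candidate at all; the limit may then be computed along any bounded exhaustion
  \<open>A\<close>, compact or not.\<close>

lemma lcs_integral_tendsto:
  fixes f :: "'d::euclidean_space \<Rightarrow> 'a::sclcs"
  assumes f: "seminorms_integrable D f" and A: "exhausts A D"
    and K: "\<And>i. compact (K i)" "incseq K" "(\<Union>i::nat. K i) = D"
  shows "(\<lambda>i. compact_integral (A i) f) \<longlonglongrightarrow> lcs_integral D f"
proof -
  obtain L where L: "\<And>A. exhausts A D \<Longrightarrow> (\<lambda>i. compact_integral (A i) f) \<longlonglongrightarrow> L"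
    using exhausting_integrals_converge[OF f] by blast
  have ex: "exhausts K' D" if "\<forall>i. compact (K' i)" "incseq K'" "(\<Union>i::nat. K' i) = D" for K'
    using that by (auto simp: exhausts_def compact_imp_bounded lmeasurable_compact fmeasurableD)
  have "lcs_integral D f = L"
    unfolding lcs_integral_def
  proof (rule the_equality)
    show "\<exists>K. (\<forall>i. compact (K i)) \<and> incseq K \<and> (\<Union>i::nat. K i) = D \<and>
        (\<lambda>i. compact_integral (K i) f) \<longlonglongrightarrow> L"
      using K L[OF ex, of K] by blast
  next
    fix J assume "\<exists>K. (\<forall>i. compact (K i)) \<and> incseq K \<and> (\<Union>i::nat. K i) = D \<and>
        (\<lambda>i. compact_integral (K i) f) \<longlonglongrightarrow> J"
    then obtain K' where "(\<forall>i. compact (K' i))" "incseq K'" "(\<Union>i::nat. K' i) = D"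
        "(\<lambda>i. compact_integral (K' i) f) \<longlonglongrightarrow> J"
      by blast
    with L[OF ex[OF this(1-3)]] show "J = L"
      using LIMSEQ_unique by blast
  qed
  with L[OF A] show ?thesis by simp
qed

section \<open>The multidimensional Laplace transform\<close>

abbreviation (input) laplace_integrand :: "(real ^ 'n \<Rightarrow> 'a::sclcs) \<Rightarrow> complex ^ 'n \<Rightarrow> real ^ 'n \<Rightarrow> 'a" where
  "laplace_integrand f lam \<equiv> \<lambda>t. exp (- pairing lam t) *\<^sub>C f t"

lemma closed_orthant: "closed orthant"
  unfolding orthant_def by (simp add: closed_Collect_all closed_Collect_le continuous_on_component)

lemma orthant_lebesgue: "orthant \<in> sets lebesgue"
  by (intro sets_completionI_sets) (simp add: borel_closed closed_orthant)

lemma pairing_add_left: "pairing (lam + z) t = pairing lam t + pairing z t"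
  by (simp add: pairing_def distrib_right sum.distrib)

lemma pairing_add_right: "pairing lam (t + h) = pairing lam t + pairing lam h"
  by (simp add: pairing_def distrib_left sum.distrib)

lemma pairing_diff_right: "pairing lam (t - h) = pairing lam t - pairing lam h"
  by (simp add: pairing_def right_diff_distrib sum_subtractf)

lemma continuous_on_exp_pairing: "continuous_on S (\<lambda>t. exp (- pairing lam t))"
  unfolding pairing_def by (intro continuous_intros)

lemma locally_integrable_laplace_integrand:
  "locally_integrable orthant f \<Longrightarrow> locally_integrable orthant (laplace_integrand f lam)"
  by (rule locally_integrable_mult[OF _ continuous_on_exp_pairing])

lemma boundedly_integrable_laplace_integrand:
  "locally_integrable orthant f \<Longrightarrow> boundedly_integrable orthant (laplace_integrand f lam)"
  by (intro locally_integrable_imp_boundedly closed_orthant locally_integrable_laplace_integrand)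

text \<open>Connects the definition with the theory of absolutely convergent integrals; the orthant
  is closed, so local integrability gives integrability over bounded sets.\<close>

lemma Omega_abs_iff:
  "lam \<in> Omega_abs f \<longleftrightarrow>
    locally_integrable orthant f \<and> seminorms_integrable orthant (laplace_integrand f lam)"
  using boundedly_integrable_laplace_integrand
  by (auto simp: Omega_abs_def seminorms_integrable_def orthant_lebesgue)

lemma cbox_0_subset_orthant: "cbox 0 t \<subseteq> orthant"
  by (auto simp: orthant_def mem_box_cart)

lemma cbox_cart_mono:
  fixes a b a' b' :: "real ^ 'n"
  assumes "\<And>j. a' $ j \<le> a $ j" "\<And>j. b $ j \<le> b' $ j"
  shows "cbox a b \<subseteq> cbox a' b'"
proof
  fix t assume "t \<in> cbox a b"
  then have "a $ j \<le> t $ j" "t $ j \<le> b $ j" for j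
    by (simp_all add: mem_box_cart)
  then have "a' $ j \<le> t $ j" "t $ j \<le> b' $ j" for j
    using assms order_trans by blast+
  then show "t \<in> cbox a' b'"
    by (simp add: mem_box_cart)
qed

lemma compact_integrable_laplace_integrand:
  "locally_integrable orthant f \<Longrightarrow> compact_integrable (cbox 0 t) (laplace_integrand f lam)"
  using locally_integrable_laplace_integrand[of f lam] cbox_0_subset_orthant[of t]
  by (auto simp: locally_integrable_def compact_cbox)

text \<open>The offset \<open>c\<close> is 0 for plain cubes and \<open>h\<close> for the boxes of
  (i), which have to end at translated corners.\<close>

lemma exhausts_orthant:
  fixes c :: "real ^ 'n"
  assumes "\<And>j. 0 \<le> c $ j"
  shows "exhausts (\<lambda>i. cbox 0 ((\<chi> j. real i) + c)) orthant"
  unfolding exhausts_def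
proof (intro conjI allI)
  show "incseq (\<lambda>i. cbox 0 ((\<chi> j. real i) + c))"
    unfolding incseq_def by (intro allI impI cbox_cart_mono) simp_all
  show "(\<Union>i. cbox 0 ((\<chi> j. real i) + c)) = orthant"
  proof (intro equalityI subsetI)
    fix t :: "real ^ 'n" assume t: "t \<in> orthant"
    obtain N where N: "(\<Sum>j\<in>UNIV. \<bar>t $ j\<bar>) \<le> real N" using real_arch_simple by blast
    have "t $ j \<le> real N + c $ j" for j
      using member_le_sum[of j UNIV "\<lambda>j. \<bar>t $ j\<bar>"] N assms[of j] by force
    then have "t \<in> cbox 0 ((\<chi> j. real N) + c)"
      using t by (simp add: orthant_def mem_box_cart)
    then show "t \<in> (\<Union>i. cbox 0 ((\<chi> j. real i) + c))" by blast
  qed (use cbox_0_subset_orthant in blast)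
qed (auto simp: bounded_cbox)

subsection \<open>Joint limits\<close>

lemma has_laplace_tendsto:
  fixes f :: "real ^ 'n \<Rightarrow> 'a::sclcs" and T :: "'i \<Rightarrow> real ^ 'n"
  assumes L: "has_laplace f lam L" and T: "\<And>j. filterlim (\<lambda>i. T i $ j) at_top \<F>"
  shows "((\<lambda>i. laplace_partial f lam (T i)) \<longlongrightarrow> L) \<F>"
  unfolding tendsto_iff_seminorms
proof (intro ballI tendstoI)
  fix p :: "'a \<Rightarrow> real" and e :: real assume p: "p \<in> seminorms" and "e > 0"
  then obtain M where M: "\<And>t. (\<forall>j. t $ j > M) \<Longrightarrow> p (laplace_partial f lam t - L) < e"
    using L unfolding has_laplace_def by blast
  have "\<forall>\<^sub>F i in \<F>. \<forall>j. T i $ j > M"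
    using T by (intro eventually_all_finite) (simp add: filterlim_at_top_dense)
  then show "\<forall>\<^sub>F i in \<F>. dist (p (laplace_partial f lam (T i) - L)) 0 < e"
    by eventually_elim (simp add: M seminorm_nonneg p)
qed

text \<open>Once the joint limit is known to exist, this single sequence determines it. Uniqueness,
  the formula in (i) and the closedness argument in (v) all rest on it.\<close>

lemma has_laplace_tendsto_diagonal:
  "has_laplace f lam L \<Longrightarrow> (\<lambda>i. laplace_partial f lam ((\<chi> j. real i) + c)) \<longlonglongrightarrow> L"
proof (erule has_laplace_tendsto)
  show "filterlim (\<lambda>i. ((\<chi> j. real i) + c) $ j) at_top sequentially" for j
    using filterlim_tendsto_add_at_top[OF tendsto_const filterlim_real_sequentially, of "c $ j"]
    by (simp add: add.commute)
qed

lemma has_laplace_unique: "has_laplace f lam L \<Longrightarrow> has_laplace f lam L' \<Longrightarrow> L = L'"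
  using has_laplace_tendsto_diagonal[of f lam _ 0] LIMSEQ_unique by blast

lemma laplace_eqI: "has_laplace f lam L \<Longrightarrow> laplace f lam = L"
  unfolding laplace_def by (rule the_equality) (auto dest: has_laplace_unique)

lemma has_laplace_laplace: "lam \<in> Omega f \<Longrightarrow> has_laplace f lam (laplace f lam)"
  by (auto simp: Omega_def laplace_eqI)

text \<open>One cube \<open>C N\<close> with small tail is fixed. Any box whose sides all exceed
  \<open>N\<close> contains it and so has a tail at least as small, whatever the proportions of the
  box; this gives the joint limit.\<close>

lemma Omega_abs_subset_Omega:
  fixes f :: "real ^ 'n \<Rightarrow> 'a::sclcs"
  shows "Omega_abs f \<subseteq> Omega f"
proof
  fix lam assume lam: "lam \<in> Omega_abs f"
  let ?e = "laplace_integrand f lam"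
  have loc: "locally_integrable orthant f" and e: "seminorms_integrable orthant ?e"
    using lam by (auto simp: Omega_abs_iff)
  obtain L where L: "\<And>A. exhausts A orthant \<Longrightarrow> (\<lambda>i. compact_integral (A i) ?e) \<longlonglongrightarrow> L"
    using exhausting_integrals_converge[OF e] by blast
  define C where "C i = cbox 0 ((\<chi> j. real i) + (0 :: real ^ 'n))" for i
  have C: "exhausts C orthant"
    using exhausts_orthant[of 0] by (simp add: C_def[abs_def])
  have "has_laplace f lam L"
    unfolding has_laplace_def
  proof (intro ballI allI impI)
    fix p :: "'a \<Rightarrow> real" and \<epsilon> :: real assume p: "p \<in> seminorms" and \<epsilon>: "\<epsilon> > 0"
    have "\<forall>\<^sub>F i in sequentially. (\<integral>\<^sup>+ t. ennreal (p (?e t)) \<partial>lebesgue_on (orthant - C i)) \<le> ennreal (\<epsilon> / 4)"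
      using seminorms_integrable_tail[OF e C p] \<epsilon> by (simp only: ennreal_tendsto_0_iff_le)
    moreover have "\<forall>\<^sub>F i in sequentially. p (compact_integral (C i) ?e - L) < \<epsilon> / 4"
      using L[OF C] p \<epsilon> by (intro order_tendstoD(2)[where y = 0]) (auto simp: tendsto_iff_seminorms)
    \<comment> \<open>Two tails and the distance of the cube integral to \<open>L\<close> cost a
      quarter of \<open>\<epsilon>\<close> each. Positivity of the index is recorded because the
      bound in \<open>has_laplace\<close> has to be positive.\<close>
    ultimately have "\<forall>\<^sub>F i in sequentially. (\<integral>\<^sup>+ t. ennreal (p (?e t)) \<partial>lebesgue_on (orthant - C i)) \<le> ennreal (\<epsilon> / 4)
        \<and> p (compact_integral (C i) ?e - L) < \<epsilon> / 4 \<and> i > 0"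
      using eventually_gt_at_top[of 0] by eventually_elim simp
    then obtain N where N: "(\<integral>\<^sup>+ t. ennreal (p (?e t)) \<partial>lebesgue_on (orthant - C N)) \<le> ennreal (\<epsilon> / 4)"
        "p (compact_integral (C N) ?e - L) < \<epsilon> / 4" "N > 0"
      by (auto simp: eventually_sequentially)
    have "p (laplace_partial f lam t - L) < \<epsilon>" if t: "\<forall>j. t $ j > real N" for t
    proof -
      have "C N \<subseteq> cbox 0 t"
        using t unfolding C_def by (intro cbox_cart_mono) (simp_all add: less_imp_le)
      then have "(\<integral>\<^sup>+ t. ennreal (p (?e t)) \<partial>lebesgue_on (orthant - cbox 0 t)) \<le> ennreal (\<epsilon> / 4)"
        by (intro order_trans[OF nn_integral_lebesgue_on_subset N(1)])
           (auto simp: C_def orthant_lebesgue)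
      then have "ennreal (p (laplace_partial f lam t - compact_integral (C N) ?e)) \<le> ennreal (\<epsilon> / 4) + ennreal (\<epsilon> / 4)"
        unfolding laplace_partial_def using N(1)
        by (intro order_trans[OF seminorm_integral_diff_le[OF boundedly_integrable_laplace_integrand[OF loc]
              orthant_lebesgue p] add_mono])
           (auto simp: cbox_0_subset_orthant exhaustsD[OF C] bounded_cbox)
      then have "p (laplace_partial f lam t - compact_integral (C N) ?e) \<le> \<epsilon> / 2"
        using \<epsilon> by (simp add: ennreal_le_iff flip: ennreal_plus)
      then show ?thesis
        using N(2) seminorm_triangle_sub[OF p, of "laplace_partial f lam t" L "compact_integral (C N) ?e"] \<epsilon>
        by linarith
    qed
    then show "\<exists>M>0. \<forall>t. (\<forall>j. t $ j > M) \<longrightarrow> p (laplace_partial f lam t - L) < \<epsilon>"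
      using N(3) by (intro exI[of _ "real N"]) auto
  qed
  with loc show "lam \<in> Omega f" by (auto simp: Omega_def)
qed

text \<open>Collects the quantifier work of the joint limit: a fixed displacement of the corner and
  a fixed scalar factor only change the threshold and the tolerance. It is applied with
  \<open>d = - h\<close> and with \<open>d = h\<close> for the two directions of (ii).\<close>

lemma has_laplace_shift:
  fixes f g :: "real ^ 'n \<Rightarrow> 'a::sclcs"
  assumes L: "has_laplace f lam L"
    and eq: "\<And>t. (\<forall>j. t $ j > N) \<Longrightarrow> laplace_partial g mu t = c *\<^sub>C laplace_partial f lam (t + d)"
  shows "has_laplace g mu (c *\<^sub>C L)"
  unfolding has_laplace_def
proof (intro ballI allI impI)
  fix p :: "'a \<Rightarrow> real" and e :: real assume p: "p \<in> seminorms" and e: "e > 0"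
  \<comment> \<open>Adding 1 covers the case \<open>c = 0\<close>.\<close>
  have "e / (cmod c + 1) > 0" using e by (simp add: add_nonneg_pos)
  then obtain M where M: "M > 0" "\<And>t. (\<forall>j. t $ j > M) \<Longrightarrow> p (laplace_partial f lam t - L) < e / (cmod c + 1)"
    using L p unfolding has_laplace_def by meson
  \<comment> \<open>The sum bounds every coordinate of \<open>d\<close>, so beyond \<open>M'\<close>
    each \<open>t $ j\<close> exceeds \<open>N\<close> and each \<open>(t + d) $ j\<close> exceeds
    \<open>M\<close>.\<close>
  define M' where "M' = \<bar>N\<bar> + M + (\<Sum>j\<in>UNIV. \<bar>d $ j\<bar>)"
  have "M' > 0" using M(1) by (simp add: M'_def add_nonneg_pos add_pos_nonneg sum_nonneg)
  moreover have "p (laplace_partial g mu t - c *\<^sub>C L) < e" if t: "\<forall>j. t $ j > M'" for t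
  proof -
    have "t $ j > N" "(t + d) $ j > M" for j
      using t[rule_format, of j] member_le_sum[of j UNIV "\<lambda>j. \<bar>d $ j\<bar>"] M(1) by (force simp: M'_def)+
    then have "p (laplace_partial g mu t - c *\<^sub>C L) = cmod c * p (laplace_partial f lam (t + d) - L)"
      and "p (laplace_partial f lam (t + d) - L) < e / (cmod c + 1)"
      by (simp_all add: eq M(2) seminorm_scaleC p flip: sclcs.scale_right_diff_distrib)
    moreover have "cmod c * p (laplace_partial f lam (t + d) - L) \<le> (cmod c + 1) * p (laplace_partial f lam (t + d) - L)"
      by (intro mult_right_mono) (simp_all add: seminorm_nonneg p)
    moreover have "(cmod c + 1) * p (laplace_partial f lam (t + d) - L) < e"
      using calculation(2) by (simp add: pos_less_divide_eq add_nonneg_pos mult.commute)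
    ultimately show ?thesis by linarith
  qed
  ultimately show "\<exists>M>0. \<forall>t. (\<forall>j. t $ j > M) \<longrightarrow> p (laplace_partial g mu t - c *\<^sub>C L) < e"
    by blast
qed

subsection \<open>Translations\<close>

lemma image_translation_cbox: "(\<lambda>t. t + h) ` cbox a b = cbox (a + h) (b + h :: 'd::euclidean_space)"
  using cbox_translation[of h a b] by (simp add: add.commute)

lemma image_translation_orthant: "(\<lambda>t. t + h) ` orthant = {t. \<forall>j. h $ j \<le> t $ j}"
proof (intro equalityI subsetI)
  fix t assume "t \<in> {t. \<forall>j. h $ j \<le> t $ j}"
  then have "t - h \<in> orthant" by (simp add: orthant_def)
  then have "t - h + h \<in> (\<lambda>t. t + h) ` orthant" by (rule imageI)
  then show "t \<in> (\<lambda>t. t + h) ` orthant" by simp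
qed (auto simp: orthant_def)

lemma closed_shifted_orthant: "closed {t :: real ^ 'n. \<forall>j. h $ j \<le> t $ j}"
  by (simp add: closed_Collect_all closed_Collect_le continuous_on_component)

text \<open>Writing \<open>exp (- pairing lam s)\<close> as
  \<open>exp (pairing lam h) * exp (- pairing lam (s + h))\<close> makes the integrand a translate,
  and the box from 0 to \<open>t\<close> is carried to the box from \<open>h\<close> to
  \<open>t + h\<close>.\<close>

lemma laplace_partial_forward_shift:
  fixes f :: "real ^ 'n \<Rightarrow> 'a::sclcs"
  assumes f: "locally_integrable orthant f" and h: "\<And>j. 0 \<le> h $ j"
  shows "laplace_partial (\<lambda>t. f (t + h)) lam t =
    exp (pairing lam h) *\<^sub>C compact_integral (cbox h (t + h)) (laplace_integrand f lam)"
proof -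
  let ?e = "laplace_integrand f lam"
  have "cbox h (t + h) \<subseteq> cbox 0 (t + h)"
    by (intro cbox_cart_mono) (simp_all add: h)
  then have int: "compact_integrable (cbox h (t + h)) ?e"
    using compact_integrable_laplace_integrand[OF f] by (rule compact_integrable_subset[rotated 2]) auto
  have tr: "(\<lambda>s. s + h) ` cbox 0 t = cbox h (t + h)"
    by (simp add: image_translation_cbox)
  have "laplace_partial (\<lambda>t. f (t + h)) lam t =
      compact_integral (cbox 0 t) (\<lambda>s. exp (pairing lam h) *\<^sub>C ?e (s + h))"
    unfolding laplace_partial_def
    by (intro compact_integral_cong) (simp add: scaleC_scaleC pairing_add_right exp_diff exp_minus field_simps flip: exp_add)
  also have "\<dots> = exp (pairing lam h) *\<^sub>C compact_integral (cbox 0 t) (\<lambda>s. ?e (s + h))"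
    using compact_integrable_translation[of "cbox 0 t" h ?e] int
    by (intro compact_integral_scaleC) (auto simp: tr)
  also have "compact_integral (cbox 0 t) (\<lambda>s. ?e (s + h)) = compact_integral (cbox h (t + h)) ?e"
    using compact_integral_translation[of "cbox 0 t" h ?e] int by (simp add: tr)
  finally show ?thesis .
qed

definition backward_shift :: "real ^ 'n \<Rightarrow> (real ^ 'n \<Rightarrow> 'a::sclcs) \<Rightarrow> real ^ 'n \<Rightarrow> 'a" where
  "backward_shift h f t = (if \<forall>j. h $ j \<le> t $ j then f (t - h) else 0)"

lemma locally_integrable_backward_shift:
  assumes f: "locally_integrable orthant f"
  shows "locally_integrable orthant (backward_shift h f)"
proof -
  have "locally_integrable (orthant \<inter> {t. \<forall>j. h $ j \<le> t $ j}) (\<lambda>t. f (t + - h))"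
    using f by (rule locally_integrable_translation) (simp add: orthant_def)
  from locally_integrable_extend[OF this closed_shifted_orthant] show ?thesis
    by (simp add: backward_shift_def[abs_def] cong: if_cong)
qed

text \<open>Holds for every \<open>t\<close>: if some \<open>t $ j\<close> is below
  \<open>h $ j\<close>, both \<open>cbox h t\<close> and \<open>cbox 0 (t - h)\<close> are empty and
  both sides vanish.\<close>

lemma laplace_partial_backward_shift:
  fixes f :: "real ^ 'n \<Rightarrow> 'a::sclcs"
  assumes f: "locally_integrable orthant f" and h: "\<And>j. 0 \<le> h $ j"
  shows "laplace_partial (backward_shift h f) lam t = exp (- pairing lam h) *\<^sub>C laplace_partial f lam (t - h)"
proof -
  let ?e = "laplace_integrand f lam"
  have tr: "(\<lambda>s. s + - h) ` cbox h t = cbox 0 (t - h)"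
    unfolding image_translation_cbox by simp
  have int: "compact_integrable ((\<lambda>s. s + - h) ` cbox h t) ?e"
    unfolding tr by (rule compact_integrable_laplace_integrand[OF f])
  then have int': "compact_integrable (cbox h t) (\<lambda>s. ?e (s + - h))"
    by (intro compact_integrable_translation) auto
  have sub: "cbox h t \<subseteq> cbox 0 t"
    using h by (intro cbox_cart_mono) simp_all
  let ?u = "\<lambda>s. exp (- pairing lam h) *\<^sub>C ?e (s + - h)"
  have int'': "compact_integrable (cbox h t) ?u"
    by (rule compact_integrable_linear[OF _ int' linear_scaleC continuous_on_scaleC]) simp
  have "laplace_partial (backward_shift h f) lam t =
      compact_integral (cbox 0 t) (\<lambda>s. if s \<in> cbox h t then ?u s else 0)"
    unfolding laplace_partial_def
    by (intro compact_integral_cong)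
       (auto simp: backward_shift_def mem_box_cart scaleC_scaleC pairing_diff_right simp flip: exp_add)
  also have "\<dots> = compact_integral (cbox h t) ?u"
    by (rule compact_integral_extend(2)[OF _ _ sub int'']) auto
  also have "\<dots> = exp (- pairing lam h) *\<^sub>C compact_integral (cbox h t) (\<lambda>s. ?e (s + - h))"
    by (rule compact_integral_scaleC[OF _ int']) simp
  also have "compact_integral (cbox h t) (\<lambda>s. ?e (s + - h)) = laplace_partial f lam (t - h)"
    unfolding laplace_partial_def tr[symmetric] by (rule compact_integral_translation[OF _ int]) simp
  finally show ?thesis .
qed

lemma has_laplace_backward_shift:
  assumes f: "locally_integrable orthant f" and h: "\<And>j. 0 \<le> h $ j"
  shows "has_laplace f lam L \<Longrightarrow> has_laplace (backward_shift h f) lam (exp (- pairing lam h) *\<^sub>C L)"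
    "has_laplace (backward_shift h f) lam L \<Longrightarrow> has_laplace f lam (exp (pairing lam h) *\<^sub>C L)"
proof -
  note eq = laplace_partial_backward_shift[OF f h]
  show "has_laplace f lam L \<Longrightarrow> has_laplace (backward_shift h f) lam (exp (- pairing lam h) *\<^sub>C L)"
    by (erule has_laplace_shift[where d = "- h" and N = 0]) (simp add: eq)
  show "has_laplace (backward_shift h f) lam L \<Longrightarrow> has_laplace f lam (exp (pairing lam h) *\<^sub>C L)"
    by (erule has_laplace_shift[where d = h and N = 0])
       (simp add: eq scaleC_scaleC scaleC_one flip: exp_add)
qed

lemma Omega_backward_shift_iff:
  assumes "locally_integrable orthant f" and "\<And>j. 0 \<le> h $ j"
  shows "lam \<in> Omega (backward_shift h f) \<longleftrightarrow> lam \<in> Omega f"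
  using has_laplace_backward_shift[OF assms] locally_integrable_backward_shift[OF assms(1)] assms(1)
  unfolding Omega_def by blast

text \<open>The shifted function vanishes off the translated orthant, so nothing is lost and an
  equality results. Its factor is positive and finite, hence finiteness transfers in both
  directions, as (ii) requires.\<close>

lemma nn_integral_backward_shift:
  fixes f :: "real ^ 'n \<Rightarrow> 'a::sclcs"
  assumes f: "locally_integrable orthant f" and h: "\<And>j. 0 \<le> h $ j" and p: "p \<in> seminorms"
  shows "(\<integral>\<^sup>+ t. ennreal (p (laplace_integrand (backward_shift h f) lam t)) \<partial>lebesgue_on orthant) =
    ennreal (cmod (exp (- pairing lam h))) *
      (\<integral>\<^sup>+ t. ennreal (p (laplace_integrand f lam t)) \<partial>lebesgue_on orthant)"
proof -
  let ?e = "laplace_integrand (backward_shift h f) lam" and ?H = "(\<lambda>t. t + h) ` orthant :: (real ^ 'n) set"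
  have H: "?H \<in> sets lebesgue" "?H \<subseteq> orthant"
    using h by (intro sets_lebesgue_translation orthant_lebesgue, auto simp: orthant_def)
  have "boundedly_integrable ?H ?e"
    using boundedly_integrable_laplace_integrand[OF locally_integrable_backward_shift[OF f]] H(2)
    by (rule boundedly_integrable_subset)
  then have meas: "(\<lambda>t. ennreal (p (?e t))) \<in> borel_measurable (lebesgue_on ?H)"
    using boundedly_integrable_seminorm_measurable[OF _ H(1) p] by simp
  have measf: "(\<lambda>t. ennreal (p (laplace_integrand f lam t))) \<in> borel_measurable (lebesgue_on orthant)"
    using boundedly_integrable_seminorm_measurable[OF boundedly_integrable_laplace_integrand[OF f] orthant_lebesgue p]
    by simp
  have "(\<integral>\<^sup>+ t. ennreal (p (?e t)) \<partial>lebesgue_on orthant) = (\<integral>\<^sup>+ t. ennreal (p (?e t)) \<partial>lebesgue_on ?H)"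
  proof -
    have eq: "ennreal (p (?e t)) * indicator orthant t = ennreal (p (?e t)) * indicator ?H t" for t
    proof (cases "t \<in> ?H")
      case True
      then show ?thesis using H(2) by (simp add: subset_iff)
    next
      case False
      then have "backward_shift h f t = 0"
        unfolding image_translation_orthant backward_shift_def by auto
      then show ?thesis by (simp add: seminorm_zero p)
    qed
    have restrict: "(\<integral>\<^sup>+ t. u t \<partial>lebesgue_on S) = (\<integral>\<^sup>+ t. u t * indicator S t \<partial>lebesgue)"
      if "S \<in> sets lebesgue" for S and u :: "real ^ 'n \<Rightarrow> ennreal"
      using that by (simp add: nn_integral_restrict_space)
    show ?thesis
      unfolding restrict[OF H(1)] restrict[OF orthant_lebesgue] by (intro nn_integral_cong eq)
  qed
  also have "\<dots> = (\<integral>\<^sup>+ t. ennreal (p (?e (t + h))) \<partial>lebesgue_on orthant)"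
    by (rule nn_integral_translation[OF orthant_lebesgue meas, symmetric])
  also have "\<dots> = (\<integral>\<^sup>+ t. ennreal (cmod (exp (- pairing lam h))) * ennreal (p (laplace_integrand f lam t)) \<partial>lebesgue_on orthant)"
  proof (rule nn_integral_cong)
    fix t :: "real ^ 'n" assume "t \<in> space (lebesgue_on orthant)"
    then have "\<forall>j. h $ j \<le> (t + h) $ j" by (simp add: orthant_def)
    then have "?e (t + h) = exp (- pairing lam h) *\<^sub>C laplace_integrand f lam t"
      unfolding backward_shift_def
      by (simp add: scaleC_scaleC pairing_add_right minus_diff_commute flip: exp_add)
    then show "ennreal (p (?e (t + h))) = ennreal (cmod (exp (- pairing lam h))) * ennreal (p (laplace_integrand f lam t))"
      by (simp only: seminorm_scaleC[OF p] ennreal_mult[OF norm_ge_zero seminorm_nonneg[OF p]]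
          mult_nonneg_nonneg norm_ge_zero seminorm_nonneg[OF p] ennreal_mult)
  qed
  also have "\<dots> = ennreal (cmod (exp (- pairing lam h))) *
      (\<integral>\<^sup>+ t. ennreal (p (laplace_integrand f lam t)) \<partial>lebesgue_on orthant)"
    by (rule nn_integral_cmult[OF measf])
  finally show ?thesis .
qed

lemma Omega_abs_backward_shift_iff:
  fixes f :: "real ^ 'n \<Rightarrow> 'a::sclcs"
  assumes f: "locally_integrable orthant f" and h: "\<And>j. 0 \<le> h $ j"
  shows "lam \<in> Omega_abs (backward_shift h f) \<longleftrightarrow> lam \<in> Omega_abs f"
proof -
  have "ennreal (cmod (exp (- pairing lam h))) * x < \<infinity> \<longleftrightarrow> x < \<infinity>" for x
    by (auto simp: ennreal_mult_less_top)
  then show ?thesis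
    using f locally_integrable_backward_shift[OF f, of h]
    by (simp add: Omega_abs_def nn_integral_backward_shift[OF f h] cong: ball_cong)
qed

text \<open>Translation turns the integral over the orthant into a multiple of the integral of the
  original integrand over \<open>?H\<close>; the inequality comes from discarding the part of the
  orthant outside \<open>?H\<close>.\<close>

lemma Omega_abs_forward_shift:
  fixes f :: "real ^ 'n \<Rightarrow> 'a::sclcs"
  assumes lam: "lam \<in> Omega_abs f" and h: "\<And>j. 0 \<le> h $ j"
  shows "lam \<in> Omega_abs (\<lambda>t. f (t + h))"
proof -
  let ?e = "laplace_integrand f lam" and ?H = "(\<lambda>t. t + h) ` orthant :: (real ^ 'n) set"
  have f: "locally_integrable orthant f" using lam by (simp add: Omega_abs_def)
  have H: "?H \<in> sets lebesgue" "?H \<subseteq> orthant"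
    using h by (intro sets_lebesgue_translation orthant_lebesgue, auto simp: orthant_def)
  have "locally_integrable orthant (\<lambda>t. f (t + h))"
    using f by (rule locally_integrable_translation) (use h in \<open>auto simp: orthant_def\<close>)
  moreover have "(\<integral>\<^sup>+ t. ennreal (p (laplace_integrand (\<lambda>t. f (t + h)) lam t)) \<partial>lebesgue_on orthant) < \<infinity>"
    if p: "p \<in> seminorms" for p
  proof -
    have meas: "(\<lambda>t. ennreal (p (?e t))) \<in> borel_measurable (lebesgue_on ?H)"
      using boundedly_integrable_seminorm_measurable[OF boundedly_integrable_subset
          [OF boundedly_integrable_laplace_integrand[OF f] H(2)] H(1) p] by simp
    then have meas': "(\<lambda>t. ennreal (p (?e (t + h)))) \<in> borel_measurable (lebesgue_on orthant)"
      by (rule measurable_compose[OF measurable_lebesgue_on_translation[OF orthant_lebesgue]])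
    have "laplace_integrand (\<lambda>t. f (t + h)) lam t = exp (pairing lam h) *\<^sub>C ?e (t + h)" for t
      by (simp add: scaleC_scaleC pairing_add_right flip: exp_add)
    then have "(\<integral>\<^sup>+ t. ennreal (p (laplace_integrand (\<lambda>t. f (t + h)) lam t)) \<partial>lebesgue_on orthant) =
        (\<integral>\<^sup>+ t. ennreal (cmod (exp (pairing lam h))) * ennreal (p (?e (t + h))) \<partial>lebesgue_on orthant)"
      by (simp only: seminorm_scaleC[OF p] ennreal_mult[OF norm_ge_zero
          mult_nonneg_nonneg[OF norm_ge_zero seminorm_nonneg[OF p]]])
    also have "\<dots> = ennreal (cmod (exp (pairing lam h))) * (\<integral>\<^sup>+ t. ennreal (p (?e (t + h))) \<partial>lebesgue_on orthant)"
      by (rule nn_integral_cmult[OF meas'])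
    also have "(\<integral>\<^sup>+ t. ennreal (p (?e (t + h))) \<partial>lebesgue_on orthant) = (\<integral>\<^sup>+ t. ennreal (p (?e t)) \<partial>lebesgue_on ?H)"
      by (rule nn_integral_translation[OF orthant_lebesgue meas])
    also have "\<dots> \<le> (\<integral>\<^sup>+ t. ennreal (p (?e t)) \<partial>lebesgue_on orthant)"
      by (rule nn_integral_lebesgue_on_subset[OF orthant_lebesgue H])
    finally show ?thesis
      using lam p by (simp add: Omega_abs_def ennreal_mult_less_top mult_left_mono order_le_less_trans)
  qed
  ultimately show ?thesis
    by (simp add: Omega_abs_def)
qed

text \<open>The set is not closed in general, as it requires the strict inequality
  \<open>t $ j < h $ j\<close> for some \<open>j\<close>. Keeping a margin of
  \<open>inverse (real (Suc i))\<close> makes the condition closed, the union over \<open>j\<close>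
  is finite, and the margin shrinks as the cubes grow. \<open>lcs_integral\<close> is defined
  through such compact exhaustions.\<close>

lemma compact_exhaustion_orthant_diff:
  fixes h :: "real ^ 'n"
  obtains K :: "nat \<Rightarrow> (real ^ 'n) set"
  where "\<And>i. compact (K i)" "incseq K" "(\<Union>i. K i) = orthant - {t. \<forall>j. h $ j \<le> t $ j}"
proof
  define K where "K i = cbox 0 ((\<chi> j. real i) + 0) \<inter> (\<Union>j. {t. t $ j \<le> h $ j - inverse (real (Suc i))})"
    for i :: nat
  show "compact (K i)" for i
    unfolding K_def by (intro compact_Int_closed closed_UN finite ballI compact_cbox closed_halfspace_component_le_cart)
  have mono: "K i \<subseteq> K k" if "i \<le> k" for i k
  proof -
    have "inverse (real (Suc k)) \<le> inverse (real (Suc i))"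
      using that by (intro le_imp_inverse_le) auto
    then have "{t. t $ j \<le> h $ j - inverse (real (Suc i))} \<subseteq> {t. t $ j \<le> h $ j - inverse (real (Suc k))}" for j
      by (intro Collect_mono impI) (erule order_trans[OF _ diff_left_mono])
    moreover have "cbox 0 ((\<chi> j. real i) + 0) \<subseteq> cbox (0 :: real ^ 'n) ((\<chi> j. real k) + 0)"
      using that by (intro cbox_cart_mono) simp_all
    ultimately show ?thesis
      unfolding K_def by (intro Int_mono UN_mono) auto
  qed
  then show "incseq K" by (simp add: incseq_def)
  show "(\<Union>i. K i) = orthant - {t. \<forall>j. h $ j \<le> t $ j}"
  proof (intro equalityI subsetI)
    fix t assume "t \<in> (\<Union>i. K i)"
    then obtain i j where t: "t \<in> cbox 0 ((\<chi> j. real i) + 0)" "t $ j \<le> h $ j - inverse (real (Suc i))"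
      by (auto simp: K_def)
    have "inverse (real (Suc i)) > 0" by simp
    with t(2) have "\<not> h $ j \<le> t $ j" by linarith
    with t(1) cbox_0_subset_orthant show "t \<in> orthant - {t. \<forall>j. h $ j \<le> t $ j}"
      by blast
  next
    fix t assume t: "t \<in> orthant - {t. \<forall>j. h $ j \<le> t $ j}"
    then obtain j where j: "t $ j < h $ j" by (auto simp: not_le)
    obtain M where M: "t \<in> cbox 0 ((\<chi> j. real M) + 0)"
      using t exhaustsD(5)[OF exhausts_orthant[of "0 :: real ^ 'n"]] by auto
    obtain N where N: "inverse (real (Suc N)) < h $ j - t $ j"
      using reals_Archimedean[of "h $ j - t $ j"] j by auto
    have "t \<in> cbox 0 ((\<chi> j. real (max M N)) + 0)"
      by (rule subsetD[OF cbox_cart_mono M]) simp_all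
    moreover have "inverse (real (Suc (max M N))) \<le> inverse (real (Suc N))"
      by (intro le_imp_inverse_le) auto
    with N have "t $ j \<le> h $ j - inverse (real (Suc (max M N)))" by linarith
    ultimately have "t \<in> K (max M N)" unfolding K_def by blast
    then show "t \<in> (\<Union>i. K i)" by blast
  qed
qed

lemma laplace_forward_shift:
  fixes f :: "real ^ 'n \<Rightarrow> 'a::sclcs"
  assumes lam: "lam \<in> Omega_abs f" and h: "\<And>j. 0 \<le> h $ j"
  defines "H \<equiv> {t. \<forall>j. h $ j \<le> t $ j}"
  shows "lcs_integrable (orthant - H) (laplace_integrand f lam)"
    and "laplace (\<lambda>t. f (t + h)) lam = exp (pairing lam h) *\<^sub>C laplace f lam -
      exp (pairing lam h) *\<^sub>C lcs_integral (orthant - H) (laplace_integrand f lam)"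
proof -
  let ?e = "laplace_integrand f lam" and ?D = "orthant - H"
  have f: "locally_integrable orthant f" and e: "seminorms_integrable orthant ?e"
    using lam by (auto simp: Omega_abs_iff)
  have H: "H \<in> sets lebesgue"
    unfolding H_def by (intro sets_completionI_sets) (simp add: borel_closed closed_shifted_orthant)
  have eD: "seminorms_integrable ?D ?e"
    by (rule seminorms_integrable_subset[OF e]) (auto intro: sets.Diff orthant_lebesgue H)
  then show "lcs_integrable ?D ?e"
    by (simp add: lcs_integrable_def seminorms_integrable_def boundedly_integrable_imp_locally)
  \<comment> \<open>With the offset \<open>h\<close>, the part of \<open>A i\<close> inside
    \<open>H\<close> is exactly the translate by \<open>h\<close> of the cube of side
    \<open>i\<close>, over which the partial integral of the shifted function is taken.\<close>
  define A where "A i = cbox 0 ((\<chi> j. real i) + h)" for i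
  have A: "exhausts A orthant"
    using exhausts_orthant[of h] h by (simp add: A_def[abs_def])
  have "(\<lambda>i. compact_integral (A i) ?e) \<longlonglongrightarrow> laplace f lam"
    using has_laplace_tendsto_diagonal[OF has_laplace_laplace, of lam f h] lam Omega_abs_subset_Omega
    by (auto simp: A_def laplace_partial_def)
  moreover have "(\<lambda>i. compact_integral (A i \<inter> - H) ?e) \<longlonglongrightarrow> lcs_integral ?D ?e"
  proof -
    obtain K where "\<And>i. compact (K i)" "incseq K" "(\<Union>i::nat. K i) = ?D"
      unfolding H_def by (rule compact_exhaustion_orthant_diff[of h]) blast
    moreover have "- H \<in> sets lebesgue"
      using sets.compl_sets[OF H] by (simp add: Compl_eq_Diff_UNIV)
    from exhausts_Int[OF A this] have "exhausts (\<lambda>i. A i \<inter> - H) ?D"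
      by (simp add: Diff_eq)
    ultimately show ?thesis
      using lcs_integral_tendsto[OF eD] by blast
  qed
  ultimately have "(\<lambda>i. compact_integral (A i) ?e - compact_integral (A i \<inter> - H) ?e) \<longlonglongrightarrow>
      laplace f lam - lcs_integral ?D ?e"
    by (rule tendsto_diff_sclcs)
  moreover have "compact_integral (A i) ?e - compact_integral (A i \<inter> - H) ?e =
      compact_integral (cbox h ((\<chi> j. real i) + h)) ?e" for i
  proof -
    have "cbox h ((\<chi> j. real i) + h) \<subseteq> A i"
      unfolding A_def by (intro cbox_cart_mono) (simp_all add: h)
    then have cbox: "cbox h ((\<chi> j. real i) + h) = A i \<inter> H"
      by (auto simp: A_def H_def mem_box_cart)
    have "A i \<inter> H \<in> lmeasurable" "A i \<inter> - H \<in> lmeasurable"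
      using exhaustsD(1,2)[OF A, of i] H by (auto intro!: bounded_set_imp_lmeasurable simp: bounded_Int)
    moreover have "compact_integrable (A i) ?e"
      unfolding A_def by (rule compact_integrable_laplace_integrand[OF f])
    moreover have "(A i \<inter> H) \<union> (A i \<inter> - H) = A i" by blast
    ultimately have "compact_integral (A i) ?e = compact_integral (A i \<inter> H) ?e + compact_integral (A i \<inter> - H) ?e"
      using compact_integral_Un[of "A i \<inter> H" "A i \<inter> - H" ?e] by (simp add: Int_ac)
    then show ?thesis by (simp add: cbox)
  qed
  ultimately have lim: "(\<lambda>i. laplace_partial (\<lambda>t. f (t + h)) lam ((\<chi> j. real i) + 0)) \<longlonglongrightarrow>
      exp (pairing lam h) *\<^sub>C (laplace f lam - lcs_integral ?D ?e)"
    by (simp add: laplace_partial_forward_shift[OF f h] tendsto_scaleC[OF tendsto_const])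
  \<comment> \<open>The computation gives a limit along cubes only. Absolute convergence of the
    shifted function supplies the joint limit, which must then agree with it.\<close>
  have "lam \<in> Omega (\<lambda>t. f (t + h))"
    using Omega_abs_forward_shift[OF lam h] Omega_abs_subset_Omega by blast
  from LIMSEQ_unique[OF has_laplace_tendsto_diagonal[OF has_laplace_laplace[OF this]] lim]
  show "laplace (\<lambda>t. f (t + h)) lam = exp (pairing lam h) *\<^sub>C laplace f lam -
      exp (pairing lam h) *\<^sub>C lcs_integral ?D ?e"
    by (simp add: sclcs.scale_right_diff_distrib)
qed

subsection \<open>Operators\<close>

lemma
  fixes f :: "real ^ 'n \<Rightarrow> 'a::sclcs" and T :: "'a \<Rightarrow> 'b::sclcs"
  assumes T: "Vector_Spaces.linear (*\<^sub>C) (*\<^sub>C) T" "continuous_on UNIV T"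
  shows Omega_linear: "lam \<in> Omega f \<Longrightarrow> lam \<in> Omega (T \<circ> f)"
    and laplace_linear: "lam \<in> Omega f \<Longrightarrow> laplace (T \<circ> f) lam = T (laplace f lam)"
    and Omega_abs_linear: "lam \<in> Omega_abs f \<Longrightarrow> lam \<in> Omega_abs (T \<circ> f)"
proof -
  interpret T: Vector_Spaces.linear "(*\<^sub>C)" "(*\<^sub>C)" T by fact
  have integrand: "laplace_integrand (T \<circ> f) lam = (\<lambda>t. T (laplace_integrand f lam t))"
    by (simp add: T.scale fun_eq_iff)
  have loc: "locally_integrable orthant f \<Longrightarrow> locally_integrable orthant (T \<circ> f)"
    using locally_integrable_linear[OF _ T] by (simp add: comp_def)
  have has: "has_laplace (T \<circ> f) lam (T (laplace f lam))" if lam: "lam \<in> Omega f"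
    unfolding has_laplace_def
  proof (intro ballI allI impI)
    fix q :: "'b \<Rightarrow> real" and e :: real assume q: "q \<in> seminorms" and e: "e > 0"
    have f: "locally_integrable orthant f" using lam by (simp add: Omega_def)
    have partial: "laplace_partial (T \<circ> f) lam t = T (laplace_partial f lam t)" for t
      unfolding laplace_partial_def integrand
      by (rule compact_integral_linear[OF _ compact_integrable_laplace_integrand[OF f] T]) simp
    \<comment> \<open>Continuity is used at the single point \<open>laplace f lam\<close>: a
      \<open>q\<close>-ball around its image pulls back to a neighbourhood described by finitely
      many seminorms, each with its own threshold \<open>M p\<close>.\<close>
    let ?U = "T -` {y. q (y - T (laplace f lam)) < e} \<inter> UNIV"
    have "open ?U"
      using T(2) open_seminorm_ball[OF q] unfolding continuous_on_open_vimage[OF open_UNIV] by blast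
    moreover have "laplace f lam \<in> ?U"
      using e by (simp add: seminorm_zero q)
    ultimately obtain F d where F: "finite F" "F \<subseteq> seminorms" "d > 0"
        "{x. \<forall>p\<in>F. p (x - laplace f lam) < d} \<subseteq> ?U"
      by (rule nhds_basis_seminorms)
    have "\<forall>p\<in>F. \<exists>M>0. \<forall>t. (\<forall>j. t $ j > M) \<longrightarrow> p (laplace_partial f lam t - laplace f lam) < d"
      using has_laplace_laplace[OF lam] F(2,3) unfolding has_laplace_def by blast
    then obtain M where M: "\<And>p. p \<in> F \<Longrightarrow> M p > 0"
        "\<And>p t. p \<in> F \<Longrightarrow> (\<forall>j. t $ j > M p) \<Longrightarrow> p (laplace_partial f lam t - laplace f lam) < d"
      by metis
    \<comment> \<open>One threshold for all \<open>p\<close> in \<open>F\<close>; the summand 1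
      keeps it positive when \<open>F\<close> is empty.\<close>
    have "M p < 1 + sum M F" if "p \<in> F" for p
      using member_le_sum[of p F M] M(1) F(1) that by (force intro: less_imp_le)
    then have "p (laplace_partial f lam t - laplace f lam) < d"
      if "p \<in> F" "\<forall>j. t $ j > 1 + sum M F" for p t
      using M(2)[OF that(1), of t] that less_trans by blast
    then have "q (T (laplace_partial f lam t) - T (laplace f lam)) < e" if "\<forall>j. t $ j > 1 + sum M F" for t
      using F(4) that by blast
    moreover have "1 + sum M F > 0"
      using M(1) by (intro add_pos_nonneg sum_nonneg) (auto intro: less_imp_le)
    ultimately show "\<exists>M>0. \<forall>t. (\<forall>j. t $ j > M) \<longrightarrow> q (laplace_partial (T \<circ> f) lam t - T (laplace f lam)) < e"
      unfolding partial by blast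
  qed
  show "lam \<in> Omega f \<Longrightarrow> lam \<in> Omega (T \<circ> f)"
    using has loc by (auto simp: Omega_def)
  show "lam \<in> Omega f \<Longrightarrow> laplace (T \<circ> f) lam = T (laplace f lam)"
    using has by (rule laplace_eqI)
  assume lam: "lam \<in> Omega_abs f"
  have "(\<integral>\<^sup>+ t. ennreal (q (laplace_integrand (T \<circ> f) lam t)) \<partial>lebesgue_on orthant) < \<infinity>"
    if q: "q \<in> seminorms" for q
  proof -
    obtain F C where F: "finite F" "F \<subseteq> seminorms" "C \<ge> 0" "\<And>x. q (T x) \<le> C * (\<Sum>p\<in>F. p x)"
      using continuous_linear_bound[OF T q] by blast
    have p: "p \<in> seminorms" if "p \<in> F" for p using F(2) that by blast
    let ?e = "laplace_integrand f lam"
    have [measurable]: "(\<lambda>t. p (?e t)) \<in> borel_measurable (lebesgue_on orthant)" if "p \<in> F" for p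
      using lam p[OF that] by (intro boundedly_integrable_seminorm_measurable boundedly_integrable_laplace_integrand
          orthant_lebesgue) (auto simp: Omega_abs_def)
    have "(\<integral>\<^sup>+ t. ennreal (q (laplace_integrand (T \<circ> f) lam t)) \<partial>lebesgue_on orthant) \<le>
        (\<integral>\<^sup>+ t. ennreal C * (\<Sum>p\<in>F. ennreal (p (?e t))) \<partial>lebesgue_on orthant)"
      unfolding integrand[THEN fun_cong]
    proof (rule nn_integral_mono)
      fix t
      have "ennreal (q (T (?e t))) \<le> ennreal (C * (\<Sum>p\<in>F. p (?e t)))"
        using F(4) by (rule ennreal_leI)
      also have "\<dots> = ennreal C * ennreal (\<Sum>p\<in>F. p (?e t))"
        using F(3) by (intro ennreal_mult sum_nonneg) (simp_all add: seminorm_nonneg p)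
      also have "ennreal (\<Sum>p\<in>F. p (?e t)) = (\<Sum>p\<in>F. ennreal (p (?e t)))"
        by (intro sum_ennreal[symmetric]) (simp add: seminorm_nonneg p)
      finally show "ennreal (q (T (?e t))) \<le> ennreal C * (\<Sum>p\<in>F. ennreal (p (?e t)))" .
    qed
    also have "\<dots> = ennreal C * (\<Sum>p\<in>F. \<integral>\<^sup>+ t. ennreal (p (?e t)) \<partial>lebesgue_on orthant)"
      by (subst nn_integral_cmult, measurable, subst nn_integral_sum, measurable)
    also have "\<dots> < \<infinity>"
      using lam p F(1) by (auto simp: Omega_abs_def ennreal_mult_less_top)
    finally show ?thesis .
  qed
  with loc lam show "lam \<in> Omega_abs (T \<circ> f)"
    by (auto simp: Omega_abs_def)
qed

text \<open>The scalar exponential can be moved inside the operator pointwise, so each pair of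
  partial integrals lies in the graph; a closed set contains the limits of its sequences, and the
  growing cubes provide one.\<close>

lemma laplace_closed_mlo:
  fixes f :: "real ^ 'n \<Rightarrow> 'a::sclcs" and g :: "real ^ 'n \<Rightarrow> 'b::sclcs"
  assumes A: "closed_mlo A" and f: "lam \<in> Omega f" and g: "lam \<in> Omega g"
    and ae: "AE t in lebesgue_on orthant. g t \<in> A (f t)"
  shows "laplace g lam \<in> A (laplace f lam)"
proof -
  have lf: "locally_integrable orthant f" and lg: "locally_integrable orthant g"
    using f g by (auto simp: Omega_def)
  have mem: "laplace_partial g lam t \<in> A (laplace_partial f lam t)" for t
    unfolding laplace_partial_def
  proof (rule compact_integral_closed_mlo[OF _ compact_integrable_laplace_integrand[OF lf]
        compact_integrable_laplace_integrand[OF lg] A])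
    have "AE s in lebesgue. s \<in> orthant \<longrightarrow> g s \<in> A (f s)"
      using ae by (simp add: AE_restrict_space_iff orthant_lebesgue)
    then have "AE s in lebesgue. s \<in> cbox 0 t \<longrightarrow>
        exp (- pairing lam s) *\<^sub>C g s \<in> A (exp (- pairing lam s) *\<^sub>C f s)"
      by eventually_elim (use cbox_0_subset_orthant closed_mlo_graph(4)[OF A] in blast)
    then show "AE s in lebesgue_on (cbox 0 t).
        exp (- pairing lam s) *\<^sub>C g s \<in> A (exp (- pairing lam s) *\<^sub>C f s)"
      by (simp add: AE_restrict_space_iff)
  qed simp
  let ?T = "\<lambda>i::nat. (\<chi> j. real i) + (0 :: real ^ 'n)"
  have "(\<lambda>i. (laplace_partial f lam (?T i), laplace_partial g lam (?T i))) \<longlonglongrightarrow> (laplace f lam, laplace g lam)"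
    by (intro tendsto_Pair has_laplace_tendsto_diagonal has_laplace_laplace f g)
  moreover have "(laplace_partial f lam (?T i), laplace_partial g lam (?T i)) \<in> {(x, y). y \<in> A x}" for i
    using mem by simp
  ultimately have "(laplace f lam, laplace g lam) \<in> {(x, y). y \<in> A x}"
    using closed_mlo_graph(1)[OF A] by (intro Lim_in_closed_set[where F = sequentially]) auto
  then show ?thesis by simp
qed

section \<open>The five claims assembled\<close>

theorem theorem2p12:
  fixes f :: "real ^ 'n \<Rightarrow> 'x::sclcs"
  assumes n: "CARD('n) \<ge> 2"
    and f: "locally_integrable orthant f"
  shows
    "(\<forall>(h :: real ^ 'n) (lam :: complex ^ 'n).
        (\<forall>j. 0 \<le> h $ j) \<longrightarrow> lam \<in> Omega_abs f \<longrightarrow>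
        (let f_h = (\<lambda>t. f (t + h)); H = {t. \<forall>j. h $ j \<le> t $ j};
             e = (\<lambda>t. exp (- pairing lam t) *\<^sub>C f t)
         in lam \<in> Omega_abs f_h \<and>
            lcs_integrable (orthant - H) e \<and>
            laplace f_h lam =
              exp (pairing lam h) *\<^sub>C laplace f lam -
              exp (pairing lam h) *\<^sub>C lcs_integral (orthant - H) e))
     \<and>
     (\<forall>(h :: real ^ 'n) (lam :: complex ^ 'n).
        (\<forall>j. 0 \<le> h $ j) \<longrightarrow>
        (let f_hm = (\<lambda>t. if \<forall>j. h $ j \<le> t $ j then f (t - h) else 0)
         in (lam \<in> Omega_abs f \<longleftrightarrow> lam \<in> Omega_abs f_hm) \<and>
            (lam \<in> Omega f \<longleftrightarrow> lam \<in> Omega f_hm) \<and>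
            (lam \<in> Omega_abs f \<or> lam \<in> Omega f \<longrightarrow>
               laplace f_hm lam = exp (- pairing lam h) *\<^sub>C laplace f lam)))
     \<and>
     (\<forall>(T :: 'x \<Rightarrow> 'y::sclcs) (lam :: complex ^ 'n).
        Vector_Spaces.linear (*\<^sub>C) (*\<^sub>C) T \<and> continuous_on UNIV T \<longrightarrow>
        (lam \<in> Omega_abs f \<longrightarrow>
           lam \<in> Omega_abs (T \<circ> f) \<and> T (laplace f lam) = laplace (T \<circ> f) lam) \<and>
        (lam \<in> Omega f \<longrightarrow>
           lam \<in> Omega (T \<circ> f) \<and> T (laplace f lam) = laplace (T \<circ> f) lam))
     \<and>
     (\<forall>(z :: complex ^ 'n) (lam :: complex ^ 'n).
        (let f_z = (\<lambda>t. exp (- pairing z t) *\<^sub>C f t)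
         in (lam + z \<in> Omega_abs f \<longleftrightarrow> lam \<in> Omega_abs f_z) \<and>
            (lam + z \<in> Omega f \<longleftrightarrow> lam \<in> Omega f_z) \<and>
            (lam + z \<in> Omega_abs f \<or> lam + z \<in> Omega f \<longrightarrow>
               laplace f_z lam = laplace f (lam + z))))
     \<and>
     (\<forall>(A :: 'x \<Rightarrow> 'y set) (g :: real ^ 'n \<Rightarrow> 'y) (lam :: complex ^ 'n).
        closed_mlo A \<longrightarrow> locally_integrable orthant g \<longrightarrow>
        (AE t in lebesgue_on orthant. g t \<in> A (f t)) \<longrightarrow>
        lam \<in> Omega f \<inter> Omega g \<longrightarrow>
        laplace g lam \<in> A (laplace f lam))"
proof (intro conjI)
  show "\<forall>(h :: real ^ 'n) (lam :: complex ^ 'n).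
        (\<forall>j. 0 \<le> h $ j) \<longrightarrow> lam \<in> Omega_abs f \<longrightarrow>
        (let f_h = (\<lambda>t. f (t + h)); H = {t. \<forall>j. h $ j \<le> t $ j};
             e = (\<lambda>t. exp (- pairing lam t) *\<^sub>C f t)
         in lam \<in> Omega_abs f_h \<and>
            lcs_integrable (orthant - H) e \<and>
            laplace f_h lam =
              exp (pairing lam h) *\<^sub>C laplace f lam -
              exp (pairing lam h) *\<^sub>C lcs_integral (orthant - H) e)"
    unfolding Let_def by (intro allI impI conjI Omega_abs_forward_shift laplace_forward_shift) auto
next
  have "laplace (backward_shift h f) lam = exp (- pairing lam h) *\<^sub>C laplace f lam"
    if "\<And>j. 0 \<le> h $ j" "lam \<in> Omega f" for h :: "real ^ 'n" and lam
    by (intro laplace_eqI has_laplace_backward_shift f that has_laplace_laplace)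
  then show "\<forall>(h :: real ^ 'n) (lam :: complex ^ 'n).
        (\<forall>j. 0 \<le> h $ j) \<longrightarrow>
        (let f_hm = (\<lambda>t. if \<forall>j. h $ j \<le> t $ j then f (t - h) else 0)
         in (lam \<in> Omega_abs f \<longleftrightarrow> lam \<in> Omega_abs f_hm) \<and>
            (lam \<in> Omega f \<longleftrightarrow> lam \<in> Omega f_hm) \<and>
            (lam \<in> Omega_abs f \<or> lam \<in> Omega f \<longrightarrow>
               laplace f_hm lam = exp (- pairing lam h) *\<^sub>C laplace f lam))"
    using Omega_abs_backward_shift_iff[OF f] Omega_backward_shift_iff[OF f] Omega_abs_subset_Omega[of f]
    unfolding Let_def backward_shift_def[abs_def] by blast
next
  show "\<forall>(T :: 'x \<Rightarrow> 'y) (lam :: complex ^ 'n).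
        Vector_Spaces.linear (*\<^sub>C) (*\<^sub>C) T \<and> continuous_on UNIV T \<longrightarrow>
        (lam \<in> Omega_abs f \<longrightarrow>
           lam \<in> Omega_abs (T \<circ> f) \<and> T (laplace f lam) = laplace (T \<circ> f) lam) \<and>
        (lam \<in> Omega f \<longrightarrow>
           lam \<in> Omega (T \<circ> f) \<and> T (laplace f lam) = laplace (T \<circ> f) lam)"
    using Omega_abs_linear Omega_linear laplace_linear Omega_abs_subset_Omega[of f] by (metis subsetD)
next
  \<comment> \<open>The integrand of \<open>f_z\<close> at \<open>lam\<close> is literally that of
    \<open>f\<close> at \<open>lam + z\<close>, so partial integrals, limits and absolute
    convergence coincide and (iv) follows by rewriting.\<close>
  have shift: "laplace_integrand (\<lambda>t. exp (- pairing z t) *\<^sub>C f t) lam = laplace_integrand f (lam + z)"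
    for z lam :: "complex ^ 'n"
    by (simp add: scaleC_scaleC pairing_add_left fun_eq_iff flip: exp_add)
  have loc: "locally_integrable orthant (laplace_integrand f z)" for z
    by (rule locally_integrable_laplace_integrand[OF f])
  have has: "has_laplace (laplace_integrand f z) lam = has_laplace f (lam + z)" for z lam
    unfolding has_laplace_def[abs_def] laplace_partial_def shift ..
  show "\<forall>(z :: complex ^ 'n) (lam :: complex ^ 'n).
        (let f_z = (\<lambda>t. exp (- pairing z t) *\<^sub>C f t)
         in (lam + z \<in> Omega_abs f \<longleftrightarrow> lam \<in> Omega_abs f_z) \<and>
            (lam + z \<in> Omega f \<longleftrightarrow> lam \<in> Omega f_z) \<and>
            (lam + z \<in> Omega_abs f \<or> lam + z \<in> Omega f \<longrightarrow>
               laplace f_z lam = laplace f (lam + z)))"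
    unfolding Let_def Omega_abs_iff Omega_def laplace_def has shift by (simp add: f loc)
next
  show "\<forall>(A :: 'x \<Rightarrow> 'y set) (g :: real ^ 'n \<Rightarrow> 'y) (lam :: complex ^ 'n).
        closed_mlo A \<longrightarrow> locally_integrable orthant g \<longrightarrow>
        (AE t in lebesgue_on orthant. g t \<in> A (f t)) \<longrightarrow>
        lam \<in> Omega f \<inter> Omega g \<longrightarrow>
        laplace g lam \<in> A (laplace f lam)"
    using laplace_closed_mlo by blast
qed

end
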